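(* Let $\mu\in(0,1]$, $\bar t^\mu\doteq\mu(2m/\kappa)^{1/2}$ and $c\ge0$. Let $\mathcal{P}^{\mu,c},\mathcal{Q}^{\mu,c},\mathcal{R}^{\mu,c}:[0,\bar t^\mu)\to\mathcal{L}(\mathcal{X}_{1/2})$ be operator-valued functions satisfying on $[0,\bar t^\mu)$ the operator differential equations $$\dot{\mathcal{P}}^{\mu,c}(t)=\kappa\,\mathcal{I}+\tfrac1m\,\mathcal{P}^{\mu,c}(t)\mathcal{A}^{1/2}\mathcal{I}_\mu\mathcal{A}^{1/2}\mathcal{P}^{\mu,c}(t),\qquad\mathcal{P}^{\mu,c}(0)=-c\,\mathcal{M}_\mu,$$ $$\dot{\mathcal{Q}}^{\mu,c}(t)=\tfrac1m\,\mathcal{P}^{\mu,c}(t)\mathcal{A}^{1/2}\mathcal{I}_\mu\mathcal{A}^{1/2}\mathcal{Q}^{\mu,c}(t),\qquad\mathcal{Q}^{\mu,c}(0)=+c\,\mathcal{M}_\mu,$$ $$\dot{\mathcal{R}}^{\mu,c}(t)=\tfrac1m\,\mathcal{Q}^{\mu,c}(t)'\mathcal{A}^{1/2}\mathcal{I}_\mu\mathcal{A}^{1/2}\mathcal{Q}^{\mu,c}(t),\qquad\mathcal{R}^{\mu,c}(0)=-c\,\mathcal{M}_\mu,$$ where $\mathcal{M}_\mu=\mathcal{K}_\mu'\mathcal{K}_\mu$ and $'$ denotes the adjoint in $\mathcal{X}_{1/2}$, and define $$\breve W^{\mu,c}(t,x,z)=\tfrac12\langle x,\mathcal{P}^{\mu,c}(t)x\rangle_{1/2}+\langle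 x,\mathcal{Q}^{\mu,c}(t)z\rangle_{1/2}+\tfrac12\langle z,\mathcal{R}^{\mu,c}(t)z\rangle_{1/2}.$$ Then $W^{\mu,c}(t,x,z)=\breve W^{\mu,c}(t,x,z)$ for all $t\in[0,\bar t^\mu)$ and $x,z\in\mathcal{X}_{1/2}$, where $W^{\mu,c}(t,x,z)=\sup_{w\in\mathcal{W}[0,t]}J^\mu_{m,\psi^{\mu,c}(\cdot,z)}(t,x,w)$.
   Context: Fix constants $L,\kappa,m>0$ and $\Lambda=(0,L)$. $\mathcal{X}=L^2(\Lambda;\mathbb{R})$ with the standard inner product $\langle\cdot,\cdot\rangle$ and norm $\|\cdot\|$. $\mathcal{X}_0=\{x\in\mathcal{X}: x,\partial x \text{ absolutely continuous},\ x(0)=0=x(L),\ \partial^2x\in\mathcal{X}\}$. $\mathcal{A}x=-\partial^2x$ with domain $\mathcal{X}_0$; it is a self-adjoint, positive, boundedly invertible operator on $\mathcal{X}$, with unique positive self-adjoint square root $\mathcal{A}^{1/2}$, and $\mathcal{J}\doteq(\mathcal{A}^{1/2})^{-1}$. $\mathcal{X}_{1/2}=\mathrm{dom}(\mathcal{A}^{1/2})$ is a Hilbert space with $\langle x,\xi\rangle_{1/2}=\langle\mathcal{A}^{1/2}x,\mathcal{A}^{1/2}\xi\rangle$ and norm $\|\cdot\|_{1/2}$; $\mathcal{L}(\mathcal{X}_{1/2})$ denotes the bounded linear operators on it. $\mathcal{I}$ is the identity; $\mathcal{I}_\mu=(\mathcal{I}+\mu^2\mathcal{A})^{-1}$, bounded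 on $\mathcal{X}$ with range $\mathcal{X}_0$, so $\mathcal{A}^{1/2}\mathcal{I}_\mu\mathcal{A}^{1/2}$ maps $\mathcal{X}_{1/2}$ boundedly to itself. Time derivatives of operator-valued functions are Fréchet derivatives in operator norm (one-sided at $t=0$). $\mathcal{W}[0,t]=L^2([0,t];\mathcal{X}_{1/2})$. For $w\in\mathcal{X}_{1/2}$, $\mathcal{J}^\mu w=(\mathcal{J}w,\mu w)$ and $\|\mathcal{J}^\mu w\|_{1/2}^2=\|\mathcal{J}w\|_{1/2}^2+\mu^2\|w\|_{1/2}^2$. For $M>0$ and a terminal payoff $\psi$, $$J^\mu_{M,\psi}(t,x,w)=\int_0^t\Big(\tfrac{\kappa}{2}\|\xi(s)\|_{1/2}^2-\tfrac{M}{2}\|\mathcal{J}^\mu w(s)\|_{1/2}^2\Big)ds+\psi(\xi(t)),\qquad \xi(s)=x+\int_0^sw(\sigma)\,d\sigma.$$ $\mathcal{K}_\mu$ is a fixed bounded, boundedly invertible linear operator on $\mathcal{X}_{1/2}$ and $\psi^{\mu,c}(x,z)=-\tfrac{c}{2}\|\mathcal{K}_\mu(x-z)\|_{1/2}^2$. Standing assumption: with a fixed $\underline{m}\in(0,m)$ and $\overline{W}^\mu(t,x)\doteq\sup_{w\in\mathcal{W}[0,t]}J^\mu_{\underline{m},0}(t,x,w)$ (zero terminal payoff), $\overline{W}^\mu(t,x)<\infty$ for all $\mu\in(0,1]$, $t\in(0,\bar t^\mu)$, $x\in\mathcal{X}_{1/2}$. *)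

theory Defs
  imports "HOL-Analysis.Analysis"
begin

text \<open>The type \<open>l2\<close> is the separable real Hilbert space $L^2(\mathbb{R})$, as a quotient by
  almost everywhere equality.  The space $L^2(0,L)$, whose parameter $L$ cannot index a type, is
  identified below with its subspace of functions vanishing almost everywhere outside $(0,L)$.
  Completeness and second countability of \<open>l2\<close> make the Bochner integral of the library available
  for functions with values in \<open>l2\<close>.\<close>

definition sq_integrable :: "(real \<Rightarrow> real) \<Rightarrow> bool" where
  "sq_integrable f \<longleftrightarrow> f \<in> borel_measurable lborel \<and> integrable lborel (\<lambda>s. (f s)\<^sup>2)"

definition l2_rel :: "(real \<Rightarrow> real) \<Rightarrow> (real \<Rightarrow> real) \<Rightarrow> bool" where
  "l2_rel f g \<longleftrightarrow> sq_integrable f \<and> sq_integrable g \<and> (AE s in lborel. f s = g s)"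

lemma sq_integrable_zero [simp]: "sq_integrable (\<lambda>s. 0)"
  by (simp add: sq_integrable_def)

lemma sq_integrable_mult:
  assumes "sq_integrable f" "sq_integrable g"
  shows "integrable lborel (\<lambda>s. f s * g s)"
proof (rule Bochner_Integration.integrable_bound)
  show "integrable lborel (\<lambda>s. (f s)\<^sup>2 + (g s)\<^sup>2)"
    using assms by (auto simp: sq_integrable_def)
  show "(\<lambda>s. f s * g s) \<in> borel_measurable lborel"
    using assms by (auto simp: sq_integrable_def)
  have "\<bar>f s * g s\<bar> \<le> (f s)\<^sup>2 + (g s)\<^sup>2" for s
    using sum_squares_bound[of "\<bar>f s\<bar>" "\<bar>g s\<bar>"] mult_nonneg_nonneg[OF abs_ge_zero abs_ge_zero, of "f s" "g s"]
    unfolding abs_mult power2_abs by linarith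
  then show "AE s in lborel. norm (f s * g s) \<le> norm ((f s)\<^sup>2 + (g s)\<^sup>2)"
    by simp
qed

lemma sq_integrable_add:
  assumes "sq_integrable f" "sq_integrable g"
  shows "sq_integrable (\<lambda>s. f s + g s)"
proof -
  have "integrable lborel (\<lambda>s. (f s)\<^sup>2 + (g s)\<^sup>2 + 2 * (f s * g s))"
    using assms sq_integrable_mult[OF assms] unfolding sq_integrable_def by auto
  then show ?thesis
    using assms unfolding sq_integrable_def by (auto simp: power2_sum mult.assoc)
qed

lemma sq_integrable_scale:
  assumes "sq_integrable f"
  shows "sq_integrable (\<lambda>s. c * f s)"
  using assms unfolding sq_integrable_def by (auto simp: power_mult_distrib)

lemma sq_integrable_diff:
  assumes "sq_integrable f" "sq_integrable g"
  shows "sq_integrable (\<lambda>s. f s - g s)"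
  using sq_integrable_add[OF assms(1) sq_integrable_scale[OF assms(2), of "-1"]] by simp

lemma sq_integrable_bound:
  assumes "sq_integrable g" "f \<in> borel_measurable lborel" "AE s in lborel. \<bar>f s\<bar> \<le> \<bar>g s\<bar>"
  shows "sq_integrable f"
  unfolding sq_integrable_def
proof
  show "integrable lborel (\<lambda>s. (f s)\<^sup>2)"
  proof (rule Bochner_Integration.integrable_bound)
    show "integrable lborel (\<lambda>s. (g s)\<^sup>2)" using assms by (simp add: sq_integrable_def)
    show "AE s in lborel. norm ((f s)\<^sup>2) \<le> norm ((g s)\<^sup>2)"
      using assms(3) by eventually_elim (simp add: abs_le_square_iff)
  qed (use assms in auto)
qed (use assms in auto)

quotient_type l2 = "real \<Rightarrow> real" / partial: l2_rel
  morphisms rep_l2 l2_class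
proof (rule part_equivpI)
  show "\<exists>f. l2_rel f f" by (auto simp: l2_rel_def intro!: exI[of _ "\<lambda>_. 0"])
  show "symp l2_rel" by (auto simp: symp_def l2_rel_def elim: eventually_mono)
  show "transp l2_rel"
    by (auto simp: transp_def l2_rel_def elim: eventually_elim2)
qed

lemma rep_sq [simp]: "sq_integrable (rep_l2 x)"
  using Quotient3_rep_reflp[OF Quotient3_l2] by (auto simp: l2_rel_def)

lemma class_rep [simp]: "l2_class (rep_l2 x) = x"
  by (rule Quotient3_abs_rep[OF Quotient3_l2])

lemma class_eq_iff:
  "sq_integrable f \<Longrightarrow> sq_integrable g \<Longrightarrow> l2_class f = l2_class g \<longleftrightarrow> (AE s in lborel. f s = g s)"
  using Quotient3_rel[OF Quotient3_l2, of f g] by (auto simp: l2_rel_def)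

lemma rep_class:
  "sq_integrable f \<Longrightarrow> AE s in lborel. rep_l2 (l2_class f) s = f s"
  using class_eq_iff[of "rep_l2 (l2_class f)" f] by simp

instantiation l2 :: real_vector
begin

lift_definition zero_l2 :: l2 is "\<lambda>s. 0" by (simp add: l2_rel_def)
lift_definition plus_l2 :: "l2 \<Rightarrow> l2 \<Rightarrow> l2" is "\<lambda>f g s. f s + g s"
  by (auto simp: l2_rel_def sq_integrable_add elim: eventually_elim2)
lift_definition scaleR_l2 :: "real \<Rightarrow> l2 \<Rightarrow> l2" is "\<lambda>c f s. c * f s"
  by (auto simp: l2_rel_def sq_integrable_scale)
lift_definition minus_l2 :: "l2 \<Rightarrow> l2 \<Rightarrow> l2" is "\<lambda>f g s. f s - g s"
  by (auto simp: l2_rel_def sq_integrable_diff elim: eventually_elim2)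
lift_definition uminus_l2 :: "l2 \<Rightarrow> l2" is "\<lambda>f s. - f s"
  using sq_integrable_scale[of _ "-1"] by (auto simp: l2_rel_def)
instance
proof
  fix x y z :: l2 and a b :: real
  show "x + y + z = x + (y + z)"
    by transfer (auto simp: l2_rel_def add.assoc intro!: sq_integrable_add)
  show "x + y = y + x"
    by transfer (auto simp: l2_rel_def add.commute intro!: sq_integrable_add)
  show "0 + x = x"
    by transfer (auto simp: l2_rel_def)
  show "- x + x = 0"
    by transfer (auto simp: l2_rel_def)
  show "x - y = x + - y"
    by transfer (auto simp: l2_rel_def sq_integrable_diff)
  show "a *\<^sub>R (x + y) = a *\<^sub>R x + a *\<^sub>R y"
    by transfer (auto simp: l2_rel_def distrib_left intro!: sq_integrable_add sq_integrable_scale)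
  show "(a + b) *\<^sub>R x = a *\<^sub>R x + b *\<^sub>R x"
    by transfer (auto simp: l2_rel_def distrib_right intro!: sq_integrable_add sq_integrable_scale)
  show "a *\<^sub>R b *\<^sub>R x = (a * b) *\<^sub>R x"
    by transfer (auto simp: l2_rel_def mult.assoc intro!: sq_integrable_scale)
  show "1 *\<^sub>R x = x"
    by transfer (auto simp: l2_rel_def)
qed

end

instantiation l2 :: real_inner
begin

lift_definition inner_l2 :: "l2 \<Rightarrow> l2 \<Rightarrow> real" is "\<lambda>f g. LBINT s. f s * g s"
proof -
  fix f f' g g' :: "real \<Rightarrow> real"
  assume "l2_rel f f'" "l2_rel g g'"
  then show "(LBINT s. f s * g s) = (LBINT s. f' s * g' s)"
    by (intro integral_cong_AE) (auto simp: l2_rel_def sq_integrable_def elim: eventually_elim2)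
qed
definition norm_l2 :: "l2 \<Rightarrow> real" where "norm_l2 x = sqrt (inner x x)"
definition dist_l2 :: "l2 \<Rightarrow> l2 \<Rightarrow> real" where "dist_l2 x y = norm (x - y)"
definition sgn_l2 :: "l2 \<Rightarrow> l2" where "sgn_l2 x = x /\<^sub>R norm x"
definition uniformity_l2 :: "(l2 \<times> l2) filter" where
  "uniformity_l2 = (INF e\<in>{0<..}. principal {(x, y). dist x y < e})"
definition open_l2 :: "l2 set \<Rightarrow> bool" where
  "open_l2 U = (\<forall>x\<in>U. eventually (\<lambda>(x', y). x' = x \<longrightarrow> y \<in> U) uniformity)"

instance
proof
  fix x y z :: l2 and a b :: real
  show "dist x y = norm (x - y)" by (rule dist_l2_def)
  show "sgn x = x /\<^sub>R norm x" by (rule sgn_l2_def)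
  show "uniformity = (INF e\<in>{0<..}. principal {(x, y :: l2). dist x y < e})"
    by (rule uniformity_l2_def)
  show "open U = (\<forall>x\<in>U. \<forall>\<^sub>F (x', y) in uniformity. x' = x \<longrightarrow> y \<in> U)" for U :: "l2 set"
    by (rule open_l2_def)
  show "inner x y = inner y x"
    by transfer (simp add: mult.commute)
  show "inner (x + y) z = inner x z + inner y z"
    by transfer (auto simp: l2_rel_def distrib_right sq_integrable_mult)
  show "inner (a *\<^sub>R x) y = a * inner x y"
    by transfer (auto simp: l2_rel_def mult.assoc)
  show "0 \<le> inner x x"
    by transfer (auto intro: Bochner_Integration.integral_nonneg)
  show "inner x x = 0 \<longleftrightarrow> x = 0"
  proof transfer
    fix f assume f: "l2_rel f f"
    then have "(LBINT s. (f s)\<^sup>2) = 0 \<longleftrightarrow> (AE s in lborel. (f s)\<^sup>2 = 0)"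
      by (intro integral_nonneg_eq_0_iff_AE) (auto simp: l2_rel_def sq_integrable_def)
    then show "((LBINT s. f s * f s) = 0) = l2_rel f (\<lambda>s. 0)"
      using f by (simp add: l2_rel_def power2_eq_square)
  qed
  show "norm x = sqrt (inner x x)" by (rule norm_l2_def)
qed

end

lemma class_add: "sq_integrable f \<Longrightarrow> sq_integrable g \<Longrightarrow> l2_class f + l2_class g = l2_class (\<lambda>s. f s + g s)"
  by (rule plus_l2.abs_eq) (auto simp: l2_rel_def)
lemma class_diff: "sq_integrable f \<Longrightarrow> sq_integrable g \<Longrightarrow> l2_class f - l2_class g = l2_class (\<lambda>s. f s - g s)"
  by (rule minus_l2.abs_eq) (auto simp: l2_rel_def)
lemma class_scale: "sq_integrable f \<Longrightarrow> c *\<^sub>R l2_class f = l2_class (\<lambda>s. c * f s)"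
  by (rule scaleR_l2.abs_eq) (auto simp: l2_rel_def)
lemma zero_class: "l2_class (\<lambda>s. 0) = 0"
  using class_scale[of "\<lambda>s. 0" 0] by simp
lemma zero_class_ind [simp]: "l2_class (indicat_real {}) = 0"
proof -
  have "indicat_real ({} :: real set) = (\<lambda>s. 0)" by (auto simp: indicator_def)
  then show ?thesis using zero_class by simp
qed
lemma inner_class: "sq_integrable f \<Longrightarrow> sq_integrable g \<Longrightarrow> inner (l2_class f) (l2_class g) = (LBINT s. f s * g s)"
  by (rule inner_l2.abs_eq) (auto simp: l2_rel_def)
lemma norm_class: "sq_integrable f \<Longrightarrow> (norm (l2_class f))\<^sup>2 = (LBINT s. (f s)\<^sup>2)"
  unfolding power2_norm_eq_inner by (simp add: inner_class power2_eq_square)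

lemma l2_dominated_convergence:
  assumes U: "\<And>i. U i \<in> borel_measurable lborel" and g: "sq_integrable g"
    and bd: "\<And>i. AE s in lborel. \<bar>U i s\<bar> \<le> g s"
    and u: "u \<in> borel_measurable lborel"
    and lim: "AE s in lborel. (\<lambda>i. U i s) \<longlonglongrightarrow> u s"
  shows "sq_integrable u" "\<And>i. sq_integrable (U i)"
    "(\<lambda>i. l2_class (U i)) \<longlonglongrightarrow> l2_class u"
proof -
  show sU: "sq_integrable (U i)" for i
    by (rule sq_integrable_bound[OF g U]) (use bd[of i] in eventually_elim, simp)
  have "AE s in lborel. \<forall>i. \<bar>U i s\<bar> \<le> g s"
    using bd by (simp add: AE_all_countable)
  then have bu: "AE s in lborel. \<bar>u s\<bar> \<le> g s"
    using lim
  proof eventually_elim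
    case (elim s)
    then have "(\<lambda>i. \<bar>U i s\<bar>) \<longlonglongrightarrow> \<bar>u s\<bar>" by (intro tendsto_intros)
    then show ?case using elim(1) by (intro LIMSEQ_le_const2[of _ "\<bar>u s\<bar>" "g s"]) auto
  qed
  show su: "sq_integrable u"
    by (rule sq_integrable_bound[OF g u]) (use bu in eventually_elim, simp)
  have "(\<lambda>i. LBINT s. (U i s - u s)\<^sup>2) \<longlonglongrightarrow> integral\<^sup>L lborel (\<lambda>s::real. 0::real)"
  proof (rule integral_dominated_convergence[where w="\<lambda>s. (2 * g s)\<^sup>2"])
    show "integrable lborel (\<lambda>s. (2 * g s)\<^sup>2)"
      using sq_integrable_scale[OF g, of 2] by (simp add: sq_integrable_def)
    show "AE s in lborel. (\<lambda>i. (U i s - u s)\<^sup>2) \<longlonglongrightarrow> 0"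
      using lim
    proof eventually_elim
      case (elim s)
      then have "(\<lambda>i. (U i s - u s)\<^sup>2) \<longlonglongrightarrow> (u s - u s)\<^sup>2" by (intro tendsto_intros)
      then show ?case by simp
    qed
    show "AE s in lborel. norm ((U i s - u s)\<^sup>2) \<le> (2 * g s)\<^sup>2" for i
      using bd[of i] bu
    proof eventually_elim
      case (elim s)
      then have "\<bar>U i s - u s\<bar> \<le> \<bar>2 * g s\<bar>" by linarith
      then show ?case by (simp only: abs_le_square_iff) simp
    qed
  qed (use U u in auto)
  then have "(\<lambda>i. (norm (l2_class (U i) - l2_class u))\<^sup>2) \<longlonglongrightarrow> 0"
    using sU su by (simp add: class_diff norm_class sq_integrable_diff)
  then have "(\<lambda>i. sqrt ((norm (l2_class (U i) - l2_class u))\<^sup>2)) \<longlonglongrightarrow> sqrt 0"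
    by (rule tendsto_real_sqrt)
  then have "(\<lambda>i. norm (l2_class (U i) - l2_class u)) \<longlonglongrightarrow> 0" by simp
  then show "(\<lambda>i. l2_class (U i)) \<longlonglongrightarrow> l2_class u"
    using LIM_zero_iff tendsto_norm_zero_iff by blast
qed

instance l2 :: complete_space
proof
  fix X :: "nat \<Rightarrow> l2"
  assume C: "Cauchy X"
  have "\<exists>N. \<forall>m\<ge>N. \<forall>n\<ge>N. norm (X m - X n) < (1/4)^k" for k :: nat
    using CauchyD[OF C, of "(1/4)^k"] by simp
  then obtain N where N: "\<And>k m n. m \<ge> N k \<Longrightarrow> n \<ge> N k \<Longrightarrow> norm (X m - X n) < (1/4)^k"
    by metis
  define r where "r k = k + (\<Sum>i\<le>k. N i)" for k
  have r_mono: "strict_mono r" by (auto simp: strict_mono_Suc_iff r_def)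
  have rN: "N k \<le> r j" if "k \<le> j" for k j
    using member_le_sum[of k "{..j}" N] that by (auto simp: r_def)
  define f where "f k = rep_l2 (X (r k))" for k
  have sf: "sq_integrable (f k)" for k by (simp add: f_def)
  have fX: "l2_class (f k) = X (r k)" for k by (simp add: f_def)
  have fm [measurable]: "f k \<in> borel_measurable lborel" for k using sf[of k] by (simp add: sq_integrable_def)
  have d: "(LBINT s. (f j s - f k s)\<^sup>2) \<le> (1/16)^k" if "k \<le> j" for j k
  proof -
    have "(LBINT s. (f j s - f k s)\<^sup>2) = (norm (X (r j) - X (r k)))\<^sup>2"
      using norm_class[OF sq_integrable_diff[OF sf sf, of j k]] sf by (simp add: class_diff[symmetric] fX)
    also have "\<dots> \<le> ((1/4)^k)\<^sup>2"
      using N[of k "r j" "r k"] rN[OF that] rN[of k k] by (intro power_mono) auto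
    also have "\<dots> = (1/16::real)^k" by (simp add: power_mult_distrib[symmetric] power2_eq_square)
    finally show ?thesis .
  qed
  have nd: "(\<integral>\<^sup>+s. ennreal ((f j s - f k s)\<^sup>2) \<partial>lborel) \<le> ennreal ((1/16)^k)" if "k \<le> j" for j k
    using d[OF that] sq_integrable_diff[OF sf sf, of j k]
    by (subst nn_integral_eq_integral) (auto simp: sq_integrable_def intro: ennreal_leI)
  have "(\<integral>\<^sup>+s. (\<Sum>k. ennreal (4^k) * ennreal ((f (Suc k) s - f k s)\<^sup>2)) \<partial>lborel)
      = (\<Sum>k. ennreal (4^k) * (\<integral>\<^sup>+s. ennreal ((f (Suc k) s - f k s)\<^sup>2) \<partial>lborel))"
    by (subst nn_integral_suminf) (auto simp: nn_integral_cmult)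
  also have "\<dots> \<le> (\<Sum>k. ennreal ((1/4)^k))"
  proof (intro suminf_le allI)
    fix k
    have "ennreal (4^k) * (\<integral>\<^sup>+s. ennreal ((f (Suc k) s - f k s)\<^sup>2) \<partial>lborel) \<le> ennreal (4^k) * ennreal ((1/16)^k)"
      by (intro mult_left_mono nd) auto
    also have "\<dots> = ennreal (4^k * (1/16)^k)" by (simp add: ennreal_mult)
    also have "(4::real)^k * (1/16)^k = (1/4)^k" by (simp add: power_mult_distrib[symmetric])
    finally show "ennreal (4^k) * (\<integral>\<^sup>+s. ennreal ((f (Suc k) s - f k s)\<^sup>2) \<partial>lborel) \<le> ennreal ((1/4)^k)" .
  qed auto
  also have "\<dots> < \<infinity>"
    using geometric_sums[of "1/4::real"] by (subst suminf_ennreal_eq[where x="1/(1-1/4)"]) auto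
  finally have "(\<integral>\<^sup>+s. (\<Sum>k. ennreal (4^k) * ennreal ((f (Suc k) s - f k s)\<^sup>2)) \<partial>lborel) \<noteq> \<infinity>" by simp
  then have "AE s in lborel. (\<Sum>k. ennreal (4^k) * ennreal ((f (Suc k) s - f k s)\<^sup>2)) \<noteq> \<infinity>"
    by (intro nn_integral_PInf_AE) auto
  then have conv: "AE s in lborel. convergent (\<lambda>k. f k s)"
  proof eventually_elim
    case (elim s)
    have "(\<Sum>k. ennreal (4^k * (f (Suc k) s - f k s)\<^sup>2)) \<noteq> \<infinity>"
      using elim by (simp add: ennreal_mult)
    then have "summable (\<lambda>k. 4^k * (f (Suc k) s - f k s)\<^sup>2)"
      by (intro summable_suminf_not_top) auto
    then have "(\<lambda>k. 4^k * (f (Suc k) s - f k s)\<^sup>2) \<longlonglongrightarrow> 0" by (rule summable_LIMSEQ_zero)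
    then have "eventually (\<lambda>k. 4^k * (f (Suc k) s - f k s)\<^sup>2 < 1) sequentially"
      by (rule order_tendstoD) simp
    then have "eventually (\<lambda>k. norm (f (Suc k) s - f k s) \<le> (1/2)^k) sequentially"
    proof eventually_elim
      case (elim k)
      have four_pow: "((2::real)^k)\<^sup>2 = 4^k"
        by (simp add: power_mult[symmetric] mult.commute[of k 2] power_mult)
      have "(2^k * \<bar>f (Suc k) s - f k s\<bar>)\<^sup>2 < 1\<^sup>2"
        using elim by (simp add: power_mult_distrib four_pow)
      then have "2^k * \<bar>f (Suc k) s - f k s\<bar> < 1"
        by (rule power_less_imp_less_base) simp
      then show ?case by (simp add: field_simps)
    qed
    then have "summable (\<lambda>k. f (Suc k) s - f k s)"
      by (rule summable_comparison_test_ev) (auto intro: summable_geometric)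
    then have "convergent (\<lambda>n. (\<Sum>k<n. f (Suc k) s - f k s) + f 0 s)"
      by (intro convergent_add convergent_const) (simp add: summable_iff_convergent)
    then show ?case using sum_lessThan_telescope[of "\<lambda>k. f k s"] by simp
  qed
  define F where "F s = lim (\<lambda>k. f k s)" for s
  have Fm [measurable]: "F \<in> borel_measurable lborel"
    unfolding F_def by (rule borel_measurable_lim_metric) simp
  have lim: "AE s in lborel. (\<lambda>k. f k s) \<longlonglongrightarrow> F s"
    using conv by eventually_elim (simp add: F_def convergent_LIMSEQ_iff)
  have nF: "(\<integral>\<^sup>+s. ennreal ((F s - f k s)\<^sup>2) \<partial>lborel) \<le> ennreal ((1/16)^k)" for k
  proof -
    have "(\<integral>\<^sup>+s. ennreal ((F s - f k s)\<^sup>2) \<partial>lborel)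
        = (\<integral>\<^sup>+s. liminf (\<lambda>j. ennreal ((f j s - f k s)\<^sup>2)) \<partial>lborel)"
    proof (rule nn_integral_cong_AE, use lim in eventually_elim)
      case (elim s)
      have "(\<lambda>j. ennreal ((f j s - f k s)\<^sup>2)) \<longlonglongrightarrow> ennreal ((F s - f k s)\<^sup>2)"
        by (intro tendsto_ennrealI tendsto_intros elim)
      from lim_imp_Liminf[OF _ this] show ?case by simp
    qed
    also have "\<dots> \<le> liminf (\<lambda>j. \<integral>\<^sup>+s. ennreal ((f j s - f k s)\<^sup>2) \<partial>lborel)"
      by (rule nn_integral_liminf) simp
    also have "\<dots> \<le> limsup (\<lambda>j. \<integral>\<^sup>+s. ennreal ((f j s - f k s)\<^sup>2) \<partial>lborel)"
      by (intro Liminf_le_Limsup) simp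
    also have "\<dots> \<le> ennreal ((1/16)^k)"
      by (intro Limsup_bounded) (auto intro!: eventually_sequentiallyI[of k] nd)
    finally show ?thesis .
  qed
  have sFd: "sq_integrable (\<lambda>s. F s - f k s)" for k
    unfolding sq_integrable_def
  proof
    show "integrable lborel (\<lambda>s. (F s - f k s)\<^sup>2)"
      using nF[of k] by (intro integrableI_nonneg) (auto simp: less_top[symmetric] top_unique intro: le_less_trans)
  qed simp
  have sF: "sq_integrable F"
    using sq_integrable_add[OF sFd[of 0] sf[of 0]] by simp
  have nk: "norm (l2_class F - X (r k)) \<le> (1/4)^k" for k
  proof -
    have "ennreal (LBINT s. (F s - f k s)\<^sup>2) \<le> ennreal ((1/16)^k)"
      using nF[of k] sFd[of k] by (subst nn_integral_eq_integral[symmetric]) (auto simp: sq_integrable_def)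
    then have "(LBINT s. (F s - f k s)\<^sup>2) \<le> (1/16)^k" by simp
    then have "(norm (l2_class F - X (r k)))\<^sup>2 \<le> (1/16)^k"
      using norm_class[OF sFd[of k]] sF sf by (simp add: class_diff[symmetric] fX)
    also have "(1/16::real)^k = ((1/4)^k)\<^sup>2" by (simp add: power_mult_distrib[symmetric] power2_eq_square)
    finally show ?thesis by (rule power2_le_imp_le) simp
  qed
  have "(\<lambda>k. norm (X (r k) - l2_class F)) \<longlonglongrightarrow> 0"
  proof (rule Lim_null_comparison)
    show "\<forall>\<^sub>F k in sequentially. norm (norm (X (r k) - l2_class F)) \<le> (1/4)^k"
      using nk by (simp add: norm_minus_commute)
    show "(\<lambda>k. (1/4::real)^k) \<longlonglongrightarrow> 0" by (rule LIMSEQ_realpow_zero) auto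
  qed
  then have "(X \<circ> r) \<longlonglongrightarrow> l2_class F"
    using LIM_zero_iff tendsto_norm_zero_iff unfolding comp_def by blast
  then show "convergent X"
    using Cauchy_converges_subseq[OF C r_mono] unfolding convergent_def by blast
qed


lemma l2_dense:
  obtains D :: "l2 set" where "countable D" "closure D = UNIV"
proof -
  define e :: "rat \<times> rat \<Rightarrow> l2" where
    "e = (\<lambda>(a, b). l2_class (indicat_real {real_of_rat a<..<real_of_rat b}))"
  define g :: "(rat \<times> rat \<times> rat) list \<Rightarrow> l2" where
    "g xs = sum_list (map (\<lambda>(q, p). real_of_rat q *\<^sub>R e p) xs)" for xs
  define V where "V = closure (range g)"
  have cV: "closed V" by (simp add: V_def)
  have lV: "x \<in> V" if "\<And>n. X n \<in> V" "X \<longlonglongrightarrow> x" for X x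
    using closed_sequentially[OF cV] that by blast
  have g_in: "g xs \<in> V" for xs
    unfolding V_def by (rule subsetD[OF closure_subset]) simp
  have seqV: "\<exists>xs. (\<lambda>n. g (xs n)) \<longlonglongrightarrow> x" if x: "x \<in> V" for x
  proof -
    obtain X where X: "\<And>n. X n \<in> range g" "X \<longlonglongrightarrow> x"
      using x unfolding V_def closure_sequential by auto
    then have "\<forall>n. \<exists>xs. X n = g xs" by blast
    then obtain xs where "\<And>n. X n = g (xs n)" by metis
    then have "X = (\<lambda>n. g (xs n))" by auto
    then show ?thesis using X by auto
  qed
  have g_append: "g (xs @ ys) = g xs + g ys" for xs ys by (simp add: g_def)
  have g_scale: "real_of_rat q *\<^sub>R g xs = g (map (\<lambda>(r, p). (q * r, p)) xs)" for q xs
    by (induction xs) (auto simp: g_def scaleR_add_right of_rat_mult)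
  have addV: "x + y \<in> V" if x: "x \<in> V" and y: "y \<in> V" for x y
  proof -
    obtain xs ys where "(\<lambda>n. g (xs n)) \<longlonglongrightarrow> x" "(\<lambda>n. g (ys n)) \<longlonglongrightarrow> y"
      using seqV[OF x] seqV[OF y] by blast
    then have "(\<lambda>n. g (xs n @ ys n)) \<longlonglongrightarrow> x + y"
      unfolding g_append by (rule tendsto_add)
    then show ?thesis by (rule lV[rotated]) (rule g_in)
  qed
  have scaleQ: "real_of_rat q *\<^sub>R x \<in> V" if x: "x \<in> V" for q x
  proof -
    obtain xs where "(\<lambda>n. g (xs n)) \<longlonglongrightarrow> x" using seqV[OF x] by blast
    then have "(\<lambda>n. real_of_rat q *\<^sub>R g (xs n)) \<longlonglongrightarrow> real_of_rat q *\<^sub>R x"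
      by (intro tendsto_intros)
    then show ?thesis by (rule lV[rotated]) (simp add: g_scale g_in)
  qed
  have scaleV: "c *\<^sub>R x \<in> V" if x: "x \<in> V" for c x
  proof -
    have "\<exists>q. c < real_of_rat q \<and> real_of_rat q < c + inverse (real (Suc n))" for n
      by (intro of_rat_dense) simp
    then obtain q where q: "\<And>n. c < real_of_rat (q n)" "\<And>n. real_of_rat (q n) < c + inverse (real (Suc n))"
      by metis
    have "(\<lambda>n. real_of_rat (q n)) \<longlonglongrightarrow> c"
    proof (rule tendsto_sandwich[OF _ _ tendsto_const])
      show "(\<lambda>n. c + inverse (real (Suc n))) \<longlonglongrightarrow> c"
        using tendsto_add[OF tendsto_const LIMSEQ_inverse_real_of_nat, of c] by simp
    qed (use q in \<open>auto intro!: always_eventually less_imp_le\<close>)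
    then have "(\<lambda>n. real_of_rat (q n) *\<^sub>R x) \<longlonglongrightarrow> c *\<^sub>R x" by (intro tendsto_intros)
    then show ?thesis by (rule lV[rotated]) (rule scaleQ[OF x])
  qed
  have zeroV: "0 \<in> V" using g_in[of "[]"] by (simp add: g_def)
  have diffV: "x - y \<in> V" if "x \<in> V" "y \<in> V" for x y
    using addV[OF that(1) scaleV[OF that(2), of "-1"]] by simp
  have eV: "e p \<in> V" for p
    using g_in[of "[(1, p)]"] by (simp add: g_def)

  have sq_ind: "sq_integrable (indicat_real A)" if "A \<in> sets borel" "emeasure lborel A < \<infinity>" for A
  proof -
    have "(\<lambda>s. (indicat_real A s)\<^sup>2) = indicat_real A" by (auto simp: indicator_def)
    then show ?thesis using that by (simp add: sq_integrable_def)
  qed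
  have iv: "emeasure lborel (A \<inter> {real_of_rat a<..<real_of_rat b}) < \<infinity>" for A and a b :: rat
    by (intro emeasure_bounded_finite bounded_Int) simp
  have sqI: "sq_integrable (indicat_real (A \<inter> {real_of_rat a<..<real_of_rat b}))"
    if "A \<in> sets borel" for A and a b :: rat
    using that by (intro sq_ind iv) simp
  define B where "B = range (\<lambda>(a, b). {real_of_rat a<..<real_of_rat b})"
  have cB: "countable B" by (simp add: B_def)
  have tB: "topological_basis B"
  proof (rule topological_basisI)
    show "open U" if "U \<in> B" for U using that by (auto simp: B_def)
    show "\<exists>B'\<in>B. x \<in> B' \<and> B' \<subseteq> U" if U: "open U" "x \<in> U" for U and x :: real
    proof -
      obtain d where d: "d > 0" "ball x d \<subseteq> U" using U open_contains_ball by blast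
      obtain a where a: "x - d < real_of_rat a" "real_of_rat a < x" using of_rat_dense[of "x - d" x] d by auto
      obtain b where b: "x < real_of_rat b" "real_of_rat b < x + d" using of_rat_dense[of x "x + d"] d by auto
      have "{real_of_rat a<..<real_of_rat b} \<subseteq> U"
        using d(2) a b by (auto simp: ball_def dist_real_def subset_iff)
      then show ?thesis using a b unfolding B_def by (intro bexI[of _ "{real_of_rat a<..<real_of_rat b}"]) auto
    qed
  qed
  have borelB: "sets borel = sigma_sets UNIV B"
    using arg_cong[OF borel_eq_countable_basis[OF cB tB], of sets] by simp
  have rat_max: "real_of_rat (max a b) = max (real_of_rat a) (real_of_rat b)"
    and rat_min: "real_of_rat (min a b) = min (real_of_rat a) (real_of_rat b)" for a b
    by (auto simp: max_def min_def of_rat_less_eq)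
  have stB: "Int_stable B"
  proof (rule Int_stableI)
    fix U W assume "U \<in> B" "W \<in> B"
    then obtain a b c d where "U = {real_of_rat a<..<real_of_rat b}" "W = {real_of_rat c<..<real_of_rat d}"
      by (auto simp: B_def)
    then have "U \<inter> W = {real_of_rat (max a c)<..<real_of_rat (min b d)}"
      by (auto simp: rat_max rat_min)
    then show "U \<inter> W \<in> B" unfolding B_def by auto
  qed

  have bounded_sets: "l2_class (indicat_real (A \<inter> {real_of_rat a<..<real_of_rat b})) \<in> V"
    if A: "A \<in> sets borel" for A and a b :: rat
  proof -
    let ?I = "{real_of_rat a<..<real_of_rat b}"
    have AB: "A \<in> sigma_sets UNIV B" using A borelB by simp
    have BP: "B \<subseteq> Pow UNIV" by simp
    from stB BP AB show ?thesis
    proof (induction rule: sigma_sets_induct_disjoint)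
      case (basic A)
      have "?I \<in> B" by (auto simp: B_def)
      then have "A \<inter> ?I \<in> B" using basic stB by (auto simp: Int_stable_def)
      then obtain c d where "A \<inter> ?I = {real_of_rat c<..<real_of_rat d}" by (auto simp: B_def)
      then show ?case using eV[of "(c, d)"] by (simp add: e_def)
    next
      case empty
      then show ?case using zeroV by (simp add: zero_class)
    next
      case (compl A)
      have Am: "A \<in> sets borel" using compl borelB by simp
      have "l2_class (indicat_real ((UNIV - A) \<inter> ?I)) = l2_class (\<lambda>s. indicat_real (UNIV \<inter> ?I) s - indicat_real (A \<inter> ?I) s)"
        by (rule arg_cong[of _ _ l2_class]) (auto simp: indicator_def)
      also have "\<dots> = l2_class (indicat_real (UNIV \<inter> ?I)) - l2_class (indicat_real (A \<inter> ?I))"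
        using Am by (intro class_diff[symmetric] sqI) simp_all
      also have "\<dots> \<in> V"
        using eV[of "(a, b)"] compl(2) by (intro diffV) (auto simp: e_def)
      finally show ?case .
    next
      case (union A)
      have Am: "A i \<in> sets borel" for i using union(2) borelB by auto
      have fin: "l2_class (indicat_real ((\<Union>i<n. A i) \<inter> ?I)) \<in> V" for n :: nat
      proof (induction n)
        case 0
        then show ?case using zeroV by (simp add: zero_class)
      next
        case (Suc n)
        have dj: "x \<notin> A n" if "i < n" "x \<in> A i" for i x
          using union(1) that unfolding disjoint_family_on_def by (metis IntI UNIV_I empty_iff less_irrefl)
        have "l2_class (indicat_real ((\<Union>i<Suc n. A i) \<inter> ?I)) =
          l2_class (\<lambda>s. indicat_real ((\<Union>i<n. A i) \<inter> ?I) s + indicat_real (A n \<inter> ?I) s)"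
          using dj by (intro arg_cong[of _ _ l2_class]) (auto simp: indicator_def less_Suc_eq fun_eq_iff)
        also have "\<dots> = l2_class (indicat_real ((\<Union>i<n. A i) \<inter> ?I)) + l2_class (indicat_real (A n \<inter> ?I))"
          using Am by (intro class_add[symmetric] sqI) simp_all
        also have "\<dots> \<in> V" using Suc union(3) by (intro addV) auto
        finally show ?case .
      qed
      have "(\<lambda>n. l2_class (indicat_real ((\<Union>i<n. A i) \<inter> ?I))) \<longlonglongrightarrow> l2_class (indicat_real ((\<Union>i. A i) \<inter> ?I))"
      proof (rule l2_dominated_convergence(3))
        show "sq_integrable (indicat_real ?I)" using sqI[of UNIV a b] by simp
        show "AE s in lborel. (\<lambda>n. indicat_real ((\<Union>i<n. A i) \<inter> ?I) s) \<longlonglongrightarrow> indicat_real ((\<Union>i. A i) \<inter> ?I) s"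
        proof (rule AE_I2)
          fix s
          have "eventually (\<lambda>n. indicat_real ((\<Union>i<n. A i) \<inter> ?I) s = indicat_real ((\<Union>i. A i) \<inter> ?I) s) sequentially"
          proof (cases "s \<in> (\<Union>i. A i)")
            case True
            then obtain i where "s \<in> A i" by auto
            then show ?thesis by (intro eventually_sequentiallyI[of "Suc i"]) (auto simp: indicator_def)
          next
            case False
            then show ?thesis by (auto simp: indicator_def)
          qed
          then show "(\<lambda>n. indicat_real ((\<Union>i<n. A i) \<inter> ?I) s) \<longlonglongrightarrow> indicat_real ((\<Union>i. A i) \<inter> ?I) s"
            by (rule tendsto_eventually)
        qed
      qed (use Am in \<open>auto simp: indicator_def\<close>)
      then show ?case by (rule lV[rotated]) (rule fin)
    qed
  qed

  have finite_sets: "l2_class (indicat_real A) \<in> V"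
    if A: "A \<in> sets borel" "sq_integrable (indicat_real A)" for A
  proof -
    let ?I = "\<lambda>n::nat. {real_of_rat (- of_nat n)<..<real_of_rat (of_nat n)}"
    have "(\<lambda>n. l2_class (indicat_real (A \<inter> ?I n))) \<longlonglongrightarrow> l2_class (indicat_real A)"
    proof (rule l2_dominated_convergence(3)[OF _ A(2)])
      show "AE s in lborel. (\<lambda>n. indicat_real (A \<inter> ?I n) s) \<longlonglongrightarrow> indicat_real A s"
      proof (rule AE_I2)
        fix s :: real
        obtain N :: nat where N: "\<bar>s\<bar> < real N" using reals_Archimedean2 by blast
        have "eventually (\<lambda>n. indicat_real (A \<inter> ?I n) s = indicat_real A s) sequentially"
          using N by (intro eventually_sequentiallyI[of N]) (auto simp: indicator_def of_rat_minus)
        then show "(\<lambda>n. indicat_real (A \<inter> ?I n) s) \<longlonglongrightarrow> indicat_real A s"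
          by (rule tendsto_eventually)
      qed
    qed (use A in \<open>auto simp: indicator_def\<close>)
    then show ?thesis by (rule lV[rotated]) (rule bounded_sets[OF A(1)])
  qed

  have nonneg: "sq_integrable u \<longrightarrow> l2_class u \<in> V"
    if u: "u \<in> borel_measurable lborel" "\<And>s. 0 \<le> u s" for u :: "real \<Rightarrow> real"
    using u
  proof (induction rule: borel_measurable_induct_real)
    case (set A)
    then show ?case using finite_sets by simp
  next
    case (mult u c)
    show ?case
    proof
      assume cu: "sq_integrable (\<lambda>x. c * u x)"
      show "l2_class (\<lambda>x. c * u x) \<in> V"
      proof (cases "c = 0")
        case True
        then show ?thesis using zeroV by (simp add: zero_class)
      next
        case False
        then have "sq_integrable u" using sq_integrable_scale[OF cu, of "1/c"] by simp
        then show ?thesis using mult by (simp add: class_scale[symmetric] scaleV)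
      qed
    qed
  next
    case (add u v)
    show ?case
    proof
      assume s: "sq_integrable (\<lambda>x. v x + u x)"
      have "sq_integrable u" "sq_integrable v"
        using add by (auto intro!: sq_integrable_bound[OF s])
      then show "l2_class (\<lambda>x. v x + u x) \<in> V"
        using add by (simp add: class_add[symmetric] addV)
    qed
  next
    case (seq U)
    show ?case
    proof
      assume s: "sq_integrable u"
      have seqlim: "\<And>x. (\<lambda>i. U i x) \<longlonglongrightarrow> u x" using seq by simp
      have IH: "sq_integrable (U i) \<longrightarrow> l2_class (U i) \<in> V" for i using seq by simp
      have le: "U i x \<le> u x" for i x
      proof (rule incseq_le[where X="\<lambda>i. U i x"])
        show "incseq (\<lambda>i. U i x)" using \<open>incseq U\<close> by (auto simp: incseq_def le_fun_def)
        show "(\<lambda>i. U i x) \<longlonglongrightarrow> u x" using seqlim by simp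
      qed
      have *: "AE x in lborel. \<bar>U i x\<bar> \<le> u x" for i using le seq(2) by simp
      have **: "AE x in lborel. (\<lambda>i. U i x) \<longlonglongrightarrow> u x" using seqlim by simp
      have um: "u \<in> borel_measurable lborel" using s by (simp add: sq_integrable_def)
      note dc = l2_dominated_convergence[OF seq(1) s * um **]
      show "l2_class u \<in> V"
        using dc(3) by (rule lV[rotated]) (simp add: IH dc(2))
    qed
  qed
  have "x \<in> V" for x
  proof -
    let ?p = "\<lambda>s. max 0 (rep_l2 x s)" and ?n = "\<lambda>s. max 0 (- rep_l2 x s)"
    have [measurable]: "rep_l2 x \<in> borel_measurable lborel"
      using rep_sq[of x] unfolding sq_integrable_def by blast
    have sp: "sq_integrable ?p" "sq_integrable ?n"
      by (auto intro!: sq_integrable_bound[OF rep_sq[of x]])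
    have "l2_class ?p \<in> V" "l2_class ?n \<in> V" using nonneg[of ?p] nonneg[of ?n] sp by auto
    then have "l2_class ?p - l2_class ?n \<in> V" by (rule diffV)
    also have "l2_class ?p - l2_class ?n = l2_class (\<lambda>s. ?p s - ?n s)" using sp by (rule class_diff)
    also have "(\<lambda>s. ?p s - ?n s) = rep_l2 x" by (auto simp: max_def)
    finally show ?thesis by simp
  qed
  then have "closure (range g) = UNIV" by (auto simp: V_def)
  then show ?thesis by (intro that[of "range g"]) auto
qed

instance l2 :: second_countable_topology
proof
  obtain D :: "l2 set" where D: "countable D" "closure D = UNIV" by (rule l2_dense)
  define B where "B = (\<lambda>(x, n). ball x (inverse (real (Suc n)))) ` (D \<times> UNIV)"
  have "topological_basis B"
  proof (rule topological_basisI)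
    show "open U" if "U \<in> B" for U using that by (auto simp: B_def)
    show "\<exists>B'\<in>B. x \<in> B' \<and> B' \<subseteq> U" if U: "open U" "x \<in> U" for U x
    proof -
      obtain d where d: "d > 0" "ball x d \<subseteq> U" using U open_contains_ball by blast
      obtain n where n: "inverse (real (Suc n)) < d / 2" using reals_Archimedean[of "d/2"] d by auto
      obtain y where y: "y \<in> D" "dist y x < inverse (real (Suc n))"
        using D(2) closure_approachable[of x D] by (metis UNIV_I inverse_positive_iff_positive of_nat_0_less_iff zero_less_Suc)
      have "ball y (inverse (real (Suc n))) \<subseteq> U"
      proof
        fix z assume "z \<in> ball y (inverse (real (Suc n)))"
        then have "dist x z < d" using y(2) n dist_triangle[of x z y] by (simp add: dist_commute)
        then show "z \<in> U" using d by auto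
      qed
      then show ?thesis using y by (intro bexI[of _ "ball y (inverse (real (Suc n)))"]) (auto simp: B_def)
    qed
  qed
  moreover have "countable B" using D(1) by (auto simp: B_def)
  ultimately show "\<exists>B::l2 set set. countable B \<and> open = generate_topology B"
    using topological_basis_imp_subbasis by blast
qed

instance l2 :: banach ..

definition X_space :: "real \<Rightarrow> l2 set" where
  "X_space L = {x. AE s in lborel. s \<notin> {0<..<L} \<longrightarrow> rep_l2 x s = 0}"

definition zero_ext :: "real \<Rightarrow> (real \<Rightarrow> real) \<Rightarrow> real \<Rightarrow> real" where
  "zero_ext L f s = indicator {0<..<L} s * f s"

definition abs_continuous_on :: "real \<Rightarrow> real \<Rightarrow> (real \<Rightarrow> real) \<Rightarrow> bool" where
  "abs_continuous_on a b f \<longleftrightarrow> (\<forall>\<epsilon>>0. \<exists>\<delta>>0. \<forall>(n::nat) u v.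
     (\<forall>i<n. a \<le> u i \<and> u i \<le> v i \<and> v i \<le> b) \<and>
     (\<forall>i<n. \<forall>j<n. i \<noteq> j \<longrightarrow> {u i<..<v i} \<inter> {u j<..<v j} = {}) \<and>
     (\<Sum>i<n. v i - u i) < \<delta>
     \<longrightarrow> (\<Sum>i<n. \<bar>f (v i) - f (u i)\<bar>) < \<epsilon>)"

definition ae_derivative :: "real \<Rightarrow> (real \<Rightarrow> real) \<Rightarrow> (real \<Rightarrow> real) \<Rightarrow> bool" where
  "ae_derivative L f g \<longleftrightarrow>
     (AE s in lborel. s \<in> {0<..<L} \<longrightarrow> (f has_real_derivative g s) (at s))"

text \<open>In the next definition \<open>f\<close> represents \<open>x\<close>, \<open>g\<close> is its derivative and \<open>h\<close> represents
  \<open>y\<close>, the second derivative.  For given \<open>x\<close> there is at most one such \<open>y\<close>.\<close>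

definition second_derivative :: "real \<Rightarrow> l2 \<Rightarrow> l2 \<Rightarrow> bool" where
  "second_derivative L x y \<longleftrightarrow> (\<exists>f g h.
     abs_continuous_on 0 L f \<and> abs_continuous_on 0 L g \<and> f 0 = 0 \<and> f L = 0 \<and>
     ae_derivative L f g \<and> ae_derivative L g h \<and> sq_integrable (zero_ext L h) \<and>
     x = l2_class (zero_ext L f) \<and> y = l2_class (zero_ext L h))"

definition X_zero :: "real \<Rightarrow> l2 set" where
  "X_zero L = {x. \<exists>y. second_derivative L x y}"

text \<open>Unbounded operators are partial functions, their domain being the usual \<open>dom\<close>;
  \<open>S \<circ>\<^sub>m S\<close> is then the operator product with its natural domain.\<close>

definition A_op :: "real \<Rightarrow> l2 \<rightharpoonup> l2" where
  "A_op L x = (if x \<in> X_zero L then Some (- (THE y. second_derivative L x y)) else None)"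

text \<open>The equivalence below says that the graph of \<open>T\<close> is the graph of its adjoint in the Hilbert
  space \<open>H\<close>; since a graph of an adjoint is a linear subspace, this includes linearity of \<open>T\<close>.\<close>

definition self_adjoint_on :: "l2 set \<Rightarrow> (l2 \<rightharpoonup> l2) \<Rightarrow> bool" where
  "self_adjoint_on H T \<longleftrightarrow> dom T \<subseteq> H \<and> ran T \<subseteq> H \<and> H \<subseteq> closure (dom T) \<and>
     (\<forall>u\<in>H. \<forall>v\<in>H. T u = Some v \<longleftrightarrow> (\<forall>x\<in>dom T. inner (the (T x)) u = inner x v))"

definition positive_op :: "(l2 \<rightharpoonup> l2) \<Rightarrow> bool" where
  "positive_op T \<longleftrightarrow> (\<forall>x\<in>dom T. 0 \<le> inner (the (T x)) x)"

definition sqrt_op :: "l2 set \<Rightarrow> (l2 \<rightharpoonup> l2) \<Rightarrow> (l2 \<rightharpoonup> l2)" where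
  "sqrt_op H T = (THE S. self_adjoint_on H S \<and> positive_op S \<and> S \<circ>\<^sub>m S = T)"

definition A_half :: "real \<Rightarrow> l2 \<Rightarrow> l2" where
  "A_half L x = the (sqrt_op (X_space L) (A_op L) x)"

definition X_half :: "real \<Rightarrow> l2 set" where
  "X_half L = dom (sqrt_op (X_space L) (A_op L))"

definition J_op :: "real \<Rightarrow> l2 \<Rightarrow> l2" where
  "J_op L y = (THE x. x \<in> X_half L \<and> A_half L x = y)"

definition I_mu :: "real \<Rightarrow> real \<Rightarrow> l2 \<Rightarrow> l2" where
  "I_mu L \<mu> y = (THE x. x \<in> X_zero L \<and> x + \<mu>\<^sup>2 *\<^sub>R the (A_op L x) = y)"

definition AIA :: "real \<Rightarrow> real \<Rightarrow> l2 \<Rightarrow> l2" where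
  "AIA L \<mu> x = A_half L (I_mu L \<mu> (A_half L x))"

definition inner_half :: "real \<Rightarrow> l2 \<Rightarrow> l2 \<Rightarrow> real" where
  "inner_half L x y = inner (A_half L x) (A_half L y)"

definition norm_half :: "real \<Rightarrow> l2 \<Rightarrow> real" where
  "norm_half L x = sqrt (inner_half L x x)"

text \<open>Operators on \<open>X_half L\<close> are total functions on \<open>l2\<close>, of which only the values on
  \<open>X_half L\<close> matter: none of the definitions below, nor the theorem, looks at other arguments.\<close>

definition bounded_ops :: "real \<Rightarrow> (l2 \<Rightarrow> l2) set" where
  "bounded_ops L = {T.
     (\<forall>x\<in>X_half L. T x \<in> X_half L) \<and>
     (\<forall>x\<in>X_half L. \<forall>y\<in>X_half L. T (x + y) = T x + T y) \<and>
     (\<forall>a. \<forall>x\<in>X_half L. T (a *\<^sub>R x) = a *\<^sub>R T x) \<and>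
     (\<exists>C. \<forall>x\<in>X_half L. norm_half L (T x) \<le> C * norm_half L x)}"

definition boundedly_invertible :: "real \<Rightarrow> (l2 \<Rightarrow> l2) \<Rightarrow> bool" where
  "boundedly_invertible L T \<longleftrightarrow>
     (\<exists>T'\<in>bounded_ops L. \<forall>x\<in>X_half L. T' (T x) = x \<and> T (T' x) = x)"

definition op_norm :: "real \<Rightarrow> (l2 \<Rightarrow> l2) \<Rightarrow> real" where
  "op_norm L T = (SUP x\<in>{x \<in> X_half L. norm_half L x \<le> 1}. norm_half L (T x))"

definition adj :: "real \<Rightarrow> (l2 \<Rightarrow> l2) \<Rightarrow> l2 \<Rightarrow> l2" where
  "adj L T y = (THE v. v \<in> X_half L \<and> (\<forall>x\<in>X_half L. inner_half L (T x) y = inner_half L x v))"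

definition has_op_derivative ::
    "real \<Rightarrow> (real \<Rightarrow> l2 \<Rightarrow> l2) \<Rightarrow> (l2 \<Rightarrow> l2) \<Rightarrow> real \<Rightarrow> real set \<Rightarrow> bool" where
  "has_op_derivative L P D t I \<longleftrightarrow> D \<in> bounded_ops L \<and>
     ((\<lambda>s. op_norm L (\<lambda>x. (P s x - P t x) /\<^sub>R (s - t) - D x)) \<longlongrightarrow> 0) (at t within I)"

text \<open>\<open>controls L t\<close> is $L^2([0,t];\mathcal{X}_{1/2})$, given by functions rather than classes.
  As \<open>A_half L\<close> is an isometric isomorphism from \<open>X_half L\<close> (with \<open>norm_half L\<close>) onto \<open>X_space L\<close>,
  measurability of \<open>w\<close> into \<open>X_half L\<close> is measurability of \<open>A_half L \<circ> w\<close>.  Borel measurability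
  suffices, since every class has a Borel representative.  In \<open>trajectory\<close> the integral is the
  Bochner integral in \<open>l2\<close>; it agrees with the one in \<open>X_half L\<close>, which embeds continuously.\<close>

definition controls :: "real \<Rightarrow> real \<Rightarrow> (real \<Rightarrow> l2) set" where
  "controls L t = {w. (\<forall>s\<in>{0..t}. w s \<in> X_half L) \<and>
     set_borel_measurable lborel {0..t} (\<lambda>s. A_half L (w s)) \<and>
     set_integrable lborel {0..t} (\<lambda>s. (norm_half L (w s))\<^sup>2)}"

definition trajectory :: "l2 \<Rightarrow> (real \<Rightarrow> l2) \<Rightarrow> real \<Rightarrow> l2" where
  "trajectory x w s = x + (LBINT \<sigma>:{0..s}. w \<sigma>)"

definition J_mu :: "real \<Rightarrow> real \<Rightarrow> l2 \<Rightarrow> l2 \<times> l2" where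
  "J_mu L \<mu> w = (J_op L w, \<mu> *\<^sub>R w)"

definition norm_half_pair :: "real \<Rightarrow> l2 \<times> l2 \<Rightarrow> real" where
  "norm_half_pair L p = sqrt ((norm_half L (fst p))\<^sup>2 + (norm_half L (snd p))\<^sup>2)"

definition payoff ::
    "real \<Rightarrow> real \<Rightarrow> real \<Rightarrow> (l2 \<Rightarrow> real) \<Rightarrow> real \<Rightarrow> real \<Rightarrow> l2 \<Rightarrow> (real \<Rightarrow> l2) \<Rightarrow> real" where
  "payoff L \<kappa> M \<psi> \<mu> t x w =
     (LBINT s:{0..t}. \<kappa> / 2 * (norm_half L (trajectory x w s))\<^sup>2
                      - M / 2 * (norm_half_pair L (J_mu L \<mu> (w s)))\<^sup>2)
     + \<psi> (trajectory x w t)"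

definition value_fn ::
    "real \<Rightarrow> real \<Rightarrow> real \<Rightarrow> (l2 \<Rightarrow> real) \<Rightarrow> real \<Rightarrow> real \<Rightarrow> l2 \<Rightarrow> ereal" where
  "value_fn L \<kappa> M \<psi> \<mu> t x = (SUP w\<in>controls L t. ereal (payoff L \<kappa> M \<psi> \<mu> t x w))"

definition psi_c :: "real \<Rightarrow> (l2 \<Rightarrow> l2) \<Rightarrow> real \<Rightarrow> l2 \<Rightarrow> l2 \<Rightarrow> real" where
  "psi_c L K c x z = - (c / 2) * (norm_half L (K (x - z)))\<^sup>2"

definition M_op :: "real \<Rightarrow> (l2 \<Rightarrow> l2) \<Rightarrow> l2 \<Rightarrow> l2" where
  "M_op L K x = adj L K (K x)"

definition t_bar :: "real \<Rightarrow> real \<Rightarrow> real \<Rightarrow> real" where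
  "t_bar \<kappa> m \<mu> = \<mu> * sqrt (2 * m / \<kappa>)"

definition W_breve ::
    "real \<Rightarrow> (real \<Rightarrow> l2 \<Rightarrow> l2) \<Rightarrow> (real \<Rightarrow> l2 \<Rightarrow> l2) \<Rightarrow> (real \<Rightarrow> l2 \<Rightarrow> l2) \<Rightarrow> real \<Rightarrow> l2 \<Rightarrow> l2 \<Rightarrow> real"
  where
  "W_breve L P Q R t x z =
     inner_half L x (P t x) / 2 + inner_half L x (Q t z) + inner_half L z (R t z) / 2"

end

theory Submission
  imports Defs
begin

text \<open>In the sine basis \<open>A\<close> is multiplication by squared frequencies, so \<open>x = A\<^bsup>-1/2\<^esup> u\<close> identifies
  the state space with \<open>L\<^sup>2\<close>, and \<open>A\<^bsup>1/2\<^esup> I\<^sub>\<mu> A\<^bsup>1/2\<^esup>\<close> with a bounded self-adjoint \<open>B\<close>, inverse to the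
  weight \<open>E\<close> of the control cost.  The Riccati equation forces \<open>P\<close> to be self-adjoint; along any
  trajectory \<open>y\<close> the derivative of the quadratic candidate value, evaluated at the remaining time,
  then equals minus the running payoff minus \<open>m/2\<close> times the \<open>E\<close>-square of
  \<open>v - B (P y + Q z) / m\<close>.  Hence the candidate bounds every payoff, and Picard iterates of the
  linear feedback equation come arbitrarily close.\<close>

subsection \<open>Absolutely continuous functions and Lebesgue points\<close>

text \<open>Controls are merely square integrable, so trajectories are merely absolutely continuous
  and the candidate value is differentiable along them only almost everywhere. Recovering its
  increments from that derivative is what the real analysis is for: almost every time is a Lebesgue
  point of the control, and absolute continuity excludes a singular part. The sine basis also shows
  that the definite descriptions (\<open>sqrt_op\<close>, \<open>J_op\<close>, \<open>I_mu\<close>,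
  \<open>adj\<close>) denote the intended objects. In the coordinate \<open>u\<close> the coupling
  operator has the multiplier \<open>w^2 / (1 + mu^2 w^2)\<close>, bounded by
  \<open>1 / mu^2\<close>. Its inverse \<open>J^2 + mu^2\<close> is the cost weight because
  \<open>w = J v\<close> gives the pair \<open>(J w, mu w)\<close> the squared norm
  \<open>|J v|^2 + mu^2 |v|^2\<close>. Symmetry of \<open>P\<close> is available because its
  antisymmetric defect solves a homogeneous linear equation with zero initial value. A supremum asks
  only for nearly optimal controls, so the closed loop need not be solved exactly: the deficit of an
  iterate is controlled by the squared distance to the next one.\<close>

definition nonoverlapping :: "real \<Rightarrow> real \<Rightarrow> nat \<Rightarrow> (nat \<Rightarrow> real) \<Rightarrow> (nat \<Rightarrow> real) \<Rightarrow> bool" where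
  "nonoverlapping a b n u v \<longleftrightarrow> (\<forall>i<n. a \<le> u i \<and> u i \<le> v i \<and> v i \<le> b) \<and>
     (\<forall>i<n. \<forall>j<n. i \<noteq> j \<longrightarrow> {u i<..<v i} \<inter> {u j<..<v j} = {})"

text \<open>Values in a normed space allow one notion for the operators \<open>P\<close> and
  \<open>Q\<close> in time, for trajectories, and for the real candidate value composed of
  them.\<close>

definition ac_on :: "real \<Rightarrow> real \<Rightarrow> (real \<Rightarrow> 'b::real_normed_vector) \<Rightarrow> bool" where
  "ac_on a b f \<longleftrightarrow> (\<forall>\<epsilon>>0. \<exists>\<delta>>0. \<forall>(n::nat) u v.
     nonoverlapping a b n u v \<and> (\<Sum>i<n. v i - u i) < \<delta> \<longrightarrow> (\<Sum>i<n. norm (f (v i) - f (u i))) < \<epsilon>)"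

lemma abs_continuous_on_iff_ac_on: "abs_continuous_on a b f \<longleftrightarrow> ac_on a b f"
  by (simp add: abs_continuous_on_def ac_on_def nonoverlapping_def conj_assoc)

lemma ac_onE:
  assumes "ac_on a b f" "\<epsilon> > 0"
  obtains \<delta> where "\<delta> > 0" "\<And>(n::nat) u v. nonoverlapping a b n u v \<Longrightarrow> (\<Sum>i<n. v i - u i) < \<delta> \<Longrightarrow> (\<Sum>i<n. norm (f (v i) - f (u i))) < \<epsilon>"
proof -
  from assms obtain \<delta> where "\<delta> > 0" "\<forall>(n::nat) u v.
     nonoverlapping a b n u v \<and> (\<Sum>i<n. v i - u i) < \<delta> \<longrightarrow> (\<Sum>i<n. norm (f (v i) - f (u i))) < \<epsilon>"
    unfolding ac_on_def by blast
  then show ?thesis by (intro that[of \<delta>]) auto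
qed

text \<open>Tagged divisions are sets of pairs, so the estimate is wanted over an arbitrary finite
  index set; a bijection with an initial segment of the naturals transfers it.\<close>

lemma ac_on_finite_family:
  assumes "ac_on a b f" "\<epsilon> > 0"
  shows "\<exists>\<delta>>0. \<forall>I u v. finite (I::'i set) \<longrightarrow> (\<forall>i\<in>I. a \<le> u i \<and> u i \<le> v i \<and> v i \<le> b) \<longrightarrow>
     (\<forall>i\<in>I. \<forall>j\<in>I. i \<noteq> j \<longrightarrow> {u i<..<v i} \<inter> {u j<..<v j} = {}) \<longrightarrow>
     (\<Sum>i\<in>I. v i - u i) < \<delta> \<longrightarrow> (\<Sum>i\<in>I. norm (f (v i) - f (u i))) < \<epsilon>"
proof -
  obtain \<delta> where "\<delta> > 0" and d: "\<And>(n::nat) u v. nonoverlapping a b n u v \<Longrightarrow> (\<Sum>i<n. v i - u i) < \<delta> \<Longrightarrow> (\<Sum>i<n. norm (f (v i) - f (u i))) < \<epsilon>"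
    using ac_onE[OF assms] by blast
  show ?thesis
  proof (intro exI[of _ \<delta>] conjI allI impI \<open>\<delta> > 0\<close>)
    fix I :: "'i set" and u v :: "'i \<Rightarrow> real"
    assume fin: "finite I" and uv: "\<forall>i\<in>I. a \<le> u i \<and> u i \<le> v i \<and> v i \<le> b"
      and disj: "\<forall>i\<in>I. \<forall>j\<in>I. i \<noteq> j \<longrightarrow> {u i<..<v i} \<inter> {u j<..<v j} = {}"
      and len: "(\<Sum>i\<in>I. v i - u i) < \<delta>"
    obtain h where h: "bij_betw h {..<card I} I"
      using ex_bij_betw_nat_finite[OF fin] by (auto simp: atLeast0LessThan)
    have reindex: "(\<Sum>i<card I. g (h i)) = (\<Sum>i\<in>I. g i)" for g :: "'i \<Rightarrow> real"
      by (rule sum.reindex_bij_betw[OF h])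
    have hI: "i < card I \<Longrightarrow> h i \<in> I" for i using h by (auto simp: bij_betw_def)
    have hinj: "i < card I \<Longrightarrow> j < card I \<Longrightarrow> i \<noteq> j \<Longrightarrow> h i \<noteq> h j" for i j
      using h by (auto simp: bij_betw_def inj_on_def)
    have "(\<Sum>i<card I. norm (f (v (h i)) - f (u (h i)))) < \<epsilon>"
    proof (rule d)
      show "(\<Sum>i<card I. v (h i) - u (h i)) < \<delta>"
        using len reindex[of "\<lambda>i. v i - u i"] by simp
    qed (use hI hinj uv disj in \<open>auto simp: nonoverlapping_def\<close>)
    then show "(\<Sum>i\<in>I. norm (f (v i) - f (u i))) < \<epsilon>"
      using reindex[of "\<lambda>i. norm (f (v i) - f (u i))"] by simp
  qed
qed

lemma ac_on_imp_continuous_on: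
  assumes "ac_on a b f"
  shows "continuous_on {a..b} f"
  unfolding continuous_on_iff
proof (intro ballI allI impI)
  fix x and \<epsilon> :: real assume x: "x \<in> {a..b}" and "\<epsilon> > 0"
  obtain \<delta> where "\<delta> > 0" and d: "\<And>(n::nat) u v. nonoverlapping a b n u v \<Longrightarrow> (\<Sum>i<n. v i - u i) < \<delta> \<Longrightarrow> (\<Sum>i<n. norm (f (v i) - f (u i))) < \<epsilon>"
    using ac_onE[OF assms \<open>\<epsilon> > 0\<close>] by blast
  have *: "norm (f t - f s) < \<epsilon>" if "a \<le> s" "s \<le> t" "t \<le> b" "t - s < \<delta>" for s t
    using d[of 1 "\<lambda>_. s" "\<lambda>_. t"] that by (simp add: nonoverlapping_def)
  show "\<exists>d>0. \<forall>y\<in>{a..b}. dist y x < d \<longrightarrow> dist (f y) (f x) < \<epsilon>"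
  proof (intro exI[of _ \<delta>] conjI ballI impI)
    fix y assume "y \<in> {a..b}" "dist y x < \<delta>"
    then show "dist (f y) (f x) < \<epsilon>"
      using *[of x y] *[of y x] x by (cases "x \<le> y") (auto simp: dist_norm norm_minus_commute)
  qed fact
qed

lemma ac_on_bounded:
  assumes "ac_on a b f"
  obtains C where "C > 0" "\<And>x. x \<in> {a..b} \<Longrightarrow> norm (f x) \<le> C"
proof -
  have "bounded (f ` {a..b})"
    by (intro compact_imp_bounded compact_continuous_image ac_on_imp_continuous_on assms) simp
  then show ?thesis unfolding bounded_pos using that by blast
qed

text \<open>The common source of the closure properties below: Lipschitz functions, sums, linear
  images and bilinear products all have increments dominated by increments of functions already
  treated. Replacing \<open>C\<close> by \<open>\<bar>C\<bar> + 1\<close> makes the division of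
  \<open>\<epsilon>\<close> legitimate whatever the sign of \<open>C\<close>.\<close>

lemma ac_on_comparison:
  assumes f: "ac_on a b f" and g: "ac_on a b g"
    and le: "\<And>s t. a \<le> s \<Longrightarrow> s \<le> t \<Longrightarrow> t \<le> b \<Longrightarrow> norm (h t - h s) \<le> C * (norm (f t - f s) + norm (g t - g s))"
  shows "ac_on a b h"
  unfolding ac_on_def
proof (intro allI impI)
  fix \<epsilon> :: real assume e: "\<epsilon> > 0"
  define C' where "C' = \<bar>C\<bar> + 1"
  have C': "C' > 0" "C \<le> C'" by (auto simp: C'_def)
  have pos: "\<epsilon> / (2 * C') > 0" using e C' by simp
  obtain d1 where "d1 > 0" and d1: "\<And>(n::nat) u v. nonoverlapping a b n u v \<Longrightarrow> (\<Sum>i<n. v i - u i) < d1 \<Longrightarrow> (\<Sum>i<n. norm (f (v i) - f (u i))) < \<epsilon> / (2 * C')"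
    using ac_onE[OF f pos] by blast
  obtain d2 where "d2 > 0" and d2: "\<And>(n::nat) u v. nonoverlapping a b n u v \<Longrightarrow> (\<Sum>i<n. v i - u i) < d2 \<Longrightarrow> (\<Sum>i<n. norm (g (v i) - g (u i))) < \<epsilon> / (2 * C')"
    using ac_onE[OF g pos] by blast
  show "\<exists>\<delta>>0. \<forall>(n::nat) u v.
     nonoverlapping a b n u v \<and> (\<Sum>i<n. v i - u i) < \<delta> \<longrightarrow> (\<Sum>i<n. norm (h (v i) - h (u i))) < \<epsilon>"
  proof (intro exI[of _ "min d1 d2"] conjI allI impI)
    fix n :: nat and u v :: "nat \<Rightarrow> real"
    assume *: "nonoverlapping a b n u v \<and> (\<Sum>i<n. v i - u i) < min d1 d2"
    have 1: "(\<Sum>i<n. norm (f (v i) - f (u i))) < \<epsilon> / (2 * C')" using * by (intro d1) auto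
    have 2: "(\<Sum>i<n. norm (g (v i) - g (u i))) < \<epsilon> / (2 * C')" using * by (intro d2) auto
    have "norm (h (v i) - h (u i)) \<le> C' * (norm (f (v i) - f (u i)) + norm (g (v i) - g (u i)))" if "i < n" for i
    proof -
      have "norm (h (v i) - h (u i)) \<le> C * (norm (f (v i) - f (u i)) + norm (g (v i) - g (u i)))"
        using * that by (intro le) (auto simp: nonoverlapping_def)
      also have "\<dots> \<le> C' * (norm (f (v i) - f (u i)) + norm (g (v i) - g (u i)))"
        using C' by (intro mult_right_mono) auto
      finally show ?thesis .
    qed
    then have "(\<Sum>i<n. norm (h (v i) - h (u i))) \<le> (\<Sum>i<n. C' * (norm (f (v i) - f (u i)) + norm (g (v i) - g (u i))))"
      by (intro sum_mono) auto
    also have "\<dots> = C' * ((\<Sum>i<n. norm (f (v i) - f (u i))) + (\<Sum>i<n. norm (g (v i) - g (u i))))"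
      by (simp add: sum_distrib_left sum.distrib distrib_left)
    also have "\<dots> < C' * (\<epsilon> / (2 * C') + \<epsilon> / (2 * C'))"
      using 1 2 C' by (intro mult_strict_left_mono add_strict_mono) auto
    also have "\<dots> = \<epsilon>" using C' by (simp add: field_simps)
    finally show "(\<Sum>i<n. norm (h (v i) - h (u i))) < \<epsilon>" .
  qed (use \<open>d1 > 0\<close> \<open>d2 > 0\<close> in auto)
qed

lemma ac_on_lipschitz:
  assumes "\<And>s t. a \<le> s \<Longrightarrow> s \<le> t \<Longrightarrow> t \<le> b \<Longrightarrow> norm (f t - f s) \<le> C * (t - s)"
  shows "ac_on a b f"
proof -
  have id: "ac_on a b (\<lambda>x::real. x)"
    unfolding ac_on_def
  proof (intro allI impI)
    fix \<epsilon> :: real assume "\<epsilon> > 0"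
    show "\<exists>\<delta>>0. \<forall>(n::nat) u v.
     nonoverlapping a b n u v \<and> (\<Sum>i<n. v i - u i) < \<delta> \<longrightarrow> (\<Sum>i<n. norm (v i - u i)) < \<epsilon>"
    proof (intro exI[of _ \<epsilon>] conjI allI impI)
      fix n :: nat and u v :: "nat \<Rightarrow> real"
      assume *: "nonoverlapping a b n u v \<and> (\<Sum>i<n. v i - u i) < \<epsilon>"
      then have "(\<Sum>i<n. norm (v i - u i)) = (\<Sum>i<n. v i - u i)" by (intro sum.cong) (auto simp: nonoverlapping_def)
      then show "(\<Sum>i<n. norm (v i - u i)) < \<epsilon>" using * by simp
    qed fact
  qed
  show ?thesis
  proof (rule ac_on_comparison[OF id id, where C="\<bar>C\<bar>"])
    fix s t assume st: "a \<le> s" "s \<le> t" "t \<le> b"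
    have "norm (f t - f s) \<le> C * (t - s)" using assms st .
    also have "\<dots> \<le> \<bar>C\<bar> * (t - s)" using st by (intro mult_right_mono) auto
    also have "\<dots> \<le> \<bar>C\<bar> * (norm (t - s) + norm (t - s))" using st by (intro mult_left_mono) auto
    finally show "norm (f t - f s) \<le> \<bar>C\<bar> * (norm (t - s) + norm (t - s))" .
  qed
qed

lemma ac_on_add:
  assumes "ac_on a b f" "ac_on a b g"
  shows "ac_on a b (\<lambda>x. f x + g x)"
proof (rule ac_on_comparison[OF assms, where C=1])
  fix s t
  have "f t + g t - (f s + g s) = (f t - f s) + (g t - g s)" by simp
  then show "norm (f t + g t - (f s + g s)) \<le> 1 * (norm (f t - f s) + norm (g t - g s))"
    using norm_triangle_ineq[of "f t - f s" "g t - g s"] by (simp only: mult_1)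
qed

lemma (in bounded_linear) ac_on:
  assumes "ac_on a b g"
  shows "ac_on a b (\<lambda>x. f (g x))"
proof -
  obtain C where C: "\<And>x. norm (f x) \<le> norm x * C" using bounded by blast
  show ?thesis
  proof (rule ac_on_comparison[OF assms assms, where C="\<bar>C\<bar>"])
    fix s t
    have "norm (f (g t) - f (g s)) \<le> norm (g t - g s) * C" using C[of "g t - g s"] by (simp add: diff)
    also have "\<dots> \<le> \<bar>C\<bar> * (norm (g t - g s) + norm (g t - g s))"
      by (subst mult.commute) (intro mult_mono; simp)
    finally show "norm (f (g t) - f (g s)) \<le> \<bar>C\<bar> * (norm (g t - g s) + norm (g t - g s))" .
  qed
qed

lemma (in bounded_bilinear) ac_on:
  assumes f: "ac_on a b f" and g: "ac_on a b g"
  shows "ac_on a b (\<lambda>x. prod (f x) (g x))"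
proof -
  obtain K where K: "K > 0" "\<And>x y. norm (prod x y) \<le> norm x * norm y * K" using pos_bounded by blast
  obtain Cf where Cf: "Cf > 0" "\<And>x. x \<in> {a..b} \<Longrightarrow> norm (f x) \<le> Cf" using ac_on_bounded[OF f] by blast
  obtain Cg where Cg: "Cg > 0" "\<And>x. x \<in> {a..b} \<Longrightarrow> norm (g x) \<le> Cg" using ac_on_bounded[OF g] by blast
  show ?thesis
  proof (rule ac_on_comparison[OF f g, where C="(Cf + Cg) * K"])
    fix s t assume st: "a \<le> s" "s \<le> t" "t \<le> b"
    have "prod (f t) (g t) - prod (f s) (g s) = prod (f t - f s) (g t) + prod (f s) (g t - g s)"
      by (simp add: diff_left diff_right)
    then have "norm (prod (f t) (g t) - prod (f s) (g s))
        \<le> norm (f t - f s) * norm (g t) * K + norm (f s) * norm (g t - g s) * K"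
      using norm_triangle_ineq[of "prod (f t - f s) (g t)" "prod (f s) (g t - g s)"]
        K(2)[of "f t - f s" "g t"] K(2)[of "f s" "g t - g s"] by simp
    also have "\<dots> \<le> norm (f t - f s) * Cg * K + Cf * norm (g t - g s) * K"
      using st K Cf Cg by (intro add_mono mult_mono) (auto intro: less_imp_le)
    also have "\<dots> \<le> (Cf + Cg) * K * (norm (f t - f s) + norm (g t - g s))"
      using K(1) Cf(1) Cg(1) by (simp add: algebra_simps)
    finally show "norm (prod (f t) (g t) - prod (f s) (g s)) \<le> (Cf + Cg) * K * (norm (f t - f s) + norm (g t - g s))" .
  qed
qed

lemma set_integral_Icc_diff:
  fixes f :: "real \<Rightarrow> 'a::{banach, second_countable_topology}"
  assumes f: "set_integrable lborel {a..b} f" and "a \<le> s" "s \<le> t" "t \<le> b"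
  shows "(LBINT x:{a..t}. f x) - (LBINT x:{a..s}. f x) = (LBINT x:{s..t}. f x)"
proof -
  have i: "set_integrable lborel {a..s} f" "set_integrable lborel {s<..t} f"
    by (rule set_integrable_subset[OF f]; use assms in auto)+
  have disj: "{a..s} \<inter> {s<..t} = {}" by auto
  have "{a..t} = {a..s} \<union> {s<..t}" using assms by auto
  then have "(LBINT x:{a..t}. f x) = (LBINT x:{a..s}. f x) + (LBINT x:{s<..t}. f x)"
    using set_integral_Un[OF disj i] by simp
  also have "(LBINT x:{s<..t}. f x) = (LBINT x:{s..t}. f x)"
    unfolding set_lebesgue_integral_def
  proof (rule integral_cong_AE)
    show "(\<lambda>x. indicat_real {s<..t} x *\<^sub>R f x) \<in> borel_measurable lborel"
      using i(2) by (auto simp: set_integrable_def)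
    have "set_integrable lborel {s..t} f" by (rule set_integrable_subset[OF f]; use assms in auto)
    then show "(\<lambda>x. indicat_real {s..t} x *\<^sub>R f x) \<in> borel_measurable lborel"
      by (auto simp: set_integrable_def)
    show "AE x in lborel. indicat_real {s<..t} x *\<^sub>R f x = indicat_real {s..t} x *\<^sub>R f x"
      using AE_lborel_singleton[of s] by eventually_elim (auto simp: indicator_def)
  qed
  finally show ?thesis by simp
qed

text \<open>Split \<open>g\<close> at a high level \<open>k\<close>. The part above the level has
  small integral by dominated convergence; the rest contributes at most \<open>k\<close> times the
  total length of the intervals.\<close>

lemma ac_on_integral_bound:
  fixes h :: "real \<Rightarrow> 'b::real_normed_vector"
  assumes g: "set_integrable lborel {a..b} g" "\<And>x. 0 \<le> g x"
    and h: "\<And>s t. a \<le> s \<Longrightarrow> s \<le> t \<Longrightarrow> t \<le> b \<Longrightarrow> norm (h t - h s) \<le> (LBINT x:{s..t}. g x)"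
  shows "ac_on a b h"
  unfolding ac_on_def
proof (intro allI impI)
  fix \<epsilon> :: real assume e: "\<epsilon> > 0"
  define G where "G x = indicat_real {a..b} x * g x" for x
  have Gi: "integrable lborel G" using g by (simp add: set_integrable_def G_def[abs_def])
  have Gm [measurable]: "G \<in> borel_measurable lborel" using Gi by simp
  have G0: "G x \<ge> 0" for x using g by (simp add: G_def)
  define T where "T k x = (if G x > real k then G x else 0)" for k x
  have Tm [measurable]: "T k \<in> borel_measurable lborel" for k unfolding T_def by measurable
  have Ti: "integrable lborel (T k)" for k
    by (rule Bochner_Integration.integrable_bound[OF Gi]) (auto simp: T_def)
  have "(\<lambda>k. integral\<^sup>L lborel (T k)) \<longlonglongrightarrow> integral\<^sup>L lborel (\<lambda>x::real. 0::real)"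
  proof (rule integral_dominated_convergence[where w=G])
    show "AE x in lborel. (\<lambda>k. T k x) \<longlonglongrightarrow> 0"
    proof (rule AE_I2)
      fix x
      obtain N where "G x < real N" using reals_Archimedean2 by blast
      then have "\<forall>k\<ge>N. T k x = 0" by (auto simp: T_def)
      then show "(\<lambda>k. T k x) \<longlonglongrightarrow> 0" by (intro tendsto_eventually) (auto simp: eventually_sequentially)
    qed
    show "AE x in lborel. norm (T k x) \<le> G x" for k using G0 by (auto simp: T_def)
  qed (use Gi in auto)
  then have "eventually (\<lambda>k. integral\<^sup>L lborel (T k) < \<epsilon> / 2) sequentially"
    using e by (intro order_tendstoD(2)) auto
  then obtain k where k: "integral\<^sup>L lborel (T k) < \<epsilon> / 2" by (auto simp: eventually_sequentially)
  show "\<exists>\<delta>>0. \<forall>(n::nat) u v.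
     nonoverlapping a b n u v \<and> (\<Sum>i<n. v i - u i) < \<delta> \<longrightarrow> (\<Sum>i<n. norm (h (v i) - h (u i))) < \<epsilon>"
  \<comment> \<open>The bounded part then adds at most \<open>\<epsilon> / 2\<close>; the summand 1
    covers \<open>k = 0\<close>.\<close>
  proof (intro exI[of _ "\<epsilon> / (2 * (real k + 1))"] conjI allI impI)
    fix n :: nat and u v :: "nat \<Rightarrow> real"
    assume *: "nonoverlapping a b n u v \<and> (\<Sum>i<n. v i - u i) < \<epsilon> / (2 * (real k + 1))"
    let ?I = "\<lambda>i. {u i<..<v i}"
    have TIi: "integrable lborel (\<lambda>x. indicat_real (?I i) x * T k x)" for i
      by (rule Bochner_Integration.integrable_bound[OF Ti[of k]]) (auto simp: indicator_def)
    have one: "norm (h (v i) - h (u i)) \<le> real k * (v i - u i) + (LBINT x. indicat_real (?I i) x * T k x)" if "i < n" for i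
    proof -
      have uv: "a \<le> u i" "u i \<le> v i" "v i \<le> b" using * that by (auto simp: nonoverlapping_def)
      have "norm (h (v i) - h (u i)) \<le> (LBINT x:{u i..v i}. g x)" using uv by (rule h)
      also have "\<dots> \<le> (LBINT x. real k * indicat_real {u i..v i} x + indicat_real (?I i) x * T k x)"
        unfolding set_lebesgue_integral_def
      proof (rule integral_mono_AE)
        show "integrable lborel (\<lambda>x. indicat_real {u i..v i} x *\<^sub>R g x)"
          using set_integrable_subset[OF g(1), of "{u i..v i}"] uv by (auto simp: set_integrable_def)
        show "integrable lborel (\<lambda>x. real k * indicat_real {u i..v i} x + indicat_real (?I i) x * T k x)"
          using TIi uv by (intro Bochner_Integration.integrable_add integrable_mult_right)
            (auto simp: integrable_indicator_iff less_top[symmetric])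
        show "AE x in lborel. indicat_real {u i..v i} x *\<^sub>R g x \<le> real k * indicat_real {u i..v i} x + indicat_real (?I i) x * T k x"
          using AE_lborel_singleton[of "u i"] AE_lborel_singleton[of "v i"]
        proof eventually_elim
          case (elim x)
          then show ?case using uv G0[of x] by (auto simp: indicator_def T_def G_def)
        qed
      qed
      also have "\<dots> = real k * (v i - u i) + (LBINT x. indicat_real (?I i) x * T k x)"
        using TIi uv by (subst Bochner_Integration.integral_add) (auto simp: integrable_indicator_iff less_top[symmetric])
      finally show ?thesis .
    qed
    have "(\<Sum>i<n. norm (h (v i) - h (u i))) \<le> (\<Sum>i<n. real k * (v i - u i) + (LBINT x. indicat_real (?I i) x * T k x))"
      using one by (intro sum_mono) auto
    also have "\<dots> = real k * (\<Sum>i<n. v i - u i) + (LBINT x. (\<Sum>i<n. indicat_real (?I i) x * T k x))"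
      by (subst Bochner_Integration.integral_sum) (use TIi in \<open>simp_all add: sum.distrib sum_distrib_left\<close>)
    also have "(LBINT x. (\<Sum>i<n. indicat_real (?I i) x * T k x)) \<le> integral\<^sup>L lborel (T k)"
    proof (rule integral_mono)
      fix x
      have "(\<Sum>i<n. indicat_real (?I i) x) = indicat_real (\<Union>i\<in>{..<n}. ?I i) x"
        using * by (intro indicator_UN_disjoint[symmetric]) (auto simp: disjoint_family_on_def nonoverlapping_def)
      then have "(\<Sum>i<n. indicat_real (?I i) x) \<le> 1" by (simp add: indicator_def)
      then show "(\<Sum>i<n. indicat_real (?I i) x * T k x) \<le> T k x"
        unfolding sum_distrib_right[symmetric] using G0[of x] by (intro mult_left_le_one_le) (auto simp: T_def sum_nonneg)
    qed (rule Bochner_Integration.integrable_sum TIi Ti)+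
    also have "real k * (\<Sum>i<n. v i - u i) \<le> real k * (\<epsilon> / (2 * (real k + 1)))"
      using * by (intro mult_left_mono) auto
    also have "real k * (\<epsilon> / (2 * (real k + 1))) \<le> \<epsilon> / 2"
      using e by (simp add: field_simps)
    finally show "(\<Sum>i<n. norm (h (v i) - h (u i))) < \<epsilon>" using k by simp
  qed (use e in auto)
qed

lemma ac_on_set_integral:
  fixes v :: "real \<Rightarrow> 'a::{banach, second_countable_topology}"
  assumes v: "set_integrable lborel {a..b} v"
  shows "ac_on a b (\<lambda>s. LBINT x:{a..s}. v x)"
proof (rule ac_on_integral_bound)
  show "set_integrable lborel {a..b} (\<lambda>x. norm (v x))" using v by (rule set_integrable_norm)
  fix s t assume st: "a \<le> s" "s \<le> t" "t \<le> b"
  have "set_integrable lborel {s..t} v" using st by (intro set_integrable_subset[OF v]) auto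
  then have "norm (LBINT x:{s..t}. v x) \<le> (LBINT x:{s..t}. norm (v x))" by (rule set_integral_norm_bound)
  then show "norm ((LBINT x:{a..t}. v x) - (LBINT x:{a..s}. v x)) \<le> (LBINT x:{s..t}. norm (v x))"
    using set_integral_Icc_diff[OF v st] by simp
qed simp

section \<open>The fundamental theorem of calculus for absolutely continuous functions\<close>

text \<open>As \<open>u\<close> and \<open>v\<close> lie on opposite sides of \<open>x\<close>, the
  two one-sided errors add up to \<open>\<epsilon>\<close> times the full length
  \<open>v - u\<close>, which is the form needed for a tagged interval.\<close>

lemma has_vector_derivative_straddle:
  fixes f :: "real \<Rightarrow> 'a::real_normed_vector"
  assumes "(f has_vector_derivative f') (at x within {a..b})" "\<epsilon> > 0"
  obtains d where "d > 0" "\<And>u v. u \<in> {a..b} \<Longrightarrow> v \<in> {a..b} \<Longrightarrow> u \<le> x \<Longrightarrow> x \<le> v \<Longrightarrow> x - u < d \<Longrightarrow> v - x < d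
     \<Longrightarrow> norm (f v - f u - (v - u) *\<^sub>R f') \<le> \<epsilon> * (v - u)"
proof -
  have "(f has_derivative (\<lambda>h. h *\<^sub>R f')) (at x within {a..b})"
    using assms(1) by (simp add: has_vector_derivative_def)
  then obtain d where "d > 0" and d: "\<And>y. y \<in> {a..b} \<Longrightarrow> norm (y - x) < d \<Longrightarrow>
      norm (f y - f x - (y - x) *\<^sub>R f') \<le> \<epsilon> * norm (y - x)"
    unfolding has_derivative_within_alt using assms(2) by blast
  show ?thesis
  proof (rule that[OF \<open>d > 0\<close>])
    fix u v assume uv: "u \<in> {a..b}" "v \<in> {a..b}" "u \<le> x" "x \<le> v" "x - u < d" "v - x < d"
    have "f v - f u - (v - u) *\<^sub>R f' = (f v - f x - (v - x) *\<^sub>R f') - (f u - f x - (u - x) *\<^sub>R f')"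
      by (simp add: algebra_simps)
    then have "norm (f v - f u - (v - u) *\<^sub>R f') \<le> norm (f v - f x - (v - x) *\<^sub>R f') + norm (f u - f x - (u - x) *\<^sub>R f')"
      using norm_triangle_ineq4 by metis
    also have "\<dots> \<le> \<epsilon> * (v - x) + \<epsilon> * (x - u)"
      using d[of v] d[of u] uv by (intro add_mono) auto
    also have "\<dots> = \<epsilon> * (v - u)" by (simp add: algebra_simps)
    finally show "norm (f v - f u - (v - u) *\<^sub>R f') \<le> \<epsilon> * (v - u)" .
  qed
qed

lemma negligible_open_supersetE:
  fixes N :: "'a::euclidean_space set"
  assumes "negligible N" "\<delta> > 0"
  obtains U where "open U" "N \<subseteq> U" "emeasure lborel U < ennreal \<delta>"
proof -
  have N: "N \<in> null_sets lebesgue" using assms by (simp add: negligible_iff_null_sets)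
  then obtain U where U: "open U" "N \<subseteq> U" "U - N \<in> lmeasurable" "emeasure lebesgue (U - N) < ennreal \<delta>"
    using sets_lebesgue_outer_open[of N \<delta>] assms by blast
  have "emeasure lebesgue U = emeasure lebesgue (U - N)"
    using N U(1) by (intro emeasure_Diff_null_set[symmetric]) auto
  moreover have "emeasure lebesgue U = emeasure lborel U"
    using U(1) by (simp add: emeasure_completion)
  ultimately show ?thesis using U that by metis
qed

text \<open>Off the exceptional set the gauge comes from differentiability; on it, from an open set of
  small measure, on which absolute continuity makes the increments of \<open>f\<close> small.\<close>

theorem ac_on_has_integral:
  fixes f :: "real \<Rightarrow> 'a::real_normed_vector"
  assumes ab: "a \<le> b" and ac: "ac_on a b f" and N: "negligible N"
    and deriv: "\<And>x. x \<in> {a..b} - N \<Longrightarrow> (f has_vector_derivative g x) (at x within {a..b})"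
  shows "(g has_integral (f b - f a)) {a..b}"
proof -
  \<comment> \<open>Setting the integrand to zero on \<open>N\<close> changes no integral and
    removes the uncontrolled values of \<open>g\<close> at tags in \<open>N\<close>.\<close>
  define h where "h x = (if x \<in> N then 0 else g x)" for x
  have "(h has_integral (f b - f a)) (cbox a b)"
    unfolding has_integral
  proof (intro allI impI)
    fix e :: real assume e: "e > 0"
    \<comment> \<open>Chosen so that \<open>c * (b - a)\<close> is at most \<open>e / 2\<close>,
      also when \<open>a = b\<close>.\<close>
    define c where "c = e / (2 * (b - a + 1))"
    have c: "c > 0" using e ab by (simp add: c_def)
    from ac_on_finite_family[OF ac half_gt_zero[OF e], where ?'i="real \<times> real set"]
    obtain \<delta> where "\<delta> > 0" and d: "\<forall>(I::(real \<times> real set) set) u v. finite I \<longrightarrow> (\<forall>i\<in>I. a \<le> u i \<and> u i \<le> v i \<and> v i \<le> b) \<longrightarrow>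
     (\<forall>i\<in>I. \<forall>j\<in>I. i \<noteq> j \<longrightarrow> {u i<..<v i} \<inter> {u j<..<v j} = {}) \<longrightarrow>
     (\<Sum>i\<in>I. v i - u i) < \<delta> \<longrightarrow> (\<Sum>i\<in>I. norm (f (v i) - f (u i))) < e / 2"
      by (elim exE conjE)
    obtain U where U: "open U" "N \<subseteq> U" "emeasure lborel U < ennreal \<delta>"
      using negligible_open_supersetE[OF N \<open>\<delta> > 0\<close>] .
    have "\<exists>r>0. x \<in> {a..b} \<longrightarrow> (if x \<in> N then ball x r \<subseteq> U else
       (\<forall>u v. u \<in> {a..b} \<longrightarrow> v \<in> {a..b} \<longrightarrow> u \<le> x \<longrightarrow> x \<le> v \<longrightarrow> x - u < r \<longrightarrow> v - x < r
     \<longrightarrow> norm (f v - f u - (v - u) *\<^sub>R g x) \<le> c * (v - u)))" for x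
    proof (cases "x \<in> N")
      case True
      then obtain r where "r > 0" "ball x r \<subseteq> U" using U by (meson openE subsetD)
      then show ?thesis using True by auto
    next
      case False
      show ?thesis
      proof (cases "x \<in> {a..b}")
        case True
        obtain r where "r > 0" "\<And>u v. u \<in> {a..b} \<Longrightarrow> v \<in> {a..b} \<Longrightarrow> u \<le> x \<Longrightarrow> x \<le> v \<Longrightarrow> x - u < r \<Longrightarrow> v - x < r
     \<Longrightarrow> norm (f v - f u - (v - u) *\<^sub>R g x) \<le> c * (v - u)"
          using has_vector_derivative_straddle[OF deriv c] True False by auto
        then show ?thesis using False by auto
      qed (use zero_less_one in blast)
    qed
    then obtain r where r: "\<And>x. r x > 0"
      and rN: "\<And>x. x \<in> {a..b} \<Longrightarrow> x \<in> N \<Longrightarrow> ball x (r x) \<subseteq> U"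
      and rd: "\<And>x u v. x \<in> {a..b} \<Longrightarrow> x \<notin> N \<Longrightarrow> u \<in> {a..b} \<Longrightarrow> v \<in> {a..b} \<Longrightarrow> u \<le> x \<Longrightarrow> x \<le> v \<Longrightarrow>
          x - u < r x \<Longrightarrow> v - x < r x \<Longrightarrow> norm (f v - f u - (v - u) *\<^sub>R g x) \<le> c * (v - u)"
      by metis
    show "\<exists>\<gamma>. gauge \<gamma> \<and> (\<forall>\<D>. \<D> tagged_division_of cbox a b \<and> \<gamma> fine \<D> \<longrightarrow>
              norm ((\<Sum>(x, k)\<in>\<D>. measure lborel k *\<^sub>R h x) - (f b - f a)) < e)"
    proof (intro exI[of _ "\<lambda>x. ball x (r x)"] conjI allI impI)
      show "gauge (\<lambda>x. ball x (r x))" using r by (simp add: gauge_def)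
      fix p assume "p tagged_division_of cbox a b \<and> (\<lambda>x. ball x (r x)) fine p"
      then have p: "p tagged_division_of {a..b}" and fine: "(\<lambda>x. ball x (r x)) fine p" by auto
      note pD = tagged_division_ofD[OF p]
      have fin: "finite p" by (rule pD(1))
      define l where "l i = Inf (snd i)" for i :: "real \<times> real set"
      define w where "w i = Sup (snd i)" for i :: "real \<times> real set"
      have K: "snd i = {l i..w i}" "l i \<le> fst i" "fst i \<le> w i" "a \<le> l i" "w i \<le> b"
        "snd i \<subseteq> ball (fst i) (r (fst i))" if "i \<in> p" for i
      proof -
        obtain x k where i: "i = (x, k)" by (cases i)
        have "\<exists>l' w'. k = {l'..w'}" using pD(4)[of x k] that i by simp
        then obtain l' w' where k: "k = {l'..w'}" by blast
        have x: "x \<in> k" "k \<subseteq> {a..b}" using pD(2,3)[of x k] that i by auto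
        have "l i = l'" "w i = w'" using k x i by (auto simp: l_def w_def)
        then show "snd i = {l i..w i}" "l i \<le> fst i" "fst i \<le> w i" "a \<le> l i" "w i \<le> b"
          using k x i by auto
        show "snd i \<subseteq> ball (fst i) (r (fst i))" using fine that i by (auto simp: fine_def)
      qed
      have disj: "{l i<..<w i} \<inter> {l j<..<w j} = {}" if "i \<in> p" "j \<in> p" "i \<noteq> j" for i j
      proof -
        have "(fst i, snd i) \<in> p" "(fst j, snd j) \<in> p" "(fst i, snd i) \<noteq> (fst j, snd j)" using that by auto
        then have "interior (snd i) \<inter> interior (snd j) = {}" by (rule pD(5))
        then show ?thesis unfolding K(1)[OF that(1)] K(1)[OF that(2)] interior_atLeastAtMost_real .
      qed
      define I where "I = {i \<in> p. fst i \<in> N}"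
      have Ip: "I \<subseteq> p" "finite I" using fin by (auto simp: I_def)
      \<comment> \<open>Intervals tagged in \<open>N\<close> have disjoint interiors inside
        \<open>U\<close>, so their total length is below \<open>\<delta>\<close> and absolute
        continuity applies to them.\<close>
      have "(\<Sum>i\<in>I. w i - l i) = (\<Sum>i\<in>I. measure lborel {l i<..<w i})"
      proof (rule sum.cong)
        fix i assume "i \<in> I"
        then have "l i \<le> w i" using K(2,3)[of i] Ip by auto
        then show "w i - l i = measure lborel {l i<..<w i}" by simp
      qed simp
      also have "\<dots> = measure lborel (\<Union>i\<in>I. {l i<..<w i})"
      proof (rule measure_finite_Union[symmetric])
        show "disjoint_family_on (\<lambda>i. {l i<..<w i}) I"
          unfolding disjoint_family_on_def using disj Ip(1) by blast
        show "emeasure lborel {l i<..<w i} \<noteq> \<infinity>" if "i \<in> I" for i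
          using emeasure_bounded_finite[of "{l i<..<w i}"] by auto
      qed (use Ip in auto)
      also have "\<dots> \<le> measure lborel U"
      proof (rule measure_mono_fmeasurable)
        show "(\<Union>i\<in>I. {l i<..<w i}) \<subseteq> U"
        proof (intro UN_least)
          fix i assume "i \<in> I"
          then have "{l i<..<w i} \<subseteq> ball (fst i) (r (fst i))" "fst i \<in> N" "fst i \<in> {a..b}"
            using K[of i] by (auto simp: I_def)
          then show "{l i<..<w i} \<subseteq> U" using rN by blast
        qed
        show "U \<in> fmeasurable lborel" using U by (intro fmeasurableI) (auto intro: less_trans)
        show "(\<Union>i\<in>I. {l i<..<w i}) \<in> sets lborel" by (intro sets.finite_UN Ip) simp
      qed
      also have "\<dots> < \<delta>" 
      proof -
        have "emeasure lborel U \<noteq> top" using U(3) by auto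
        then have "ennreal (measure lborel U) < ennreal \<delta>" using U(3) by (simp add: emeasure_eq_ennreal_measure)
        then show ?thesis by (simp add: ennreal_less_iff)
      qed
      finally have "(\<Sum>i\<in>I. norm (f (w i) - f (l i))) < e / 2"
      proof (intro d[rule_format])
        show "a \<le> l i \<and> l i \<le> w i \<and> w i \<le> b" if "i \<in> I" for i
          using K[of i] Ip that by auto
        show "{l i<..<w i} \<inter> {l j<..<w j} = {}" if "i \<in> I" "j \<in> I" "i \<noteq> j" for i j
          using disj Ip that by blast
      qed (use Ip in auto)
      have tele: "(\<Sum>i\<in>p. f (w i) - f (l i)) = f b - f a"
        using additive_tagged_division_1[OF ab p, of f] by (simp add: l_def w_def split_beta)
      have "(\<Sum>(x, k)\<in>p. measure lborel k *\<^sub>R h x) - (f b - f a) = (\<Sum>i\<in>p. measure lborel (snd i) *\<^sub>R h (fst i) - (f (w i) - f (l i)))"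
        unfolding tele[symmetric] by (simp add: sum_subtractf split_beta)
      also have "norm \<dots> \<le> (\<Sum>i\<in>p. norm (measure lborel (snd i) *\<^sub>R h (fst i) - (f (w i) - f (l i))))"
        by (rule norm_sum)
      also have "\<dots> \<le> (\<Sum>i\<in>p. (if i \<in> I then norm (f (w i) - f (l i)) else 0) + c * (w i - l i))"
      proof (rule sum_mono)
        fix i assume i: "i \<in> p"
        have cont: "measure lborel (snd i) = w i - l i" using K[OF i] by simp
        show "norm (measure lborel (snd i) *\<^sub>R h (fst i) - (f (w i) - f (l i)))
            \<le> (if i \<in> I then norm (f (w i) - f (l i)) else 0) + c * (w i - l i)"
        proof (cases "i \<in> I")
          case True
          then have "h (fst i) = 0" by (simp add: I_def h_def)
          then show ?thesis using True c K[OF i] norm_minus_commute[of "f (w i)" "f (l i)"] by simp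
        next
          case False
          then have "fst i \<notin> N" using i by (simp add: I_def)
          moreover have "l i \<in> ball (fst i) (r (fst i))" "w i \<in> ball (fst i) (r (fst i))"
            using K(2,3)[OF i] by (intro subsetD[OF K(6)[OF i]]; simp add: K(1)[OF i])+
          ultimately have "norm (f (w i) - f (l i) - (w i - l i) *\<^sub>R g (fst i)) \<le> c * (w i - l i)"
            using K[OF i] by (intro rd) (auto simp: dist_real_def)
          then show ?thesis
            using False \<open>fst i \<notin> N\<close> by (simp add: cont h_def norm_minus_commute)
        qed
      qed
      also have "\<dots> = (\<Sum>i\<in>I. norm (f (w i) - f (l i))) + c * (\<Sum>i\<in>p. w i - l i)"
        using fin Ip by (simp add: sum.distrib sum_distrib_left sum.If_cases Int_absorb1)
      also have "(\<Sum>i\<in>p. w i - l i) = b - a"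
        using additive_tagged_division_1[OF ab p, of "\<lambda>x. x"] by (simp add: l_def w_def split_beta)
      also have "c * (b - a) \<le> e / 2" using ab e by (simp add: c_def field_simps)
      finally show "norm ((\<Sum>(x, k)\<in>p. measure lborel k *\<^sub>R h x) - (f b - f a)) < e"
        using \<open>(\<Sum>i\<in>I. norm (f (w i) - f (l i))) < e / 2\<close> by simp
    qed
  qed
  then have "(h has_integral (f b - f a)) {a..b}" by simp
  then show ?thesis by (rule has_integral_spike[OF N, rotated]) (simp add: h_def)
qed

section \<open>Differentiation of indefinite integrals almost everywhere\<close>

text \<open>At a bad point arbitrarily short intervals have a Riemann error of at least a fixed
  fraction of their length. By Vitali's theorem disjoint intervals of this kind cover almost all bad
  points; finitely many of them form a partial division, whose total error Henstock's lemma makes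
  small, so their total length is small as well.\<close>

theorem integral_has_derivative_AE:
  fixes h :: "real \<Rightarrow> real"
  assumes h: "h integrable_on {a..b}"
  obtains N where "negligible N"
    "\<And>x. x \<in> {a<..<b} - N \<Longrightarrow> ((\<lambda>x. integral {a..x} h) has_real_derivative h x) (at x)"
proof -
  define F where "F x = integral {a..x} h" for x
  have F_diff: "F y - F x = integral {x..y} h" if "a \<le> x" "x \<le> y" "y \<le> b" for x y
  proof -
    have "integral {a..x} h + integral {x..y} h = integral {a..y} h"
      using that by (intro Henstock_Kurzweil_Integration.integral_combine) (auto intro: integrable_subinterval_real[OF h])
    then show ?thesis by (simp add: F_def)
  qed
  \<comment> \<open>Points where difference quotients of \<open>F\<close> miss \<open>h x\<close> by
    more than \<open>1 / (k + 1)\<close> at arbitrarily small distance. Off all of these sets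
    \<open>F\<close> has derivative \<open>h\<close>.\<close>
  define Bad where "Bad k = {x \<in> {a<..<b}. \<forall>d>0. \<exists>y\<in>{a<..<b}. y \<noteq> x \<and> \<bar>y - x\<bar> < d \<and>
     \<bar>F y - F x - h x * (y - x)\<bar> > \<bar>y - x\<bar> / real (Suc k)}" for k
  have "negligible (Bad k)" for k
    unfolding negligible_outer_le
  proof (intro allI impI)
    fix e :: real assume e: "e > 0"
    obtain \<gamma> where g: "gauge \<gamma>" and hen: "\<And>p. \<lbrakk>p tagged_partial_division_of (cbox a b); \<gamma> fine p\<rbrakk> \<Longrightarrow>
       sum (\<lambda>(x,k). norm (measure lborel k *\<^sub>R h x - integral k h)) p < e / real (Suc k)"
    proof (rule Henstock_lemma)
      show "h integrable_on cbox a b" using h by simp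
      show "e / real (Suc k) > 0" using e by simp
      fix \<gamma> assume 1: "gauge \<gamma>" and 2: "\<And>p. \<lbrakk>p tagged_partial_division_of (cbox a b); \<gamma> fine p\<rbrakk> \<Longrightarrow>
       sum (\<lambda>(x,k). norm (measure lborel k *\<^sub>R h x - integral k h)) p < e / real (Suc k)"
      show thesis by (rule that[OF 1]) (rule 2)
    qed
    \<comment> \<open>A pair \<open>(x, y)\<close> stands for the interval between its components,
      tagged at its end point \<open>x\<close>. Centre and radius present this interval as a ball,
      as the covering theorem requires.\<close>
    define c :: "real \<times> real \<Rightarrow> real" where "c i = (fst i + snd i) / 2" for i
    define r :: "real \<times> real \<Rightarrow> real" where "r i = \<bar>snd i - fst i\<bar> / 2" for i
    define Q where "Q i = cball (c i) (r i)" for i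
    have Q: "Q i = {min (fst i) (snd i)..max (fst i) (snd i)}" for i
      by (auto simp: Q_def c_def r_def cball_eq_atLeastAtMost min_def max_def field_simps abs_if)
    define K where "K = {(x, y). x \<in> Bad k \<and> y \<in> {a<..<b} \<and> y \<noteq> x \<and> Q (x, y) \<subseteq> \<gamma> x \<and>
       \<bar>F y - F x - h x * (y - x)\<bar> > \<bar>y - x\<bar> / real (Suc k)}"
    have rpos: "0 < r i" if "i \<in> K" for i using that by (auto simp: K_def r_def)
    have fine: "\<exists>i. i \<in> K \<and> x \<in> cball (c i) (r i) \<and> r i < d" if x: "x \<in> Bad k" and d: "0 < d" for x d
    proof -
      obtain d' where d': "d' > 0" "ball x d' \<subseteq> \<gamma> x"
        using gaugeD[OF g, of x] openE by blast
      obtain y where y: "y \<in> {a<..<b}" "y \<noteq> x" "\<bar>y - x\<bar> < min d d'" "\<bar>F y - F x - h x * (y - x)\<bar> > \<bar>y - x\<bar> / real (Suc k)"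
      proof -
        have "min d d' > 0" using d d' by simp
        then show ?thesis using x that unfolding Bad_def by blast
      qed
      have "Q (x, y) \<subseteq> ball x d'" using y by (auto simp: Q dist_real_def)
      then have "(x, y) \<in> K" using x y d' by (auto simp: K_def)
      moreover have "x \<in> cball (c (x, y)) (r (x, y))" using Q[of "(x, y)"] by (simp add: Q_def)
      moreover have "r (x, y) < d" using y d by (simp add: r_def)
      ultimately show ?thesis by blast
    qed
    obtain C where C: "countable C" "C \<subseteq> K"
      "pairwise (\<lambda>i j. disjnt (cball (c i) (r i)) (cball (c j) (r j))) C"
      "negligible (Bad k - (\<Union>i\<in>C. cball (c i) (r i)))"
      using Vitali_covering_theorem_cballs[of K r "Bad k" c, OF rpos fine] by blast
    have disj: "Q i \<inter> Q j = {}" if "i \<in> C" "j \<in> C" "i \<noteq> j" for i j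
      using C(3) that by (auto simp: pairwise_def disjnt_def Q_def)
    have fstQ: "fst i \<in> Q i" for i by (simp add: Q)
    \<comment> \<open>Henstock's lemma speaks of finite families only; a bound uniform over the
      finite subfamilies passes to the countable union.\<close>
    have bound: "measure lebesgue (\<Union>i\<in>I. Q i) \<le> e" if I: "I \<subseteq> C" "finite I" for I
    proof -
      define p where "p = (\<lambda>i. (fst i, Q i)) ` I"
      have inj: "inj_on (\<lambda>i. (fst i, Q i)) I"
        using disj I fstQ by (auto simp: inj_on_def) (metis Int_absorb disj empty_iff fst_conv subsetD)
      have "p tagged_partial_division_of (cbox a b)"
        unfolding tagged_partial_division_of_def
      proof (intro conjI allI impI)
        show "finite p" using I by (simp add: p_def)
        fix x k' assume xk: "(x, k') \<in> p"
        then obtain i where i: "i \<in> I" "x = fst i" "k' = Q i" by (auto simp: p_def)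
        then have "i \<in> K" using I C by auto
        then have "fst i \<in> {a<..<b}" "snd i \<in> {a<..<b}" by (auto simp: K_def Bad_def)
        then show "k' \<subseteq> cbox a b" using i by (auto simp: Q)
        show "x \<in> k'" using i fstQ by simp
        show "\<exists>a b. k' = cbox a b" using i Q by auto
      next
        fix x k' x2 k2 assume *: "(x, k') \<in> p \<and> (x2, k2) \<in> p \<and> (x, k') \<noteq> (x2, k2)"
        then obtain i j where i: "i \<in> I" "x = fst i" "k' = Q i" and j: "j \<in> I" "x2 = fst j" "k2 = Q j"
          by (auto simp: p_def)
        then have "i \<noteq> j" using * by auto
        then have "k' \<inter> k2 = {}" using disj[of i j] i j I by auto
        then show "interior k' \<inter> interior k2 = {}" using interior_subset by blast
      qed
      moreover have "\<gamma> fine p" using I C by (fastforce simp: p_def fine_def K_def)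
      ultimately have "sum (\<lambda>(x,k). norm (measure lborel k *\<^sub>R h x - integral k h)) p < e / real (Suc k)"
        by (rule hen)
      then have hs: "(\<Sum>i\<in>I. norm (measure lborel (Q i) *\<^sub>R h (fst i) - integral (Q i) h)) < e / real (Suc k)"
        unfolding p_def by (subst (asm) sum.reindex[OF inj]) (simp add: o_def)
      have single: "measure lborel (Q i) \<le> real (Suc k) * norm (measure lborel (Q i) *\<^sub>R h (fst i) - integral (Q i) h)" if "i \<in> I" for i
      proof -
        obtain x y where i: "i = (x, y)" by (cases i)
        have "i \<in> K" using that I C by auto
        then have xy: "x \<in> {a<..<b}" "y \<in> {a<..<b}" and gt: "\<bar>F y - F x - h x * (y - x)\<bar> > \<bar>y - x\<bar> / real (Suc k)"
          using i by (auto simp: K_def Bad_def)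
        have cq: "measure lborel (Q i) = \<bar>y - x\<bar>" by (auto simp: Q i min_def max_def)
        have "\<bar>measure lborel (Q i) * h x - integral (Q i) h\<bar> = \<bar>F y - F x - h x * (y - x)\<bar>"
        proof (cases "x \<le> y")
          case True
          then have "integral (Q i) h = F y - F x" using F_diff[of x y] xy i by (simp add: Q)
          then show ?thesis using cq True by (simp add: abs_minus_commute mult.commute)
        next
          case False
          then have "integral (Q i) h = F x - F y" using F_diff[of y x] xy i by (simp add: Q)
          moreover have "measure lborel (Q i) = x - y" using cq False by linarith
          ultimately have eq: "integral (Q i) h = F x - F y" "measure lborel (Q i) = x - y" .
          have "measure lborel (Q i) * h x - integral (Q i) h = F y - F x - h x * (y - x)"
            unfolding eq by (simp add: algebra_simps)
          then show ?thesis by simp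
        qed
        then have "measure lborel (Q i) / real (Suc k) < norm (measure lborel (Q i) *\<^sub>R h (fst i) - integral (Q i) h)"
          using gt cq i by simp
        then show ?thesis by (simp add: field_simps)
      qed
      have "measure lebesgue (\<Union>i\<in>I. Q i) \<le> (\<Sum>i\<in>I. measure lebesgue (Q i))"
        using I by (intro measure_UNION_le) (auto simp: Q)
      also have "\<dots> = (\<Sum>i\<in>I. measure lborel (Q i))" by (intro sum.cong) (auto simp: Q)
      also have "\<dots> \<le> (\<Sum>i\<in>I. real (Suc k) * norm (measure lborel (Q i) *\<^sub>R h (fst i) - integral (Q i) h))"
        by (intro sum_mono single)
      also have "\<dots> = real (Suc k) * (\<Sum>i\<in>I. norm (measure lborel (Q i) *\<^sub>R h (fst i) - integral (Q i) h))"
        by (simp add: sum_distrib_left)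
      also have "\<dots> \<le> real (Suc k) * (e / real (Suc k))" using hs by (intro mult_left_mono) auto
      also have "\<dots> = e" by simp
      finally show ?thesis .
    qed
    have Qm: "Q i \<in> lmeasurable" for i by (simp add: Q_def)
    have "(\<Union>i\<in>C. Q i) \<in> lmeasurable" "measure lebesgue (\<Union>i\<in>C. Q i) \<le> e"
      using fmeasurable_UN_bound[OF C(1) Qm bound] measure_UN_bound[OF C(1) Qm bound] by auto
    have neg: "negligible (Bad k - (\<Union>i\<in>C. Q i))" using C(4) by (simp add: Q_def)
    then have null: "Bad k - (\<Union>i\<in>C. Q i) \<in> null_sets lebesgue" by (simp only: negligible_iff_null_sets)
    have "(\<Union>i\<in>C. Q i) \<union> (Bad k - (\<Union>i\<in>C. Q i)) \<in> lmeasurable"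
      by (rule fmeasurable.Un[OF \<open>(\<Union>i\<in>C. Q i) \<in> lmeasurable\<close> negligible_imp_measurable[OF neg]])
    moreover have "measure lebesgue ((\<Union>i\<in>C. Q i) \<union> (Bad k - (\<Union>i\<in>C. Q i))) \<le> e"
      using measure_Un_null_set[OF fmeasurableD[OF \<open>(\<Union>i\<in>C. Q i) \<in> lmeasurable\<close>] null]
        \<open>measure lebesgue (\<Union>i\<in>C. Q i) \<le> e\<close> by (simp only:)
    ultimately show "\<exists>T. Bad k \<subseteq> T \<and> T \<in> lmeasurable \<and> measure lebesgue T \<le> e"
      by (intro exI[of _ "(\<Union>i\<in>C. Q i) \<union> (Bad k - (\<Union>i\<in>C. Q i))"] conjI) (simp_all only: Un_Diff_cancel Un_upper2)
  qed
  then have neg: "negligible (\<Union>k. Bad k)" by (rule negligible_Union_nat)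
  show ?thesis
  proof (rule that[OF neg])
    fix x assume x: "x \<in> {a<..<b} - (\<Union>k. Bad k)"
    have "(F has_derivative (\<lambda>u. h x * u)) (at x)"
      unfolding has_derivative_at_alt
    proof (intro conjI allI impI)
      fix e :: real assume "e > 0"
      then obtain k where k: "inverse (real (Suc k)) < e" using reals_Archimedean by blast
      have "x \<notin> Bad k" using x by auto
      then obtain d where d: "d > 0" "\<And>y. y \<in> {a<..<b} \<Longrightarrow> y \<noteq> x \<Longrightarrow> \<bar>y - x\<bar> < d \<Longrightarrow>
          \<bar>F y - F x - h x * (y - x)\<bar> \<le> \<bar>y - x\<bar> / real (Suc k)"
        using x unfolding Bad_def by (force simp: not_less)
      show "\<exists>d>0. \<forall>y. norm (y - x) < d \<longrightarrow> norm (F y - F x - h x * (y - x)) \<le> e * norm (y - x)"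
      proof (intro exI[of _ "min d (min (x - a) (b - x))"] conjI allI impI)
        fix y assume y: "norm (y - x) < min d (min (x - a) (b - x))"
        show "norm (F y - F x - h x * (y - x)) \<le> e * norm (y - x)"
        proof (cases "y = x")
          case False
          have "\<bar>F y - F x - h x * (y - x)\<bar> \<le> \<bar>y - x\<bar> / real (Suc k)"
            using y x False by (intro d) (auto simp: abs_if split: if_splits)
          also have "\<dots> \<le> e * \<bar>y - x\<bar>"
            using mult_left_mono[OF less_imp_le[OF k], of "\<bar>y - x\<bar>"] by (simp add: divide_inverse mult.commute)
          finally show ?thesis by simp
        qed simp
      qed (use d x in auto)
    qed (rule bounded_linear_mult_right)
    then show "((\<lambda>x. integral {a..x} h) has_real_derivative h x) (at x)"
      by (simp add: has_field_derivative_def F_def[abs_def])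
  qed
qed

lemma AE_lborel_imp_negligible:
  assumes "AE x in lborel. P (x :: 'a::euclidean_space)"
  shows "negligible {x. \<not> P x}"
proof -
  from assms obtain N where "N \<in> null_sets lborel" "{x. \<not> P x} \<subseteq> N"
    by (auto simp: eventually_ae_filter)
  then show ?thesis
    by (meson negligible_iff_null_sets negligible_subset null_sets_completionI)
qed

lemma negligible_imp_AE_lborel:
  fixes N :: "'a::euclidean_space set"
  assumes "negligible N"
  shows "AE x in lborel. x \<notin> N"
proof -
  have "AE x in lebesgue. x \<notin> N"
    using assms by (intro AE_not_in) (simp add: negligible_iff_null_sets)
  then show ?thesis by (simp add: AE_completion_iff)
qed

corollary ac_on_set_lebesgue_integral:
  fixes f :: "real \<Rightarrow> real"
  assumes "a \<le> b" "ac_on a b f" and g: "set_integrable lborel {a..b} g"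
    and deriv: "AE s in lborel. s \<in> {a<..<b} \<longrightarrow> (f has_real_derivative g s) (at s)"
  shows "(LBINT s:{a..b}. g s) = f b - f a"
proof -
  let ?N = "{s. \<not> (s \<in> {a<..<b} \<longrightarrow> (f has_real_derivative g s) (at s))} \<union> {a, b}"
  have "(g has_integral (f b - f a)) {a..b}"
  proof (rule ac_on_has_integral[OF assms(1,2)])
    show "negligible ?N" using AE_lborel_imp_negligible[OF deriv] by (intro negligible_Un) auto
    fix x assume "x \<in> {a..b} - ?N"
    then have "(f has_real_derivative g x) (at x)" by auto
    then show "(f has_vector_derivative g x) (at x within {a..b})"
      by (simp add: has_real_derivative_iff_has_vector_derivative has_vector_derivative_at_within)
  qed
  then show ?thesis
    using set_borel_integral_eq_integral(2)[OF g] by (simp add: integral_unique)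
qed

corollary set_integral_has_derivative_AE:
  fixes h :: "real \<Rightarrow> real"
  assumes h: "set_integrable lborel {a..b} h"
  shows "AE s in lborel. s \<in> {a<..<b} \<longrightarrow> ((\<lambda>x. LBINT y:{a..x}. h y) has_real_derivative h s) (at s)"
proof -
  obtain N where N: "negligible N"
    "\<And>x. x \<in> {a<..<b} - N \<Longrightarrow> ((\<lambda>x. integral {a..x} h) has_real_derivative h x) (at x)"
    using integral_has_derivative_AE[OF set_borel_integral_eq_integral(1)[OF h]] by blast
  show ?thesis
    using negligible_imp_AE_lborel[OF N(1)]
  proof eventually_elim
    case (elim s)
    show ?case
    proof
      assume s: "s \<in> {a<..<b}"
      have eq: "(LBINT y:{a..x}. h y) = integral {a..x} h" if "x \<in> {a<..<b}" for x
        using that by (intro set_borel_integral_eq_integral(2) set_integrable_subset[OF h]) auto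
      have "((\<lambda>x. integral {a..x} h) has_real_derivative h s) (at s)" using N(2) s elim by auto
      then show "((\<lambda>x. LBINT y:{a..x}. h y) has_real_derivative h s) (at s)"
        by (rule has_field_derivative_transform_within_open[where S="{a<..<b}"]) (use s eq in auto)
    qed
  qed
qed

text \<open>Almost every point is a Lebesgue point: for a countable dense set of vectors \<open>d\<close> the scalar
  theorem applies to the functions \<open>norm (v x - d)\<close>.\<close>

theorem Bochner_integral_has_derivative_AE:
  fixes v :: "real \<Rightarrow> 'a::{banach, second_countable_topology}"
  assumes v: "set_integrable lborel {a..b} v"
  shows "AE s in lborel. s \<in> {a<..<b} \<longrightarrow> ((\<lambda>x. LBINT y:{a..x}. v y) has_vector_derivative v s) (at s)"
proof -
  obtain D :: "'a set" where D: "countable D" "\<And>X. open X \<Longrightarrow> X \<noteq> {} \<Longrightarrow> \<exists>d\<in>D. d \<in> X"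
    using countable_dense_exists[where 'a='a] by blast
  define V where "V x = (LBINT y:{a..x}. v y)" for x
  have ni: "set_integrable lborel {a..b} (\<lambda>x. norm (v x - d))" for d
    by (intro set_integrable_norm set_integral_diff v) (simp add: set_integrable_def integrable_indicator_iff less_top[symmetric] borel_integrable_compact)
  have "AE s in lborel. \<forall>d\<in>D. s \<in> {a<..<b} \<longrightarrow>
     ((\<lambda>x. LBINT y:{a..x}. norm (v y - d)) has_real_derivative norm (v s - d)) (at s)"
    by (intro AE_ball_countable'[OF _ D(1)] set_integral_has_derivative_AE ni)
  then show ?thesis
  proof eventually_elim
    case (elim s)
    show ?case
    proof
      assume s: "s \<in> {a<..<b}"
      have "(V has_derivative (\<lambda>h. h *\<^sub>R v s)) (at s)"
        unfolding has_derivative_at_alt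
      proof (intro conjI allI impI)
        show "bounded_linear (\<lambda>h. h *\<^sub>R v s)" by (rule bounded_linear_scaleR_left)
        fix e :: real assume e: "e > 0"
        \<comment> \<open>The three thirds are the error of \<open>d\<close> against
          \<open>v s\<close>, that of the derivative of \<open>F\<close>, and the constant term
          \<open>d - v s\<close> in the triangle inequality below.\<close>
        obtain d where d: "d \<in> D" "norm (v s - d) < e / 3"
          using D(2)[of "ball (v s) (e / 3)"] e by (auto simp: dist_norm)
        define F where "F x = (LBINT y:{a..x}. norm (v y - d))" for x
        have "(F has_derivative (\<lambda>h. norm (v s - d) * h)) (at s)"
          using elim d(1) s by (simp add: F_def[abs_def] has_field_derivative_def)
        then obtain r where r: "r > 0" "\<And>y. norm (y - s) < r \<Longrightarrow>
            norm (F y - F s - norm (v s - d) * (y - s)) \<le> e / 3 * norm (y - s)"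
          unfolding has_derivative_at_alt using e by (meson divide_pos_pos zero_less_numeral)
        have diff: "norm (V q - V p - (q - p) *\<^sub>R v s) \<le> F q - F p + e / 3 * (q - p)"
          if pq: "a \<le> p" "p \<le> q" "q \<le> b" for p q
        proof -
          have vi: "set_integrable lborel {p..q} v" using pq by (intro set_integrable_subset[OF v]) auto
          have ci: "set_integrable lborel {p..q} (\<lambda>_. c)" for c :: 'a
            by (simp add: set_integrable_def integrable_indicator_iff less_top[symmetric] borel_integrable_compact)
          have const: "(LBINT y:{p..q}. c) = (q - p) *\<^sub>R c" for c :: 'a
            using pq by (simp add: set_lebesgue_integral_def)
          have "V q - V p - (q - p) *\<^sub>R v s = (LBINT y:{p..q}. v y) - (LBINT y:{p..q}. v s)"
            using set_integral_Icc_diff[OF v pq] by (simp add: V_def const)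
          also have "\<dots> = (LBINT y:{p..q}. v y - v s)"
            using vi ci by (simp add: set_integral_diff)
          also have "\<dots> = (LBINT y:{p..q}. v y - d) + (LBINT y:{p..q}. d - v s)"
            using set_integral_add(2)[OF set_integral_diff(1)[OF vi ci[of d]] ci[of "d - v s"]] by simp
          finally have "norm (V q - V p - (q - p) *\<^sub>R v s) \<le> norm (LBINT y:{p..q}. v y - d) + norm (LBINT y:{p..q}. d - v s)"
            using norm_triangle_ineq by metis
          also have "norm (LBINT y:{p..q}. v y - d) \<le> (LBINT y:{p..q}. norm (v y - d))"
            using set_integral_diff(1)[OF vi ci[of d]] by (rule set_integral_norm_bound)
          also have "\<dots> = F q - F p" using set_integral_Icc_diff[OF ni pq] by (simp add: F_def)
          also have "norm (LBINT y:{p..q}. d - v s) \<le> e / 3 * (q - p)"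
            using mult_right_mono[of "norm (v s - d)" "e / 3" "q - p"] d pq
            by (simp add: const norm_minus_commute mult.commute)
          finally show ?thesis by simp
        qed
        show "\<exists>r>0. \<forall>y. norm (y - s) < r \<longrightarrow> norm (V y - V s - (y - s) *\<^sub>R v s) \<le> e * norm (y - s)"
        proof (intro exI[of _ "min r (min (s - a) (b - s))"] conjI allI impI)
          fix y assume y: "norm (y - s) < min r (min (s - a) (b - s))"
          then have ry: "\<bar>F y - F s - norm (v s - d) * (y - s)\<bar> \<le> e / 3 * \<bar>y - s\<bar>" using r(2)[of y] by simp
          have yab: "a \<le> y" "y \<le> b" using y by (auto simp: abs_if split: if_splits)
          have "norm (v s - d) * \<bar>y - s\<bar> \<le> e / 3 * \<bar>y - s\<bar>" using d by (intro mult_right_mono) auto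
          moreover have "norm (V y - V s - (y - s) *\<^sub>R v s) \<le> \<bar>F y - F s\<bar> + e / 3 * \<bar>y - s\<bar>"
          proof (cases "s \<le> y")
            case True
            then show ?thesis using diff[of s y] s yab by simp
          next
            case False
            have "V y - V s - (y - s) *\<^sub>R v s = - (V s - V y - (s - y) *\<^sub>R v s)" by (simp add: algebra_simps)
            then have "norm (V y - V s - (y - s) *\<^sub>R v s) = norm (V s - V y - (s - y) *\<^sub>R v s)"
              by (simp only: norm_minus_cancel)
            then show ?thesis using diff[of y s] s yab False by simp
          qed
          moreover have "\<bar>F y - F s\<bar> \<le> \<bar>F y - F s - norm (v s - d) * (y - s)\<bar> + norm (v s - d) * \<bar>y - s\<bar>"
            using abs_triangle_ineq[of "F y - F s - norm (v s - d) * (y - s)" "norm (v s - d) * (y - s)"]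
            by (simp add: abs_mult)
          ultimately show "norm (V y - V s - (y - s) *\<^sub>R v s) \<le> e * norm (y - s)" using ry by simp
        qed (use r s in auto)
      qed
      then show "((\<lambda>x. LBINT y:{a..x}. v y) has_vector_derivative v s) (at s)"
        by (simp add: has_vector_derivative_def V_def[abs_def])
    qed
  qed
qed

subsection \<open>Orthonormal bases and diagonal operators\<close>

text \<open>A basis of a closed subspace and not of the type, because the interval length is a
  parameter and so the function space is only a subspace of \<open>l2\<close>. Vectors outside
  \<open>H\<close> still have coefficients; summing these projects orthogonally onto
  \<open>H\<close>.\<close>

locale orthonormal_basis =
  fixes H :: "'a::{real_inner, banach} set" and e :: "nat \<Rightarrow> 'a"
  assumes orthonormal: "inner (e i) (e j) = (if i = j then 1 else 0)"
    and subspace: "subspace H" and closed: "closed H" and basis_in: "e n \<in> H"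
    and total: "x \<in> H \<Longrightarrow> (\<And>n. inner x (e n) = 0) \<Longrightarrow> x = 0"
begin

lemma coeff_eqI:
  assumes "x \<in> H" "y \<in> H" "\<And>n. inner x (e n) = inner y (e n)"
  shows "x = y"
  using total[of "x - y"] assms subspace_diff[OF subspace] by (simp add: inner_diff_left)

lemma inner_finite_sum: "finite F \<Longrightarrow> inner (\<Sum>n\<in>F. a n *\<^sub>R e n) (e m) = (if m \<in> F then a m else 0)"
  by (simp add: inner_sum_left orthonormal if_distrib[of "\<lambda>x. _ * x"] sum.delta cong: if_cong)

lemma norm_finite_sum: "finite F \<Longrightarrow> (norm (\<Sum>n\<in>F. a n *\<^sub>R e n))\<^sup>2 = (\<Sum>n\<in>F. (a n)\<^sup>2)"
  unfolding power2_norm_eq_inner by (simp add: inner_sum_right inner_finite_sum power2_eq_square)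

lemma bessel_finite:
  assumes "finite F"
  shows "(\<Sum>n\<in>F. (inner x (e n))\<^sup>2) \<le> (norm x)\<^sup>2"
proof -
  let ?p = "\<Sum>n\<in>F. inner x (e n) *\<^sub>R e n"
  have "inner x ?p = (\<Sum>n\<in>F. (inner x (e n))\<^sup>2)"
    by (simp add: inner_sum_right power2_eq_square)
  moreover have "inner ?p ?p = (\<Sum>n\<in>F. (inner x (e n))\<^sup>2)"
    using norm_finite_sum[OF assms, of "\<lambda>n. inner x (e n)"] by (simp add: power2_norm_eq_inner)
  moreover have "0 \<le> inner (x - ?p) (x - ?p)" by simp
  ultimately show ?thesis
    by (simp add: inner_diff_left inner_diff_right inner_commute[of ?p x] power2_norm_eq_inner)
qed

lemma summable_coeff_square: "summable (\<lambda>n. (inner x (e n))\<^sup>2)"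
  by (rule summableI_nonneg_bounded[where x="(norm x)\<^sup>2"]) (auto intro: bessel_finite)

definition synth :: "(nat \<Rightarrow> real) \<Rightarrow> 'a" where
  "synth a = (\<Sum>n. a n *\<^sub>R e n)"

context
  fixes a :: "nat \<Rightarrow> real"
  assumes a: "summable (\<lambda>n. (a n)\<^sup>2)"
begin

lemma synth_sums: "(\<lambda>n. a n *\<^sub>R e n) sums synth a"
proof -
  have "summable (\<lambda>n. a n *\<^sub>R e n)"
    unfolding summable_Cauchy
  proof (intro allI impI)
    fix r :: real assume "r > 0"
    then have "r\<^sup>2 > 0" by simp
    then obtain N where N: "\<And>m n. m \<ge> N \<Longrightarrow> norm (\<Sum>k=m..<n. (a k)\<^sup>2) < r\<^sup>2"
      using a unfolding summable_Cauchy by metis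
    show "\<exists>N. \<forall>m\<ge>N. \<forall>n. norm (\<Sum>k=m..<n. a k *\<^sub>R e k) < r"
    proof (intro exI[of _ N] allI impI)
      fix m n assume "N \<le> m"
      then have "(norm (\<Sum>k=m..<n. a k *\<^sub>R e k))\<^sup>2 < r\<^sup>2"
        using N[of m n] by (simp add: norm_finite_sum sum_nonneg)
      then show "norm (\<Sum>k=m..<n. a k *\<^sub>R e k) < r"
        using \<open>r > 0\<close> by (simp add: power_less_imp_less_base)
    qed
  qed
  then show ?thesis unfolding synth_def by (rule summable_sums)
qed

lemma synth_in: "synth a \<in> H"
proof (rule closed_sequentially[OF closed])
  show "(\<lambda>N. \<Sum>n<N. a n *\<^sub>R e n) \<longlonglongrightarrow> synth a" using synth_sums by (simp add: sums_def)
qed (intro subspace_sum subspace_scale subspace basis_in)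

lemma inner_synth: "inner (synth a) (e m) = a m"
proof -
  have "(\<lambda>n. inner (a n *\<^sub>R e n) (e m)) sums inner (synth a) (e m)"
    using bounded_linear.sums[OF bounded_linear_inner_left synth_sums] .
  moreover have "(\<lambda>n. inner (a n *\<^sub>R e n) (e m)) = (\<lambda>n. if n = m then a n else 0)"
    by (auto simp: orthonormal)
  ultimately show ?thesis using sums_single[of m a] sums_unique2 by metis
qed

end

lemma coeff_sums:
  assumes "x \<in> H"
  shows "(\<lambda>n. inner x (e n) *\<^sub>R e n) sums x"
proof -
  have "synth (\<lambda>n. inner x (e n)) = x"
    by (intro coeff_eqI synth_in summable_coeff_square assms inner_synth)
  then show ?thesis using synth_sums[OF summable_coeff_square[of x]] by simp
qed

lemma parseval:
  assumes "x \<in> H"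
  shows "(\<lambda>n. inner x (e n) * inner y (e n)) sums inner x y"
  using bounded_linear.sums[OF bounded_linear_inner_left coeff_sums[OF assms], of y]
  by (simp add: inner_commute)

lemma parseval_norm:
  assumes "x \<in> H"
  shows "(\<lambda>n. (inner x (e n))\<^sup>2) sums (norm x)\<^sup>2"
  using parseval[OF assms, of x] unfolding power2_norm_eq_inner by (simp add: power2_eq_square)

text \<open>Applying \<open>f\<close> to a partial sum \<open>s\<close> of its own coefficients
  gives \<open>norm s * norm s \<le> norm s * C\<close>, hence square summability, and the
  coefficients assemble to the representing vector. It is what produces adjoints later.\<close>

lemma riesz_representation:
  assumes f: "bounded_linear f"
  obtains v where "v \<in> H" "\<And>x. x \<in> H \<Longrightarrow> f x = inner x v"
proof -
  interpret f: bounded_linear f by fact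
  obtain C where C: "C > 0" "\<And>x. norm (f x) \<le> norm x * C" using f.pos_bounded by blast
  have "summable (\<lambda>n. (f (e n))\<^sup>2)"
  proof (rule summableI_nonneg_bounded)
    fix N
    let ?s = "\<Sum>n<N. f (e n) *\<^sub>R e n" and ?S = "\<Sum>n<N. (f (e n))\<^sup>2"
    have S0: "?S \<ge> 0" by (simp add: sum_nonneg)
    have nS: "(norm ?s)\<^sup>2 = ?S" by (simp add: norm_finite_sum)
    have "f ?s = ?S" by (simp add: f.sum f.scaleR power2_eq_square)
    then have "?S \<le> norm ?s * C" using C(2)[of ?s] by simp
    then have "norm ?s * norm ?s \<le> norm ?s * C" using nS by (simp add: power2_eq_square)
    then have "norm ?s \<le> C" using C(1) by (cases "norm ?s = 0") auto
    then show "?S \<le> C\<^sup>2" unfolding nS[symmetric] by (intro power_mono) auto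
  qed simp
  note v = synth_in[OF this] inner_synth[OF this]
  show ?thesis
  proof (rule that[OF v(1)])
    fix x assume x: "x \<in> H"
    have "(\<lambda>n. f (inner x (e n) *\<^sub>R e n)) sums f x"
      using f.sums[OF coeff_sums[OF x]] .
    moreover have "(\<lambda>n. f (inner x (e n) *\<^sub>R e n)) = (\<lambda>n. inner x (e n) * inner (synth (\<lambda>n. f (e n))) (e n))"
      by (simp add: f.scaleR v(2))
    ultimately show "f x = inner x (synth (\<lambda>n. f (e n)))"
      using parseval[OF x, of "synth (\<lambda>n. f (e n))"] sums_unique2 by metis
  qed
qed

section \<open>Bounded multipliers with respect to the basis\<close>

text \<open>Bounded coefficients give an operator bounded on the whole type, since the projection
  onto \<open>H\<close> is built into the coefficients. It can therefore be used as a bounded linear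
  map without restricting its domain.\<close>

definition diag :: "(nat \<Rightarrow> real) \<Rightarrow> 'a \<Rightarrow> 'a" where
  "diag a x = synth (\<lambda>n. a n * inner x (e n))"

lemma summable_mult_coeff:
  assumes "\<And>n. \<bar>a n\<bar> \<le> C"
  shows "summable (\<lambda>n. (a n * inner x (e n))\<^sup>2)"
proof (rule summable_comparison_test'[of "\<lambda>n. C\<^sup>2 * (inner x (e n))\<^sup>2" 0])
  show "summable (\<lambda>n. C\<^sup>2 * (inner x (e n))\<^sup>2)" by (intro summable_mult summable_coeff_square)
  fix n
  have "(a n)\<^sup>2 \<le> C\<^sup>2" using power_mono[OF assms[of n], of 2] by simp
  then show "norm ((a n * inner x (e n))\<^sup>2) \<le> C\<^sup>2 * (inner x (e n))\<^sup>2"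
    by (simp add: power_mult_distrib mult_right_mono)
qed

context
  fixes a :: "nat \<Rightarrow> real" and C :: real
  assumes a: "\<And>n. \<bar>a n\<bar> \<le> C"
begin

lemma diag_in: "diag a x \<in> H"
  unfolding diag_def by (rule synth_in[OF summable_mult_coeff[OF a]])

lemma inner_diag_basis: "inner (diag a x) (e n) = a n * inner x (e n)"
  unfolding diag_def by (rule inner_synth[OF summable_mult_coeff[OF a]])

lemma norm_diag_le: "norm (diag a x) \<le> C * norm x"
proof -
  have C: "C \<ge> 0" using a[of 0] by simp
  have "(norm (diag a x))\<^sup>2 = (\<Sum>n. (a n * inner x (e n))\<^sup>2)"
    using sums_unique[OF parseval_norm[OF diag_in]] by (simp add: inner_diag_basis)
  also have "\<dots> \<le> C\<^sup>2 * (norm x)\<^sup>2"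
  proof (rule suminf_le_const[OF summable_mult_coeff[OF a]])
    fix N
    have "(\<Sum>n<N. (a n * inner x (e n))\<^sup>2) \<le> (\<Sum>n<N. C\<^sup>2 * (inner x (e n))\<^sup>2)"
      using power_mono[OF a abs_ge_zero, of _ 2] by (intro sum_mono) (simp add: power_mult_distrib mult_right_mono)
    also have "\<dots> \<le> C\<^sup>2 * (norm x)\<^sup>2"
      unfolding sum_distrib_left[symmetric] by (intro mult_left_mono bessel_finite) auto
    finally show "(\<Sum>n<N. (a n * inner x (e n))\<^sup>2) \<le> C\<^sup>2 * (norm x)\<^sup>2" .
  qed
  finally have "(norm (diag a x))\<^sup>2 \<le> (C * norm x)\<^sup>2" by (simp add: power_mult_distrib)
  then show ?thesis by (rule power2_le_imp_le) (use C in simp)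
qed

lemma bounded_linear_diag: "bounded_linear (diag a)"
proof (rule bounded_linear_intro[where K=C])
  show "diag a (x + y) = diag a x + diag a y" for x y
    by (intro coeff_eqI subspace_add subspace diag_in)
      (simp add: inner_add_left inner_diag_basis distrib_left)
  show "diag a (r *\<^sub>R x) = r *\<^sub>R diag a x" for r x
    by (intro coeff_eqI subspace_scale subspace diag_in) (simp add: inner_diag_basis)
  show "norm (diag a x) \<le> norm x * C" for x using norm_diag_le[of x] by (simp add: mult.commute)
qed

lemma diag_selfadjoint: "inner (diag a x) y = inner x (diag a y)"
proof -
  have "(\<lambda>n. inner (diag a x) (e n) * inner y (e n)) sums inner (diag a x) y" by (rule parseval[OF diag_in])
  moreover have "(\<lambda>n. inner (diag a y) (e n) * inner x (e n)) sums inner (diag a y) x" by (rule parseval[OF diag_in])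
  moreover have "(\<lambda>n. inner (diag a x) (e n) * inner y (e n)) = (\<lambda>n. inner (diag a y) (e n) * inner x (e n))"
    by (simp add: inner_diag_basis mult.commute mult.left_commute)
  ultimately show ?thesis using sums_unique2 by (metis inner_commute)
qed

end

end

subsection \<open>The Dirichlet Laplacian in the sine basis\<close>

lemma sq_integrable_rep_zero_ext [simp]: "sq_integrable (zero_ext L (rep_l2 x))"
proof (rule sq_integrable_bound[OF rep_sq[of x]])
  have [measurable]: "rep_l2 x \<in> borel_measurable lborel" using rep_sq[of x] by (simp add: sq_integrable_def)
  show "zero_ext L (rep_l2 x) \<in> borel_measurable lborel" unfolding zero_ext_def[abs_def] by measurable
qed (auto simp: zero_ext_def indicator_def)

lemma sq_integrable_zero_ext_continuous:
  assumes "continuous_on {0..L} f"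
  shows "sq_integrable (zero_ext L f)"
proof -
  have "bounded (f ` {0..L})" by (intro compact_imp_bounded compact_continuous_image assms) simp
  then obtain C where C: "\<And>s. s \<in> {0..L} \<Longrightarrow> \<bar>f s\<bar> \<le> C" unfolding bounded_iff by (metis imageI real_norm_def)
  have c: "continuous_on {0<..<L} f" using assms by (rule continuous_on_subset) auto
  show ?thesis
  proof (rule sq_integrable_bound[where g="\<lambda>s. C * indicator {0<..<L} s"])
    have "(\<lambda>s. (indicator {0<..<L} s :: real)\<^sup>2) = indicator {0<..<L}" by (auto simp: indicator_def)
    then show "sq_integrable (\<lambda>s. C * indicator {0<..<L} s)"
      by (intro sq_integrable_scale) (simp add: sq_integrable_def integrable_indicator_iff emeasure_bounded_finite[unfolded infinity_ennreal_def])
    show "zero_ext L f \<in> borel_measurable lborel"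
      using borel_measurable_continuous_on_indicator[OF _ c] by (simp add: zero_ext_def[abs_def])
    have "\<bar>zero_ext L f s\<bar> \<le> \<bar>C * indicator {0<..<L} s\<bar>" for s
      using C[of s] by (auto simp: zero_ext_def indicator_def)
    then show "AE s in lborel. \<bar>zero_ext L f s\<bar> \<le> \<bar>C * indicator {0<..<L} s\<bar>" by simp
  qed
qed

lemma class_zero_ext_in_X_space:
  assumes "sq_integrable (zero_ext L f)"
  shows "l2_class (zero_ext L f) \<in> X_space L"
  unfolding X_space_def using rep_class[OF assms]
  by (auto elim!: eventually_mono simp: zero_ext_def)

lemma X_space_class:
  assumes "x \<in> X_space L"
  shows "x = l2_class (zero_ext L (rep_l2 x))"
proof -
  have "AE s in lborel. rep_l2 x s = zero_ext L (rep_l2 x) s"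
    using assms unfolding X_space_def mem_Collect_eq
    by eventually_elim (auto simp: zero_ext_def indicator_def)
  then show ?thesis using class_eq_iff[of "rep_l2 x" "zero_ext L (rep_l2 x)"] by simp
qed

text \<open>As an intersection of kernels of functionals, the space is visibly a closed
  subspace.\<close>

lemma X_space_orthogonal:
  "X_space L = (\<Inter>y\<in>{y. AE s in lborel. s \<in> {0<..<L} \<longrightarrow> rep_l2 y s = 0}. {x. inner x y = 0})"
proof (intro equalityI subsetI INT_I)
  fix x y assume x: "x \<in> X_space L" and y: "y \<in> {y. AE s in lborel. s \<in> {0<..<L} \<longrightarrow> rep_l2 y s = 0}"
  have "inner x y = (LBINT s. rep_l2 x s * rep_l2 y s)" using inner_class[OF rep_sq rep_sq, of x y] by simp
  also have "\<dots> = 0"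
  proof (rule integral_eq_zero_AE)
    have "AE s in lborel. s \<notin> {0<..<L} \<longrightarrow> rep_l2 x s = 0" using x by (simp add: X_space_def)
    moreover have "AE s in lborel. s \<in> {0<..<L} \<longrightarrow> rep_l2 y s = 0" using y by simp
    ultimately show "AE s in lborel. rep_l2 x s * rep_l2 y s = 0" by eventually_elim auto
  qed
  finally show "x \<in> {x. inner x y = 0}" by simp
next
  fix x assume x: "x \<in> (\<Inter>y\<in>{y. AE s in lborel. s \<in> {0<..<L} \<longrightarrow> rep_l2 y s = 0}. {x. inner x y = 0})"
  \<comment> \<open>The part of \<open>x\<close> off the interval is itself an admissible test
    vector, and its inner product with \<open>x\<close> is its own squared norm.\<close>
  define g where "g s = rep_l2 x s - zero_ext L (rep_l2 x) s" for s
  have g: "sq_integrable g" unfolding g_def[abs_def] by (intro sq_integrable_diff) simp_all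
  have g0: "g s = 0" if "s \<in> {0<..<L}" for s using that by (simp add: g_def zero_ext_def)
  have "AE s in lborel. s \<in> {0<..<L} \<longrightarrow> rep_l2 (l2_class g) s = 0"
    using rep_class[OF g] by eventually_elim (auto simp: g0)
  then have "inner x (l2_class g) = 0" using x by auto
  then have "(LBINT s. rep_l2 x s * g s) = 0" using inner_class[OF rep_sq g, of x] by simp
  also have "(\<lambda>s. rep_l2 x s * g s) = (\<lambda>s. (g s)\<^sup>2)"
    by (auto simp: g_def zero_ext_def indicator_def power2_eq_square)
  finally have "AE s in lborel. (g s)\<^sup>2 = 0"
    using integral_nonneg_eq_0_iff_AE[of lborel "\<lambda>s. (g s)\<^sup>2"] g by (simp add: sq_integrable_def)
  then have "AE s in lborel. s \<notin> {0<..<L} \<longrightarrow> rep_l2 x s = 0"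
    by eventually_elim (auto simp: g_def zero_ext_def)
  then show "x \<in> X_space L" by (simp add: X_space_def)
qed

lemma subspace_X_space: "subspace (X_space L)"
  unfolding X_space_orthogonal by (auto simp: subspace_def inner_add_left)

lemma closed_X_space: "closed (X_space L)"
  unfolding X_space_orthogonal by (intro closed_INT ballI closed_Collect_eq continuous_intros)

lemma inner_zero_ext_class:
  assumes "sq_integrable (zero_ext L f)" "sq_integrable (zero_ext L g)"
  shows "inner (l2_class (zero_ext L f)) (l2_class (zero_ext L g)) = (LBINT s:{0..L}. f s * g s)"
proof -
  have "(\<lambda>s. zero_ext L f s * zero_ext L g s) = (\<lambda>s. indicator {0<..<L} s *\<^sub>R (f s * g s))"
    by (auto simp: zero_ext_def indicator_def)
  then have "inner (l2_class (zero_ext L f)) (l2_class (zero_ext L g)) = (LBINT s:{0<..<L}. f s * g s)"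
    using inner_class[OF assms] by (simp add: set_lebesgue_integral_def)
  also have "\<dots> = (LBINT s:{0..L}. f s * g s)"
    by (rule set_integral_discrete_difference[where X="{0, L}"]) auto
  finally show ?thesis .
qed

lemma set_integrable_zero_ext:
  assumes "sq_integrable (zero_ext L f)" "continuous_on {0..L} g"
  shows "set_integrable lborel {0..L} (\<lambda>s. zero_ext L f s * g s)"
proof -
  have "(\<lambda>s. indicat_real {0..L} s *\<^sub>R (zero_ext L f s * g s)) = (\<lambda>s. zero_ext L f s * zero_ext L g s)"
    by (auto simp: zero_ext_def indicator_def)
  then show ?thesis
    using sq_integrable_mult[OF assms(1) sq_integrable_zero_ext_continuous[OF assms(2)]]
    by (simp add: set_integrable_def)
qed

section \<open>Orthonormality and completeness of the sines\<close>

text \<open>The successor makes index 0 the first mode, with frequency \<open>pi / L\<close>; a sine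
  of frequency zero would vanish.\<close>

definition freq :: "real \<Rightarrow> nat \<Rightarrow> real" where
  "freq L n = real (Suc n) * pi / L"

definition sine_fun :: "real \<Rightarrow> nat \<Rightarrow> real \<Rightarrow> real" where
  "sine_fun L n s = sqrt (2 / L) * sin (freq L n * s)"

definition sine :: "real \<Rightarrow> nat \<Rightarrow> l2" where
  "sine L n = l2_class (zero_ext L (sine_fun L n))"

lemma continuous_on_sine_fun: "continuous_on A (sine_fun L n)"
  unfolding sine_fun_def[abs_def] by (intro continuous_intros)

lemma sine_in_X_space: "sine L n \<in> X_space L"
  unfolding sine_def
  by (intro class_zero_ext_in_X_space sq_integrable_zero_ext_continuous continuous_on_sine_fun)

lemma inner_sine:
  assumes "x \<in> X_space L"
  shows "inner x (sine L n) = (LBINT s:{0..L}. zero_ext L (rep_l2 x) s * sine_fun L n s)"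
proof -
  have "inner (l2_class (zero_ext L (rep_l2 x))) (sine L n) = (LBINT s:{0..L}. rep_l2 x s * sine_fun L n s)"
    unfolding sine_def
    by (intro inner_zero_ext_class sq_integrable_rep_zero_ext sq_integrable_zero_ext_continuous continuous_on_sine_fun)
  also have "\<dots> = (LBINT s:{0<..<L}. rep_l2 x s * sine_fun L n s)"
    by (rule set_integral_discrete_difference[where X="{0, L}"]) auto
  also have "\<dots> = (LBINT s:{0..L}. zero_ext L (rep_l2 x) s * sine_fun L n s)"
    unfolding set_lebesgue_integral_def
    by (rule Bochner_Integration.integral_cong) (auto simp: zero_ext_def indicator_def)
  finally show ?thesis using X_space_class[OF assms] by simp
qed

context
  fixes L :: real
  assumes L: "0 < L"
begin

lemma integral_cos_multiple:
  "(LBINT s:{0..L}. cos (of_int k * pi / L * s)) = (if k = 0 then L else 0)"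
proof (cases "k = 0")
  case True
  then show ?thesis using L by (simp add: set_lebesgue_integral_def)
next
  case False
  let ?F = "\<lambda>s. sin (of_int k * pi / L * s) / (of_int k * pi / L)"
  have "(LBINT s. cos (of_int k * pi / L * s) * indicator {0..L} s) = ?F L - ?F 0"
  proof (rule integral_FTC_Icc_real)
    show "(?F has_real_derivative cos (of_int k * pi / L * s)) (at s)" for s
      using L False by (auto intro!: derivative_eq_intros)
  qed (use L in \<open>auto intro!: continuous_intros\<close>)
  also have "?F L = 0" using L sin_npi_int[of k] by (simp add: mult.commute)
  finally show ?thesis using False by (simp add: set_lebesgue_integral_def mult.commute)
qed

lemma sine_orthonormal: "inner (sine L i) (sine L j) = (if i = j then 1 else 0)"
proof -
  let ?c = "\<lambda>k::int. \<lambda>s. cos (of_int k * pi / L * s)"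
  have ci: "set_integrable lborel {0..L} (?c k)" for k
    by (intro borel_integrable_atLeastAtMost' continuous_intros)
  \<comment> \<open>The shift by 2 stems from the two successors in the frequencies. Hence the
    second cosine never has frequency zero, and its integral always vanishes.\<close>
  have product: "(\<lambda>s. sine_fun L i s * sine_fun L j s) = (\<lambda>s. (1 / L) * ?c (int i - int j) s - (1 / L) * ?c (int i + int j + 2) s)"
  proof
    fix s
    have a: "of_int (int i - int j) * pi / L * s = freq L i * s - freq L j * s"
      "of_int (int i + int j + 2) * pi / L * s = freq L i * s + freq L j * s"
      using L by (simp_all add: freq_def field_simps)
    have "sine_fun L i s * sine_fun L j s = (sqrt (2 / L) * sqrt (2 / L)) * (sin (freq L i * s) * sin (freq L j * s))"
      by (simp only: sine_fun_def mult.assoc mult.left_commute)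
    also have "sqrt (2 / L) * sqrt (2 / L) = 2 / L" using L by simp
    also have "sin (freq L i * s) * sin (freq L j * s) = (cos (freq L i * s - freq L j * s) - cos (freq L i * s + freq L j * s)) / 2"
      by (rule sin_times_sin)
    finally show "sine_fun L i s * sine_fun L j s = (1 / L) * ?c (int i - int j) s - (1 / L) * ?c (int i + int j + 2) s"
      unfolding a using L by (simp add: field_simps)
  qed
  have "inner (sine L i) (sine L j) = (LBINT s:{0..L}. sine_fun L i s * sine_fun L j s)"
    unfolding sine_def by (intro inner_zero_ext_class sq_integrable_zero_ext_continuous continuous_on_sine_fun)
  also have "\<dots> = (LBINT s:{0..L}. (1 / L) * ?c (int i - int j) s - (1 / L) * ?c (int i + int j + 2) s)"
    unfolding product ..
  also have "\<dots> = (1 / L) * (LBINT s:{0..L}. ?c (int i - int j) s) - (1 / L) * (LBINT s:{0..L}. ?c (int i + int j + 2) s)"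
  proof -
    have "set_integrable lborel {0..L} (\<lambda>s. (1 / L) * ?c k s)" for k by (intro set_integrable_mult_right ci)
    then show ?thesis unfolding set_integral_mult_right[symmetric] by (rule set_integral_diff(2)) fact+
  qed
  also have "\<dots> = (if i = j then 1 else 0)"
    unfolding integral_cos_multiple using L by auto
  finally show ?thesis .
qed

text \<open>Orthogonality to all sines means orthogonality to \<open>sin \<theta>\<close> times every polynomial in \<open>cos \<theta>\<close>,
  where \<open>\<theta> = pi * s / L\<close>, hence by Weierstrass to \<open>sin \<theta>\<close> times every continuous function.\<close>

lemma sine_total:
  assumes x: "x \<in> X_space L" and orth: "\<And>n. inner x (sine L n) = 0"
  shows "x = 0"
proof -
  define f where "f = zero_ext L (rep_l2 x)"
  define \<theta> where "\<theta> s = pi * s / L" for s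
  have [continuous_intros]: "continuous_on A \<theta>" for A unfolding \<theta>_def using L by (intro continuous_intros) auto
  define I where "I g = (LBINT s:{0..L}. f s * g s)" for g
  have fi: "set_integrable lborel {0..L} (\<lambda>s. f s * g s)" if "continuous_on {0..L} g" for g
    unfolding f_def using that by (intro set_integrable_zero_ext) auto
  have I_add: "I (\<lambda>s. g s + h s) = I g + I h" if "continuous_on {0..L} g" "continuous_on {0..L} h" for g h
    using set_integral_add(2)[OF fi[OF that(1)] fi[OF that(2)]] by (simp add: I_def distrib_left)
  have I_scale: "I (\<lambda>s. c * g s) = c * I g" for c g
    unfolding I_def set_integral_mult_right[symmetric] by (simp only: mult.left_commute)
  have sin0: "I (\<lambda>s. sin (real k * \<theta> s)) = 0" for k
  proof (cases k)
    case 0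
    then show ?thesis by (simp add: I_def)
  next
    case (Suc n)
    have "inner x (sine L n) = I (\<lambda>s. sqrt (2 / L) * sin (real k * \<theta> s))"
      unfolding inner_sine[OF x] I_def by (simp add: f_def sine_fun_def freq_def \<theta>_def Suc mult.assoc)
    then show ?thesis using orth[of n] L I_scale by simp
  qed
  \<comment> \<open>A factor \<open>cos \<theta>\<close> turns \<open>sin (k \<theta>)\<close> into
    the mean of the sines with \<open>k + 1\<close> and \<open>k - 1\<close>, so induction on
    \<open>j\<close> uses only sines.\<close>
  have sin_cos: "I (\<lambda>s. sin (real k * \<theta> s) * cos (\<theta> s) ^ j) = 0" for j k
  proof (induction j arbitrary: k)
    case 0
    then show ?case using sin0 by simp
  next
    case (Suc j)
    show ?case
    proof (cases k)
      case 0
      then show ?thesis by (simp add: I_def)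
    next
      case (Suc n)
      have "sin (real k * \<theta> s) * cos (\<theta> s) ^ Suc j =
         (1/2) * (sin (real (Suc k) * \<theta> s) * cos (\<theta> s) ^ j) + (1/2) * (sin (real n * \<theta> s) * cos (\<theta> s) ^ j)" for s
      proof -
        have "sin (real k * \<theta> s) * cos (\<theta> s) = (sin (real k * \<theta> s + \<theta> s) + sin (real k * \<theta> s - \<theta> s)) / 2"
          by (rule sin_times_cos)
        also have "real k * \<theta> s + \<theta> s = real (Suc k) * \<theta> s" by (simp add: algebra_simps)
        also have "real k * \<theta> s - \<theta> s = real n * \<theta> s" by (simp add: Suc algebra_simps)
        finally have "sin (real k * \<theta> s) * cos (\<theta> s) = (sin (real (Suc k) * \<theta> s) + sin (real n * \<theta> s)) / 2" .
        moreover have "sin (real k * \<theta> s) * cos (\<theta> s) ^ Suc j = (sin (real k * \<theta> s) * cos (\<theta> s)) * cos (\<theta> s) ^ j"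
          by simp
        ultimately show ?thesis by (simp only: ) (simp add: field_simps)
      qed
      then have "I (\<lambda>s. sin (real k * \<theta> s) * cos (\<theta> s) ^ Suc j) =
         I (\<lambda>s. (1/2) * (sin (real (Suc k) * \<theta> s) * cos (\<theta> s) ^ j) + (1/2) * (sin (real n * \<theta> s) * cos (\<theta> s) ^ j))"
        by presburger
      also have "\<dots> = (1/2) * I (\<lambda>s. sin (real (Suc k) * \<theta> s) * cos (\<theta> s) ^ j) + (1/2) * I (\<lambda>s. sin (real n * \<theta> s) * cos (\<theta> s) ^ j)"
        unfolding I_scale[symmetric] by (intro I_add continuous_intros)
      also have "\<dots> = 0" unfolding Suc.IH by simp
      finally show ?thesis .
    qed
  qed
  have poly: "I (\<lambda>s. sin (\<theta> s) * p (cos (\<theta> s))) = 0" if p: "real_polynomial_function p" for p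
  proof -
    obtain a N where pe: "p = (\<lambda>x. \<Sum>i\<le>N. a i * x ^ i)" using p real_polynomial_function_iff_sum by blast
    have "I (\<lambda>s. \<Sum>i\<le>M. a i * (sin (\<theta> s) * cos (\<theta> s) ^ i)) = 0" for M :: nat
    proof (induction M)
      case 0
      then show ?case using I_scale[of "a 0" "\<lambda>s. sin (\<theta> s)"] sin_cos[of 1 0] by simp
    next
      case (Suc M)
      have "I (\<lambda>s. \<Sum>i\<le>Suc M. a i * (sin (\<theta> s) * cos (\<theta> s) ^ i)) =
        I (\<lambda>s. \<Sum>i\<le>M. a i * (sin (\<theta> s) * cos (\<theta> s) ^ i)) + I (\<lambda>s. a (Suc M) * (sin (\<theta> s) * cos (\<theta> s) ^ Suc M))"
        unfolding sum.atMost_Suc by (intro I_add continuous_intros)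
      also have "\<dots> = 0" using Suc sin_cos[of 1 "Suc M"] by (simp only: I_scale) simp
      finally show ?case .
    qed
    moreover have "sin (\<theta> s) * p (cos (\<theta> s)) = (\<Sum>i\<le>N. a i * (sin (\<theta> s) * cos (\<theta> s) ^ i))" for s
      by (simp add: pe sum_distrib_left mult.left_commute)
    ultimately show ?thesis by simp
  qed
  have cont0: "I (\<lambda>s. sin (\<theta> s) * g s) = 0" if g: "continuous_on {0..L} g" for g
  proof -
    define B where "B = (LBINT s:{0..L}. \<bar>f s * sin (\<theta> s)\<bar>)"
    have B0: "B \<ge> 0" unfolding B_def set_lebesgue_integral_def by (intro Bochner_Integration.integral_nonneg) auto
    have si: "set_integrable lborel {0..L} (\<lambda>s. f s * sin (\<theta> s))" by (intro fi continuous_intros)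
    have "\<bar>I (\<lambda>s. sin (\<theta> s) * g s)\<bar> \<le> 0 + \<epsilon>" if e: "\<epsilon> > 0" for \<epsilon>
    proof -
      \<comment> \<open>\<open>\<theta>\<close> runs once through \<open>{0..pi}\<close>, where the
        cosine is injective; so \<open>g\<close> is a continuous function of
        \<open>cos \<theta>\<close>, and this function is what gets approximated. The bound
        \<open>\<epsilon> / (B + 1)\<close> tolerates \<open>B = 0\<close>.\<close>
      have c: "continuous_on {-1..1} (\<lambda>y. g (L / pi * arccos y))"
      proof (rule continuous_on_compose2[OF g])
        show "(\<lambda>y. L / pi * arccos y) ` {-1..1} \<subseteq> {0..L}"
        proof (intro image_subsetI)
          fix y :: real assume "y \<in> {-1..1}"
          then have "0 \<le> arccos y" "arccos y \<le> pi" by (auto intro: arccos_lbound arccos_ubound)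
          then show "L / pi * arccos y \<in> {0..L}" using L by (auto simp: field_simps)
        qed
      qed (intro continuous_intros, auto)
      have "\<epsilon> / (B + 1) > 0" using e B0 by simp
      with Stone_Weierstrass_real_polynomial_function[OF compact_Icc c]
      obtain p where p: "real_polynomial_function p"
        "\<And>y. y \<in> {-1..1} \<Longrightarrow> \<bar>g (L / pi * arccos y) - p y\<bar> < \<epsilon> / (B + 1)" by blast
      have pg: "\<bar>g s - p (cos (\<theta> s))\<bar> \<le> \<epsilon> / (B + 1)" if s: "s \<in> {0..L}" for s
      proof -
        have "\<theta> s \<ge> 0" "\<theta> s \<le> pi" using s L by (auto simp: \<theta>_def field_simps)
        then have "arccos (cos (\<theta> s)) = \<theta> s" by (rule arccos_cos)
        then have "L / pi * arccos (cos (\<theta> s)) = s" using L by (simp add: \<theta>_def)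
        then show ?thesis using p(2)[of "cos (\<theta> s)"] by auto
      qed
      have pc: "continuous_on {0..L} (\<lambda>s. p (cos (\<theta> s)))"
        using continuous_real_polymonial_function[OF p(1)]
        by (intro continuous_on_compose2[OF continuous_at_imp_continuous_on[of UNIV p]] continuous_intros) auto
      let ?r = "\<lambda>s. sin (\<theta> s) * (g s - p (cos (\<theta> s)))"
      have "I (\<lambda>s. sin (\<theta> s) * g s) = I (\<lambda>s. sin (\<theta> s) * (g s - p (cos (\<theta> s))) + sin (\<theta> s) * p (cos (\<theta> s)))"
        by (simp add: algebra_simps)
      also have "\<dots> = I ?r"
        using poly[OF p(1)] g pc by (subst I_add) (auto intro!: continuous_intros)
      finally have "\<bar>I (\<lambda>s. sin (\<theta> s) * g s)\<bar> = \<bar>I ?r\<bar>" by simp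
      also have "\<dots> \<le> (LBINT s:{0..L}. \<bar>f s * ?r s\<bar>)"
      proof -
        have "continuous_on {0..L} ?r" using g pc by (intro continuous_intros)
        from set_integral_norm_bound[OF fi[OF this]] show ?thesis by (simp only: I_def real_norm_def)
      qed
      also have "\<dots> \<le> (LBINT s:{0..L}. \<epsilon> / (B + 1) * \<bar>f s * sin (\<theta> s)\<bar>)"
      proof (rule set_integral_mono)
        show "set_integrable lborel {0..L} (\<lambda>s. \<bar>f s * ?r s\<bar>)"
          using g pc by (intro set_integrable_abs fi continuous_intros)
        show "set_integrable lborel {0..L} (\<lambda>s. \<epsilon> / (B + 1) * \<bar>f s * sin (\<theta> s)\<bar>)"
          using si by (intro set_integrable_mult_right set_integrable_abs)
        fix s assume "s \<in> {0..L}"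
        then have "\<bar>f s * sin (\<theta> s)\<bar> * \<bar>g s - p (cos (\<theta> s))\<bar> \<le> \<bar>f s * sin (\<theta> s)\<bar> * (\<epsilon> / (B + 1))"
          by (intro mult_left_mono pg) auto
        then show "\<bar>f s * ?r s\<bar> \<le> \<epsilon> / (B + 1) * \<bar>f s * sin (\<theta> s)\<bar>"
          by (simp add: abs_mult mult.commute mult.left_commute mult.assoc)
      qed
      also have "\<dots> = \<epsilon> / (B + 1) * B" by (simp add: B_def)
      also have "\<dots> \<le> \<epsilon>" using e B0 by (simp add: field_simps)
      finally show ?thesis by simp
    qed
    then show ?thesis using field_le_epsilon[of "\<bar>I (\<lambda>s. sin (\<theta> s) * g s)\<bar>" 0] by auto
  qed
  define h where "h s = f s * sin (\<theta> s)" for s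
  have hi: "set_integrable lborel {0..L} h" unfolding h_def[abs_def] by (intro fi continuous_intros)
  \<comment> \<open>Continuous ramps converge to the indicator of \<open>{..<t}\<close>, so all
    integrals of \<open>h\<close> from the left end vanish. Differentiating them yields
    \<open>h = 0\<close> almost everywhere, and \<open>sin \<theta>\<close> is positive inside the
    interval.\<close>
  have F0: "(LBINT s:{0..t}. h s) = 0" if t: "t \<in> {0<..<L}" for t
  proof -
    let ?h = "\<lambda>s. indicat_real {0..L} s * h s"
    define g where "g k s = max 0 (min 1 (real k * (t - s)))" for k :: nat and s
    have gc: "continuous_on A (g k)" for A k unfolding g_def by (intro continuous_intros)
    have [measurable]: "(\<lambda>s. ?h s) \<in> borel_measurable lborel"
      using hi by (auto simp: set_integrable_def)
    have [measurable]: "g k \<in> borel_measurable lborel" for k unfolding g_def[abs_def] by measurable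
    have "(\<lambda>k. LBINT s. (?h s) * g k s) \<longlonglongrightarrow> (LBINT s. (?h s) * indicator {..<t} s)"
    proof (rule integral_dominated_convergence[where w="\<lambda>s. \<bar>?h s\<bar>"])
      show "integrable lborel (\<lambda>s. \<bar>?h s\<bar>)" using hi by (simp add: set_integrable_def)
      show "AE s in lborel. norm (?h s * g k s) \<le> \<bar>?h s\<bar>" for k
        by (auto simp: abs_mult g_def intro!: mult_left_le)
      show "AE s in lborel. (\<lambda>k. ?h s * g k s) \<longlonglongrightarrow> ?h s * indicator {..<t} s"
      proof (rule AE_I2)
        fix s
        have "(\<lambda>k. g k s) \<longlonglongrightarrow> indicator {..<t} s"
        proof (rule tendsto_eventually)
          show "\<forall>\<^sub>F k in sequentially. g k s = indicator {..<t} s"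
          proof (cases "s < t")
            case True
            obtain N :: nat where N: "1 / (t - s) < real N" using reals_Archimedean2 by blast
            show ?thesis
            proof (rule eventually_sequentiallyI[of N])
              fix k assume "N \<le> k"
              then have "1 / (t - s) \<le> real k" using N by linarith
              then have "1 \<le> real k * (t - s)" using True by (simp add: field_simps)
              then show "g k s = indicator {..<t} s" using True by (simp add: g_def)
            qed
          next
            case False
            then have "real k * (t - s) \<le> 0" for k by (simp add: mult_nonneg_nonpos)
            then have "min 1 (real k * (t - s)) \<le> 0" for k by (simp add: min.coboundedI2)
            then have "g k s = 0" for k by (simp add: g_def max.absorb1)
            then show ?thesis using False by simp
          qed
        qed
        then show "(\<lambda>k. ?h s * g k s) \<longlonglongrightarrow> ?h s * indicator {..<t} s"
          by (intro tendsto_mult tendsto_const)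
      qed
    qed measurable
    moreover have "(LBINT s. (?h s) * g k s) = 0" for k
      using cont0[OF gc] by (simp add: I_def set_lebesgue_integral_def h_def mult.assoc)
    ultimately have "(LBINT s. (?h s) * indicator {..<t} s) = 0"
      using LIMSEQ_unique[OF _ tendsto_const] by simp
    moreover have "(LBINT s. (?h s) * indicator {..<t} s) = (LBINT s:{0..t}. h s)"
      unfolding set_lebesgue_integral_def
    proof (rule integral_cong_AE)
      show "(\<lambda>s. indicat_real {0..t} s *\<^sub>R h s) \<in> borel_measurable lborel"
        using set_integrable_subset[OF hi, of "{0..t}"] t by (auto simp: set_integrable_def)
      show "AE s in lborel. ?h s * indicator {..<t} s = indicat_real {0..t} s *\<^sub>R h s"
        using AE_lborel_singleton[of t] by eventually_elim (use t in \<open>auto simp: indicator_def\<close>)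
    qed measurable
    ultimately show ?thesis by simp
  qed
  have "AE s in lborel. s \<in> {0<..<L} \<longrightarrow> h s = 0"
    using set_integral_has_derivative_AE[OF hi]
  proof eventually_elim
    case (elim s)
    show ?case
    proof
      assume s: "s \<in> {0<..<L}"
      have "((\<lambda>x. LBINT y:{0..x}. h y) has_real_derivative 0) (at s)"
        by (rule has_field_derivative_transform_within_open[where S="{0<..<L}" and f="\<lambda>_. 0"]) (use s F0 in auto)
      then show "h s = 0" using elim s DERIV_unique by blast
    qed
  qed
  moreover have "AE s in lborel. s \<notin> {0<..<L} \<longrightarrow> rep_l2 x s = 0" using x by (simp add: X_space_def)
  ultimately have "AE s in lborel. rep_l2 x s = 0"
  proof eventually_elim
    case (elim s)
    show ?case
    proof (cases "s \<in> {0<..<L}")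
      case True
      then have "sin (\<theta> s) > 0" using L by (intro sin_gt_zero) (auto simp: \<theta>_def field_simps)
      then show ?thesis using elim True by (auto simp: h_def f_def zero_ext_def)
    qed (use elim in auto)
  qed
  then show "x = 0" using class_eq_iff[OF rep_sq[of x] sq_integrable_zero] zero_class by simp
qed

end

lemma orthonormal_basis_sine:
  assumes "0 < L"
  shows "orthonormal_basis (X_space L) (sine L)"
  using sine_orthonormal[OF assms] sine_total[OF assms]
  by unfold_locales (auto simp: subspace_X_space closed_X_space sine_in_X_space)

section \<open>The second derivative in terms of sine coefficients\<close>

lemma ac_on_bounded_derivative:
  fixes f :: "real \<Rightarrow> real"
  assumes "\<And>x. (f has_real_derivative f' x) (at x)" "\<And>x. \<bar>f' x\<bar> \<le> C"
  shows "ac_on a b f"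
proof (rule ac_on_lipschitz)
  fix s t :: real assume "s \<le> t"
  then show "norm (f t - f s) \<le> C * (t - s)"
    using field_differentiable_bound[of UNIV f f' C t s] assms by simp
qed

lemma second_derivative_in:
  assumes "second_derivative L x y"
  shows "x \<in> X_space L" "y \<in> X_space L"
proof -
  obtain f g h where "abs_continuous_on 0 L f" "sq_integrable (zero_ext L h)"
    "x = l2_class (zero_ext L f)" "y = l2_class (zero_ext L h)"
    using assms unfolding second_derivative_def by blast
  moreover from this have "sq_integrable (zero_ext L f)"
    using sq_integrable_zero_ext_continuous ac_on_imp_continuous_on abs_continuous_on_iff_ac_on by blast
  ultimately show "x \<in> X_space L" "y \<in> X_space L"
    using class_zero_ext_in_X_space by auto
qed

text \<open>Green's formula: the derivative of \<open>f e' - f' e\<close> is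
  \<open>f e'' - f'' e\<close>, and the boundary terms vanish since both \<open>f\<close> and the
  sine are zero at the end points. Absolute continuity of \<open>f\<close> and \<open>f'\<close>
  justifies the integration.\<close>

lemma second_derivative_sine:
  assumes L: "0 < L" and "second_derivative L x y"
  shows "inner y (sine L n) = - (freq L n)\<^sup>2 * inner x (sine L n)"
proof -
  obtain f g h where ac: "ac_on 0 L f" "ac_on 0 L g" and f0: "f 0 = 0" "f L = 0"
    and fg: "ae_derivative L f g" and gh: "ae_derivative L g h" and h: "sq_integrable (zero_ext L h)"
    and xy: "x = l2_class (zero_ext L f)" "y = l2_class (zero_ext L h)"
    using assms(2) unfolding second_derivative_def abs_continuous_on_iff_ac_on by blast
  define w where "w = freq L n"
  define e where "e = sine_fun L n"
  define e' where "e' s = sqrt (2 / L) * (w * cos (w * s))" for s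
  have de: "(e has_real_derivative e' s) (at s)" for s
    unfolding e_def e'_def sine_fun_def[abs_def] w_def by (auto intro!: derivative_eq_intros)
  have de': "(e' has_real_derivative - w\<^sup>2 * e s) (at s)" for s
    unfolding e_def e'_def[abs_def] sine_fun_def[abs_def] w_def
    by (auto intro!: derivative_eq_intros simp: power2_eq_square)
  have ec: "continuous_on A e" for A by (simp add: e_def continuous_on_sine_fun)
  have w: "w \<ge> 0" using L by (simp add: w_def freq_def)
  have ace: "ac_on 0 L e"
  proof (rule ac_on_bounded_derivative[OF de])
    show "\<bar>e' s\<bar> \<le> sqrt (2 / L) * w" for s
      using L w by (auto simp: e'_def abs_mult intro!: mult_left_mono mult_left_le)
  qed
  have ace': "ac_on 0 L e'"
  proof (rule ac_on_bounded_derivative[OF de'])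
    show "\<bar>- w\<^sup>2 * e s\<bar> \<le> w\<^sup>2 * sqrt (2 / L)" for s
      using L by (auto simp: e_def sine_fun_def abs_mult intro!: mult_left_mono mult_left_le)
  qed
  have eL: "e 0 = 0" "e L = 0"
    using L sin_npi_int[of "int (Suc n)"] by (auto simp: e_def sine_fun_def freq_def mult.commute)
  define \<phi> where "\<phi> s = f s * e' s + g s * (- e s)" for s
  have "ac_on 0 L (\<lambda>s. - e s)" by (rule bounded_linear.ac_on[OF bounded_linear_minus[OF bounded_linear_ident] ace])
  then have ac\<phi>: "ac_on 0 L \<phi>"
    unfolding \<phi>_def by (intro ac_on_add bounded_bilinear.ac_on[OF bounded_bilinear_mult] ac ace')
  have fc: "continuous_on {0..L} f" by (rule ac_on_imp_continuous_on[OF ac(1)])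
  have int1: "set_integrable lborel {0..L} (\<lambda>s. f s * e s)"
    by (intro borel_integrable_atLeastAtMost' continuous_intros fc ec)
  \<comment> \<open>Square integrability is given for \<open>zero_ext L h\<close>; it agrees with
    \<open>h\<close> inside the interval, and the end points form a null set.\<close>
  have int2: "set_integrable lborel {0..L} (\<lambda>s. zero_ext L h s * e s)"
    by (rule set_integrable_zero_ext[OF h ec])
  have int: "set_integrable lborel {0..L} (\<lambda>s. - w\<^sup>2 * (f s * e s) - zero_ext L h s * e s)"
    using int1 int2 by (intro set_integral_diff set_integrable_mult_right)
  have "(LBINT s:{0..L}. - w\<^sup>2 * (f s * e s) - zero_ext L h s * e s) = \<phi> L - \<phi> 0"
  proof (rule ac_on_set_lebesgue_integral[OF _ ac\<phi> int])
    show "AE s in lborel. s \<in> {0<..<L} \<longrightarrow> (\<phi> has_real_derivative - w\<^sup>2 * (f s * e s) - zero_ext L h s * e s) (at s)"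
      using fg gh unfolding ae_derivative_def
    proof eventually_elim
      case (elim s)
      show ?case
      proof
        assume s: "s \<in> {0<..<L}"
        then have "(f has_real_derivative g s) (at s)" "(g has_real_derivative h s) (at s)" using elim by auto
        then have "(\<phi> has_real_derivative (f s * (- w\<^sup>2 * e s) + g s * e' s) + (g s * (- e' s) + h s * (- e s))) (at s)"
          unfolding \<phi>_def[abs_def] by (intro DERIV_add DERIV_mult' DERIV_minus de de')
        moreover have "(f s * (- w\<^sup>2 * e s) + g s * e' s) + (g s * (- e' s) + h s * (- e s))
            = - w\<^sup>2 * (f s * e s) - zero_ext L h s * e s"
          using s by (simp add: zero_ext_def algebra_simps)
        ultimately show "(\<phi> has_real_derivative - w\<^sup>2 * (f s * e s) - zero_ext L h s * e s) (at s)" by (simp only:)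
      qed
    qed
  qed (use L in simp)
  also have "\<phi> L - \<phi> 0 = 0" by (simp add: \<phi>_def f0 eL)
  also have "(LBINT s:{0..L}. - w\<^sup>2 * (f s * e s) - zero_ext L h s * e s)
     = - w\<^sup>2 * (LBINT s:{0..L}. f s * e s) - (LBINT s:{0..L}. zero_ext L h s * e s)"
  proof -
    have "set_integrable lborel {0..L} (\<lambda>s. - w\<^sup>2 * (f s * e s))" using int1 by (intro set_integrable_mult_right)
    then show ?thesis unfolding set_integral_mult_right[symmetric] using int2 by (rule set_integral_diff(2))
  qed
  also have "(LBINT s:{0..L}. f s * e s) = inner x (sine L n)"
    unfolding xy sine_def e_def
    by (intro inner_zero_ext_class[symmetric] sq_integrable_zero_ext_continuous fc continuous_on_sine_fun)
  also have "(LBINT s:{0..L}. zero_ext L h s * e s) = (LBINT s:{0<..<L}. zero_ext L h s * e s)"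
    by (rule set_integral_discrete_difference[where X="{0, L}"]) auto
  also have "\<dots> = (LBINT s:{0<..<L}. h s * e s)"
    unfolding set_lebesgue_integral_def
    by (rule Bochner_Integration.integral_cong) (auto simp: zero_ext_def indicator_def)
  also have "\<dots> = (LBINT s:{0..L}. h s * e s)"
    by (rule set_integral_discrete_difference[where X="{0, L}"]) auto
  also have "\<dots> = inner y (sine L n)"
    unfolding xy sine_def e_def
    by (intro inner_zero_ext_class[symmetric] sq_integrable_zero_ext_continuous h continuous_on_sine_fun)
  finally show ?thesis by (simp add: w_def)
qed

text \<open>Solving the boundary value problem by two integrations. This is the source of
  regularity: decay of coefficients says nothing directly about absolute continuity, but a vector
  with the right coefficients must equal the solution built here.\<close>

lemma second_derivative_exists:
  assumes L: "0 < L" and y: "y \<in> X_space L"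
  shows "\<exists>x. second_derivative L x y"
proof -
  define h where "h = zero_ext L (rep_l2 y)"
  have hi: "set_integrable lborel {0..L} h"
    using set_integrable_zero_ext[OF sq_integrable_rep_zero_ext continuous_on_const, of L y 1] by (simp add: h_def)
  define G where "G s = (LBINT r:{0..s}. h r)" for s
  have acG: "ac_on 0 L G" unfolding G_def[abs_def] by (rule ac_on_set_integral[OF hi])
  \<comment> \<open>Subtracting the mean of \<open>G\<close> makes the second integral vanish at
    \<open>L\<close>.\<close>
  define k where "k = - (LBINT r:{0..L}. G r) / L"
  define g where "g s = G s + k" for s
  have "ac_on 0 L (\<lambda>_. k)" by (rule ac_on_lipschitz[where C=0]) simp
  then have acg: "ac_on 0 L g" unfolding g_def[abs_def] by (intro ac_on_add acG)
  have Gi: "set_integrable lborel {0..L} G"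
    by (intro borel_integrable_atLeastAtMost' ac_on_imp_continuous_on acG)
  have gi: "set_integrable lborel {0..L} g"
    by (intro borel_integrable_atLeastAtMost' ac_on_imp_continuous_on acg)
  define f where "f s = (LBINT r:{0..s}. g r)" for s
  have acf: "ac_on 0 L f" unfolding f_def[abs_def] by (rule ac_on_set_integral[OF gi])
  have f0: "f 0 = 0"
  proof -
    have "f 0 = (LBINT r:{}. g r)"
      unfolding f_def by (rule set_integral_discrete_difference[where X="{0}"]) auto
    then show ?thesis by (simp add: set_lebesgue_integral_def)
  qed
  have "f L = (LBINT r:{0..L}. G r) + (LBINT r:{0..L}. k)"
    unfolding f_def g_def by (rule set_integral_add(2)[OF Gi]) (intro borel_integrable_atLeastAtMost' continuous_intros)
  also have "(LBINT r:{0..L}. k) = L * k" using L by (simp add: set_lebesgue_integral_def)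
  finally have fL: "f L = 0" using L by (simp add: k_def)
  have "ae_derivative L f g"
    unfolding ae_derivative_def f_def[abs_def] by (rule set_integral_has_derivative_AE[OF gi])
  moreover have "ae_derivative L g h"
    unfolding ae_derivative_def using set_integral_has_derivative_AE[OF hi]
    by eventually_elim (auto simp: g_def[abs_def] G_def[abs_def] intro!: derivative_eq_intros)
  moreover have "zero_ext L h = h" by (auto simp: h_def zero_ext_def indicator_def)
  then have "sq_integrable (zero_ext L h)" "y = l2_class (zero_ext L h)"
    using X_space_class[OF y] by (auto simp: h_def)
  ultimately have "second_derivative L (l2_class (zero_ext L f)) y"
    unfolding second_derivative_def abs_continuous_on_iff_ac_on using acf acg f0 fL by blast
  then show ?thesis by blast
qed

section \<open>The Laplacian, its square root and its resolvent as multipliers\<close>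

locale dirichlet_interval =
  fixes L :: real
  assumes L: "0 < L"
begin

sublocale orthonormal_basis "X_space L" "sine L"
  by (rule orthonormal_basis_sine[OF L])

abbreviation H :: "l2 set" where "H \<equiv> X_space L"

lemma freq_pos [simp]: "0 < freq L n"
  using L by (simp add: freq_def)

lemma freq_nonzero [simp]: "freq L n \<noteq> 0"
  using freq_pos[of n] by linarith

lemma freq_ge: "pi / L \<le> freq L n"
  using L by (simp add: freq_def field_simps)

text \<open>For the converse, solve the boundary value problem for the given \<open>y\<close>; the
  solution has the coefficients of \<open>x\<close>, as the frequencies are nonzero.\<close>

lemma second_derivative_iff:
  "second_derivative L x y \<longleftrightarrow>
     x \<in> H \<and> y \<in> H \<and> (\<forall>n. inner y (sine L n) = - (freq L n)\<^sup>2 * inner x (sine L n))"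
proof
  assume "second_derivative L x y"
  then show "x \<in> H \<and> y \<in> H \<and> (\<forall>n. inner y (sine L n) = - (freq L n)\<^sup>2 * inner x (sine L n))"
    using second_derivative_in second_derivative_sine[OF L] by blast
next
  assume *: "x \<in> H \<and> y \<in> H \<and> (\<forall>n. inner y (sine L n) = - (freq L n)\<^sup>2 * inner x (sine L n))"
  then obtain x' where x': "second_derivative L x' y" using second_derivative_exists[OF L] by blast
  have "x = x'"
  proof (rule coeff_eqI)
    show "inner x (sine L n) = inner x' (sine L n)" for n
      using * second_derivative_sine[OF L x', of n] by simp
  qed (use * second_derivative_in[OF x'] in auto)
  then show "second_derivative L x y" using x' by simp
qed

lemma A_op_eq_Some_iff:
  "A_op L x = Some y \<longleftrightarrow> x \<in> H \<and> y \<in> H \<and> (\<forall>n. inner y (sine L n) = (freq L n)\<^sup>2 * inner x (sine L n))"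
proof -
  have uniq: "y = y'" if "second_derivative L x y" "second_derivative L x y'" for y y'
    using that by (intro coeff_eqI) (auto simp: second_derivative_iff)
  have "A_op L x = Some y \<longleftrightarrow> second_derivative L x (- y)"
  proof
    assume "A_op L x = Some y"
    then obtain z where z: "second_derivative L x z" "y = - (THE z. second_derivative L x z)"
      by (auto simp: A_op_def X_zero_def split: if_splits)
    then have "(THE z. second_derivative L x z) = z" using uniq by blast
    then show "second_derivative L x (- y)" using z by simp
  next
    assume *: "second_derivative L x (- y)"
    then have "(THE z. second_derivative L x z) = - y" using uniq by blast
    then show "A_op L x = Some y" using * by (auto simp: A_op_def X_zero_def)
  qed
  moreover have "- y \<in> H \<longleftrightarrow> y \<in> H" using subspace_neg[OF subspace] by force
  ultimately show ?thesis by (auto simp: second_derivative_iff)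
qed

lemma X_zero_iff: "x \<in> X_zero L \<longleftrightarrow> (\<exists>y. A_op L x = Some y)"
  by (simp add: A_op_def)

text \<open>The candidate for the square root. Its domain is the maximal one for this multiplier,
  which makes it self-adjoint and not merely symmetric.\<close>

definition half_op :: "l2 \<rightharpoonup> l2" where
  "half_op x = (if x \<in> H \<and> summable (\<lambda>n. (freq L n * inner x (sine L n))\<^sup>2)
     then Some (synth (\<lambda>n. freq L n * inner x (sine L n))) else None)"

lemma half_op_eq_Some_iff:
  "half_op x = Some y \<longleftrightarrow> x \<in> H \<and> y \<in> H \<and> (\<forall>n. inner y (sine L n) = freq L n * inner x (sine L n))"
proof
  assume "half_op x = Some y"
  then show "x \<in> H \<and> y \<in> H \<and> (\<forall>n. inner y (sine L n) = freq L n * inner x (sine L n))"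
    by (auto simp: half_op_def synth_in inner_synth split: if_splits)
next
  assume *: "x \<in> H \<and> y \<in> H \<and> (\<forall>n. inner y (sine L n) = freq L n * inner x (sine L n))"
  then have s: "summable (\<lambda>n. (freq L n * inner x (sine L n))\<^sup>2)"
    using summable_coeff_square[of y] by simp
  have "synth (\<lambda>n. freq L n * inner x (sine L n)) = y"
    using * by (intro coeff_eqI synth_in[OF s]) (auto simp: inner_synth[OF s])
  then show "half_op x = Some y" using * s by (simp add: half_op_def)
qed

lemma half_op_symmetric:
  assumes "half_op x = Some x'" "half_op y = Some y'"
  shows "inner x' y = inner x y'"
proof -
  have "(\<lambda>n. inner x' (sine L n) * inner y (sine L n)) sums inner x' y"
    "(\<lambda>n. inner x (sine L n) * inner y' (sine L n)) sums inner x y'"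
    by (rule parseval; use assms in \<open>simp add: half_op_eq_Some_iff\<close>)+
  then show ?thesis
    using assms by (auto simp: half_op_eq_Some_iff mult.commute mult.left_commute intro: sums_unique2)
qed

lemma half_op_sine: "half_op (sine L n) = Some (freq L n *\<^sub>R sine L n)"
  by (auto simp: half_op_eq_Some_iff basis_in subspace_scale[OF subspace] orthonormal)

text \<open>Partial sums of the basis expansion lie in the domain, which gives density. Testing the
  adjoint relation on single sines recovers the coefficient description of the graph.\<close>

lemma self_adjoint_half_op: "self_adjoint_on H half_op"
  unfolding self_adjoint_on_def
proof (intro conjI ballI iffI)
  show "dom half_op \<subseteq> H" by (auto simp: half_op_eq_Some_iff)
  show "ran half_op \<subseteq> H" by (auto simp: ran_def half_op_eq_Some_iff)
  have fin: "(\<Sum>n<N. a n *\<^sub>R sine L n) \<in> dom half_op" for a N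
  proof -
    have "half_op (\<Sum>n<N. a n *\<^sub>R sine L n) = Some (\<Sum>n<N. (freq L n * a n) *\<^sub>R sine L n)"
      unfolding half_op_eq_Some_iff
      by (auto intro!: subspace_sum subspace_scale subspace basis_in simp: inner_finite_sum)
    then show ?thesis by auto
  qed
  show "H \<subseteq> closure (dom half_op)"
  proof
    fix x assume "x \<in> H"
    then have "(\<lambda>N. \<Sum>n<N. inner x (sine L n) *\<^sub>R sine L n) \<longlonglongrightarrow> x"
      using coeff_sums by (simp add: sums_def)
    then show "x \<in> closure (dom half_op)" 
      unfolding closure_sequential by (intro exI conjI allI) (rule fin)
  qed
next
  fix u v x assume "half_op u = Some v" "x \<in> dom half_op"
  then show "inner (the (half_op x)) u = inner x v" using half_op_symmetric by force
next
  fix u v assume uv: "u \<in> H" "v \<in> H" and *: "\<forall>x\<in>dom half_op. inner (the (half_op x)) u = inner x v"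
  have "inner v (sine L n) = freq L n * inner u (sine L n)" for n
  proof -
    have "sine L n \<in> dom half_op" by (simp add: dom_def half_op_sine)
    then have "inner (the (half_op (sine L n))) u = inner (sine L n) v" using * by blast
    then show ?thesis by (simp add: half_op_sine inner_commute)
  qed
  then show "half_op u = Some v" using uv by (simp add: half_op_eq_Some_iff)
qed

lemma positive_half_op: "positive_op half_op"
  unfolding positive_op_def
proof
  fix x assume "x \<in> dom half_op"
  then obtain y where y: "half_op x = Some y" by auto
  then have "(\<lambda>n. inner y (sine L n) * inner x (sine L n)) sums inner y x"
    by (intro parseval) (simp add: half_op_eq_Some_iff)
  moreover have "0 \<le> inner y (sine L n) * inner x (sine L n)" for n
  proof -
    have "inner y (sine L n) * inner x (sine L n) = freq L n * (inner x (sine L n))\<^sup>2"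
      using y by (simp add: half_op_eq_Some_iff power2_eq_square)
    then show ?thesis using freq_pos[of n] by (simp add: less_imp_le)
  qed
  ultimately have "0 \<le> inner y x" by (rule sums_le[OF _ sums_zero, rotated]) 
  then show "0 \<le> inner (the (half_op x)) x" using y by simp
qed

lemma inverse_freq_le: "\<bar>1 / freq L n\<bar> \<le> L / pi"
proof -
  have "\<bar>1 / freq L n\<bar> = 1 / freq L n" using abs_of_pos[OF freq_pos[of n]] by simp
  then show ?thesis unfolding \<open>\<bar>1 / freq L n\<bar> = 1 / freq L n\<close>
    using freq_ge[of n] freq_pos[of n] L by (simp add: divide_le_eq le_divide_eq mult.commute)
qed

text \<open>An equality of partial functions, so the domains must agree too: when \<open>A x\<close>
  exists, the intermediate vector is \<open>A x\<close> under the bounded multiplier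
  \<open>1 / freq\<close>, hence exists as well.\<close>

lemma half_op_square: "half_op \<circ>\<^sub>m half_op = A_op L"
proof
  fix x
  have "(half_op \<circ>\<^sub>m half_op) x = Some y \<longleftrightarrow> A_op L x = Some y" for y
  proof
    assume "(half_op \<circ>\<^sub>m half_op) x = Some y"
    then obtain z where "half_op x = Some z" "half_op z = Some y"
      by (auto simp: map_comp_def split: option.splits)
    then show "A_op L x = Some y"
      by (auto simp: half_op_eq_Some_iff A_op_eq_Some_iff power2_eq_square)
  next
    assume "A_op L x = Some y"
    then have *: "x \<in> H" "y \<in> H" "\<And>n. inner y (sine L n) = (freq L n)\<^sup>2 * inner x (sine L n)"
      by (auto simp: A_op_eq_Some_iff)
    let ?z = "diag (\<lambda>n. 1 / freq L n) y"
    have "half_op x = Some ?z" "half_op ?z = Some y"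
      using * by (auto simp: half_op_eq_Some_iff diag_in[OF inverse_freq_le] inner_diag_basis[OF inverse_freq_le] power2_eq_square)
    then show "(half_op \<circ>\<^sub>m half_op) x = Some y" by (simp add: map_comp_def)
  qed
  then show "(half_op \<circ>\<^sub>m half_op) x = A_op L x"
    by (metis not_Some_eq)
qed

text \<open>A positive root \<open>S\<close> sends \<open>sine L n\<close> to its \<open>freq L n\<close>-multiple, because
  \<open>(S + freq) (S - freq) (sine L n) = 0\<close> and \<open>S + freq\<close> is injective by positivity.\<close>

lemma sqrt_unique:
  assumes sa: "self_adjoint_on H S" and pos: "positive_op S" and sq: "S \<circ>\<^sub>m S = A_op L"
  shows "S = half_op"
proof -
  have dom: "u \<in> H" if "u \<in> dom S" for u using sa that by (auto simp: self_adjoint_on_def)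
  have ran: "v \<in> H" if "S u = Some v" for u v
  proof -
    have "v \<in> ran S" using that by (rule ranI)
    then show ?thesis using sa by (auto simp: self_adjoint_on_def)
  qed
  have graph: "S u = Some v \<longleftrightarrow> (\<forall>x\<in>dom S. inner (the (S x)) u = inner x v)" if "u \<in> H" "v \<in> H" for u v
    using sa that unfolding self_adjoint_on_def by blast
  have adj: "inner (the (S x)) u = inner x v" if "S u = Some v" "x \<in> dom S" for u v x
    using graph[of u v] dom[of u] ran[OF that(1)] that by auto
  \<comment> \<open>Linearity of \<open>S\<close> comes from its graph being that of an
    adjoint.\<close>
  have lin: "S (u + a *\<^sub>R u') = Some (v + a *\<^sub>R v')" if "S u = Some v" "S u' = Some v'" for u v u' v' a
    using adj[OF that(1)] adj[OF that(2)] dom[of u] dom[of u'] ran[OF that(1)] ran[OF that(2)] that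
    by (subst graph) (auto intro!: subspace_add subspace_scale subspace simp: inner_add_right)
  have S_sine: "S (sine L n) = Some (freq L n *\<^sub>R sine L n)" for n
  proof -
    let ?w = "freq L n" and ?e = "sine L n"
    have "A_op L ?e = Some (?w\<^sup>2 *\<^sub>R ?e)"
      by (auto simp: A_op_eq_Some_iff basis_in subspace_scale[OF subspace] orthonormal)
    then obtain z where z: "S ?e = Some z" "S z = Some (?w\<^sup>2 *\<^sub>R ?e)"
      unfolding sq[symmetric] by (auto simp: map_comp_def split: option.splits)
    define y where "y = z + (- ?w) *\<^sub>R ?e"
    have "?w\<^sup>2 *\<^sub>R ?e + (- ?w) *\<^sub>R z = (- ?w) *\<^sub>R y"
      by (simp add: y_def algebra_simps power2_eq_square)
    then have Sy: "S y = Some ((- ?w) *\<^sub>R y)" using lin[OF z(2,1), of "- ?w"] by (simp add: y_def)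
    then have "0 \<le> inner ((- ?w) *\<^sub>R y) y" using pos unfolding positive_op_def by force
    then have "?w * inner y y \<le> 0" by simp
    then have "inner y y \<le> 0" using freq_pos[of n] by (simp add: mult_le_0_iff)
    then have "y = 0" using inner_ge_zero[of y] inner_eq_zero_iff[of y] by linarith
    then have "z = ?w *\<^sub>R ?e" by (simp add: y_def)
    then show ?thesis using z by simp
  qed
  have sub: "half_op x = Some y" if "S x = Some y" for x y
  proof -
    have "freq L n * inner (sine L n) x = inner (sine L n) y" for n
      using adj[OF that, of "sine L n"] S_sine[of n] by auto
    then show ?thesis
      using that dom[of x] ran[OF that] by (auto simp: half_op_eq_Some_iff inner_commute)
  qed
  \<comment> \<open>\<open>S\<close> is a restriction of \<open>half_op\<close>. Self-adjointness
    forbids a proper symmetric extension, so the two coincide.\<close>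
  have "S x = Some y" if h: "half_op x = Some y" for x y
  proof (subst graph)
    show "x \<in> H" "y \<in> H" using h by (auto simp: half_op_eq_Some_iff)
    show "\<forall>w\<in>dom S. inner (the (S w)) x = inner w y"
      using sub half_op_symmetric[OF _ h] by force
  qed
  then show ?thesis using sub by (metis not_Some_eq ext)
qed

lemma sqrt_op_eq: "sqrt_op H (A_op L) = half_op"
  unfolding sqrt_op_def
  using self_adjoint_half_op positive_half_op half_op_square sqrt_unique by blast

text \<open>A version of \<open>J_op\<close> that is bounded and linear on all of \<open>l2\<close>.
  It is also the coordinate map \<open>x = J u\<close> from \<open>H\<close> onto the state
  space.\<close>

definition J :: "l2 \<Rightarrow> l2" where
  "J = diag (\<lambda>n. 1 / freq L n)"

lemma J_in: "J u \<in> H"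
  unfolding J_def by (rule diag_in[OF inverse_freq_le])

lemma bounded_linear_J: "bounded_linear J"
  unfolding J_def by (rule bounded_linear_diag[OF inverse_freq_le])

lemma inner_J_basis: "inner (J u) (sine L n) = inner u (sine L n) / freq L n"
  unfolding J_def by (simp add: inner_diag_basis[OF inverse_freq_le])

lemma half_op_J: "u \<in> H \<Longrightarrow> half_op (J u) = Some u"
  by (simp add: half_op_eq_Some_iff J_in inner_J_basis)

lemma A_half_J: "u \<in> H \<Longrightarrow> A_half L (J u) = u"
  by (simp add: A_half_def sqrt_op_eq half_op_J)

lemma J_in_X_half: "u \<in> H \<Longrightarrow> J u \<in> X_half L"
  by (auto simp: X_half_def sqrt_op_eq half_op_J)

lemma X_half_cases:
  assumes "x \<in> X_half L"
  shows "A_half L x \<in> H" "J (A_half L x) = x"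
proof -
  obtain y where y: "half_op x = Some y" using assms by (auto simp: X_half_def sqrt_op_eq)
  then have "A_half L x = y" by (simp add: A_half_def sqrt_op_eq)
  moreover have "J y = x"
    using y by (intro coeff_eqI J_in) (auto simp: half_op_eq_Some_iff inner_J_basis)
  ultimately show "A_half L x \<in> H" "J (A_half L x) = x" using y by (auto simp: half_op_eq_Some_iff)
qed

lemma J_op_eq:
  assumes "y \<in> H"
  shows "J_op L y = J y"
  unfolding J_op_def
proof (rule the_equality)
  show "J y \<in> X_half L \<and> A_half L (J y) = y" using assms by (simp add: J_in_X_half A_half_J)
qed (use X_half_cases in auto)

text \<open>The bounded operator \<open>A I_mu\<close>; it is \<open>A^(1/2) I_mu A^(1/2)\<close> in
  the coordinate \<open>u\<close>.\<close>

definition B :: "real \<Rightarrow> l2 \<Rightarrow> l2" where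
  "B \<mu> = diag (\<lambda>n. (freq L n)\<^sup>2 / (1 + \<mu>\<^sup>2 * (freq L n)\<^sup>2))"

lemma resolvent_bound: "\<bar>1 / (1 + \<mu>\<^sup>2 * (freq L n)\<^sup>2)\<bar> \<le> 1"
  by (simp add: add_pos_nonneg divide_le_eq)

lemma B_bound:
  assumes "\<mu> \<noteq> 0"
  shows "\<bar>(freq L n)\<^sup>2 / (1 + \<mu>\<^sup>2 * (freq L n)\<^sup>2)\<bar> \<le> 1 / \<mu>\<^sup>2"
proof -
  have "1 + \<mu>\<^sup>2 * (freq L n)\<^sup>2 > 0" by (simp add: add_pos_nonneg)
  then show ?thesis using assms by (simp add: abs_divide field_simps)
qed

lemma resolvent_identity:
  fixes a b c :: real
  assumes "1 + a * b \<noteq> 0"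
  shows "1 / (1 + a * b) * c + a * (b / (1 + a * b) * c) = c"
proof -
  have "1 / (1 + a * b) * c + a * (b / (1 + a * b) * c) = (1 + a * b) / (1 + a * b) * c"
    by (simp only: add_divide_distrib distrib_right times_divide_eq_right mult.assoc times_divide_eq_left)
  then show ?thesis using assms by simp
qed

context
  fixes \<mu> :: real
  assumes \<mu>: "\<mu> \<noteq> 0"
begin

lemma I_mu_eq:
  assumes "y \<in> H"
  shows "I_mu L \<mu> y = diag (\<lambda>n. 1 / (1 + \<mu>\<^sup>2 * (freq L n)\<^sup>2)) y"
  unfolding I_mu_def
proof (rule the_equality)
  let ?D = "\<lambda>n. 1 + \<mu>\<^sup>2 * (freq L n)\<^sup>2"
  let ?x = "diag (\<lambda>n. 1 / ?D n) y"
  have pos: "?D n > 0" for n by (simp add: add_pos_nonneg)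
  have "A_op L ?x = Some (B \<mu> y)"
    by (simp add: B_def A_op_eq_Some_iff diag_in[OF resolvent_bound] diag_in[OF B_bound[OF \<mu>]]
      inner_diag_basis[OF resolvent_bound] inner_diag_basis[OF B_bound[OF \<mu>]])
  moreover have "?x + \<mu>\<^sup>2 *\<^sub>R B \<mu> y = y"
  proof (rule coeff_eqI)
    fix n
    have "inner (?x + \<mu>\<^sup>2 *\<^sub>R B \<mu> y) (sine L n)
        = 1 / ?D n * inner y (sine L n) + \<mu>\<^sup>2 * ((freq L n)\<^sup>2 / ?D n * inner y (sine L n))"
      by (simp add: B_def inner_add_left inner_diag_basis[OF resolvent_bound] inner_diag_basis[OF B_bound[OF \<mu>]])
    then show "inner (?x + \<mu>\<^sup>2 *\<^sub>R B \<mu> y) (sine L n) = inner y (sine L n)"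
      using resolvent_identity[of "\<mu>\<^sup>2" "(freq L n)\<^sup>2"] pos[of n] by simp
  qed (use assms in \<open>auto simp: B_def intro!: subspace_add subspace_scale subspace diag_in[OF resolvent_bound] diag_in[OF B_bound[OF \<mu>]]\<close>)
  ultimately show "?x \<in> X_zero L \<and> ?x + \<mu>\<^sup>2 *\<^sub>R the (A_op L ?x) = y" by (simp add: X_zero_iff)
  fix x assume x: "x \<in> X_zero L \<and> x + \<mu>\<^sup>2 *\<^sub>R the (A_op L x) = y"
  then obtain z where z: "A_op L x = Some z" by (auto simp: X_zero_iff)
  then have y: "y = x + \<mu>\<^sup>2 *\<^sub>R z" using x by simp
  show "x = ?x"
  proof (rule coeff_eqI)
    fix n
    have "inner ?x (sine L n) = (1 / ?D n) * (?D n * inner x (sine L n))"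
      using z by (simp add: y A_op_eq_Some_iff inner_diag_basis[OF resolvent_bound] inner_add_left distrib_right)
    then show "inner x (sine L n) = inner ?x (sine L n)" using pos[of n] by simp
  qed (use z in \<open>auto simp: A_op_eq_Some_iff diag_in[OF resolvent_bound]\<close>)
qed

lemma B_in: "B \<mu> u \<in> H"
  unfolding B_def by (rule diag_in[OF B_bound[OF \<mu>]])

lemma bounded_linear_B: "bounded_linear (B \<mu>)"
  unfolding B_def by (rule bounded_linear_diag[OF B_bound[OF \<mu>]])

lemma B_selfadjoint: "inner (B \<mu> u) v = inner u (B \<mu> v)"
  unfolding B_def by (rule diag_selfadjoint[OF B_bound[OF \<mu>]])

lemma inner_B_basis: "inner (B \<mu> u) (sine L n) = (freq L n)\<^sup>2 / (1 + \<mu>\<^sup>2 * (freq L n)\<^sup>2) * inner u (sine L n)"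
  unfolding B_def by (rule inner_diag_basis[OF B_bound[OF \<mu>]])

text \<open>The first root cancels \<open>J\<close>; the resolvent and the second root leave the
  multiplier \<open>w / (1 + mu^2 w^2)\<close>, which is that of \<open>B\<close> divided by
  \<open>w\<close>.\<close>

lemma AIA_J:
  assumes "u \<in> H"
  shows "AIA L \<mu> (J u) = J (B \<mu> u)"
proof -
  have "half_op (I_mu L \<mu> u) = Some (J (B \<mu> u))"
    using assms by (simp add: half_op_eq_Some_iff I_mu_eq J_in diag_in[OF resolvent_bound] inner_J_basis inner_B_basis
      inner_diag_basis[OF resolvent_bound]) (simp add: power2_eq_square)
  then show ?thesis using assms by (simp add: AIA_def A_half_def sqrt_op_eq half_op_J)
qed

text \<open>\<open>B\<close> is inverse to the weight \<open>J\<^sup>2 + \<mu>\<^sup>2\<close> of the running cost.\<close>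

lemma J_square_B:
  assumes "u \<in> H"
  shows "J (J (B \<mu> u)) + \<mu>\<^sup>2 *\<^sub>R B \<mu> u = u"
proof (rule coeff_eqI)
  fix n
  let ?w = "freq L n" let ?D = "1 + \<mu>\<^sup>2 * ?w\<^sup>2"
  have "?D > 0" by (simp add: add_pos_nonneg)
  have "inner (J (J (B \<mu> u)) + \<mu>\<^sup>2 *\<^sub>R B \<mu> u) (sine L n)
      = (?w\<^sup>2 / ?D * inner u (sine L n)) / ?w / ?w + \<mu>\<^sup>2 * (?w\<^sup>2 / ?D * inner u (sine L n))"
    by (simp only: inner_add_left inner_J_basis inner_B_basis inner_scaleR_left)
  also have "(?w\<^sup>2 / ?D * inner u (sine L n)) / ?w / ?w = 1 / ?D * inner u (sine L n)"
    by (simp add: power2_eq_square)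
  finally show "inner (J (J (B \<mu> u)) + \<mu>\<^sup>2 *\<^sub>R B \<mu> u) (sine L n) = inner u (sine L n)"
    using resolvent_identity[of "\<mu>\<^sup>2" "?w\<^sup>2"] \<open>?D > 0\<close> by simp
qed (use assms in \<open>auto intro!: subspace_add subspace_scale subspace J_in B_in\<close>)

end

lemma J_selfadjoint: "inner (J u) v = inner u (J v)"
  unfolding J_def by (rule diag_selfadjoint[OF inverse_freq_le])

end

subsection \<open>Verification for operator Riccati equations\<close>

lemma vector_derivative_lipschitz:
  fixes f :: "real \<Rightarrow> 'a::real_normed_vector"
  assumes "\<And>s. s \<in> {a..b} \<Longrightarrow> (f has_vector_derivative f' s) (at s within {a..b})"
    and "\<And>s. s \<in> {a..b} \<Longrightarrow> norm (f' s) \<le> C" and "s \<in> {a..b}" "t \<in> {a..b}"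
  shows "norm (f t - f s) \<le> C * \<bar>t - s\<bar>"
proof -
  have "norm (f t - f s) \<le> C * norm (t - s)"
  proof (rule differentiable_bound[where f'="\<lambda>s h. h *\<^sub>R f' s" and S="{a..b}"])
    show "(f has_derivative (\<lambda>h. h *\<^sub>R f' s)) (at s within {a..b})" if "s \<in> {a..b}" for s
      using assms(1)[OF that] by (simp add: has_vector_derivative_def)
    show "onorm (\<lambda>h. h *\<^sub>R f' s) \<le> C" if "s \<in> {a..b}" for s
      using assms(2)[OF that] mult_left_mono[OF assms(2)[OF that] abs_ge_zero]
      by (intro onorm_le) (simp add: mult.commute)
  qed (use assms in auto)
  then show ?thesis by simp
qed

text \<open>The candidate value is evaluated at the remaining time, so its operators run backwards
  along a trajectory. A continuous derivative on a compact interval makes them Lipschitz.\<close>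

lemma ac_on_reflect_C1:
  fixes f :: "real \<Rightarrow> 'a::real_normed_vector"
  assumes deriv: "\<And>s. s \<in> {0..t} \<Longrightarrow> (f has_vector_derivative f' s) (at s within S)" "{0..t} \<subseteq> S"
    and cont: "continuous_on {0..t} f'"
  shows "ac_on 0 t (\<lambda>s. f (t - s))"
proof -
  have "bounded (f' ` {0..t})" by (intro compact_imp_bounded compact_continuous_image cont) simp
  then obtain C where C: "\<And>s. s \<in> {0..t} \<Longrightarrow> norm (f' s) \<le> C" unfolding bounded_iff by (metis imageI)
  show ?thesis
  proof (rule ac_on_lipschitz)
    fix r s assume "0 \<le> r" "r \<le> s" "s \<le> t"
    then show "norm (f (t - s) - f (t - r)) \<le> C * (s - r)"
      using vector_derivative_lipschitz[OF has_vector_derivative_within_subset[OF deriv] C, of "t - r" "t - s"] by simp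
  qed
qed

lemma set_square_integrable_imp_integrable:
  fixes v :: "real \<Rightarrow> 'a::{real_inner, banach, second_countable_topology}"
  assumes m: "set_borel_measurable lborel {a..b} v" and sq: "set_integrable lborel {a..b} (\<lambda>s. (norm (v s))\<^sup>2)"
  shows "set_integrable lborel {a..b} v"
  unfolding set_integrable_def
proof (rule Bochner_Integration.integrable_bound)
  show "integrable lborel (\<lambda>s. indicat_real {a..b} s *\<^sub>R ((norm (v s))\<^sup>2 + 1))"
    using set_integral_add(1)[OF sq borel_integrable_atLeastAtMost'[OF continuous_on_const, of a b 1]]
    by (simp add: set_integrable_def)
  show "(\<lambda>s. indicat_real {a..b} s *\<^sub>R v s) \<in> borel_measurable lborel"
    using m by (simp add: set_borel_measurable_def)
  have "norm (v s) \<le> (norm (v s))\<^sup>2 + 1" for s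
    using sum_squares_bound[of "norm (v s)" 1] norm_ge_zero[of "v s"] by (simp add: power2_eq_square) (smt (verit) norm_ge_zero)
  then show "AE s in lborel. norm (indicat_real {a..b} s *\<^sub>R v s) \<le> norm (indicat_real {a..b} s *\<^sub>R ((norm (v s))\<^sup>2 + 1))"
    by (auto simp: indicator_def)
qed

lemma set_square_integrable_add:
  fixes v w :: "real \<Rightarrow> 'a::{real_inner, banach, second_countable_topology}"
  assumes "set_borel_measurable lborel A v" "set_integrable lborel A (\<lambda>s. (norm (v s))\<^sup>2)"
    and "set_borel_measurable lborel A w" "set_integrable lborel A (\<lambda>s. (norm (w s))\<^sup>2)"
  shows "set_borel_measurable lborel A (\<lambda>s. v s + w s)" "set_integrable lborel A (\<lambda>s. (norm (v s + w s))\<^sup>2)"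
proof -
  have [measurable]: "(\<lambda>s. indicat_real A s *\<^sub>R v s) \<in> borel_measurable lborel"
    "(\<lambda>s. indicat_real A s *\<^sub>R w s) \<in> borel_measurable lborel"
    using assms by (auto simp: set_borel_measurable_def)
  have [measurable]: "(\<lambda>s. indicat_real A s *\<^sub>R (v s + w s)) \<in> borel_measurable lborel"
    unfolding scaleR_add_right by measurable
  then show "set_borel_measurable lborel A (\<lambda>s. v s + w s)" by (simp add: set_borel_measurable_def)
  have eq: "(\<lambda>s. indicat_real A s *\<^sub>R (norm (v s + w s))\<^sup>2) = (\<lambda>s. (norm (indicat_real A s *\<^sub>R (v s + w s)))\<^sup>2)"
    by (auto simp: indicator_def)
  show "set_integrable lborel A (\<lambda>s. (norm (v s + w s))\<^sup>2)"
    unfolding set_integrable_def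
  proof (rule Bochner_Integration.integrable_bound)
    show "integrable lborel (\<lambda>s. indicat_real A s *\<^sub>R (2 * (norm (v s))\<^sup>2 + 2 * (norm (w s))\<^sup>2))"
      by (fold set_integrable_def) (intro set_integral_add(1) set_integrable_mult_right assms)
    show "(\<lambda>s. indicat_real A s *\<^sub>R (norm (v s + w s))\<^sup>2) \<in> borel_measurable lborel"
      unfolding eq by measurable
    have "(norm (x + y))\<^sup>2 \<le> 2 * (norm x)\<^sup>2 + 2 * (norm y)\<^sup>2" for x y :: 'a
    proof -
      have "(norm (x + y))\<^sup>2 \<le> (norm x + norm y)\<^sup>2" by (intro power_mono norm_triangle_ineq) simp
      also have "\<dots> \<le> 2 * (norm x)\<^sup>2 + 2 * (norm y)\<^sup>2"
        using sum_squares_bound[of "norm x" "norm y"] by (simp add: power2_sum)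
      finally show ?thesis .
    qed
    then show "AE s in lborel. norm (indicat_real A s *\<^sub>R (norm (v s + w s))\<^sup>2)
        \<le> norm (indicat_real A s *\<^sub>R (2 * (norm (v s))\<^sup>2 + 2 * (norm (w s))\<^sup>2))"
      by (auto simp: indicator_def)
  qed
qed

lemma set_square_integrable_continuous:
  fixes v :: "real \<Rightarrow> 'a::{real_inner, banach, second_countable_topology}"
  assumes "continuous_on {a..b} v"
  shows "set_borel_measurable lborel {a..b} v" "set_integrable lborel {a..b} (\<lambda>s. (norm (v s))\<^sup>2)"
  using borel_measurable_continuous_on_indicator[OF _ assms]
  by (auto simp: set_borel_measurable_def intro!: borel_integrable_atLeastAtMost' continuous_intros assms)

lemma set_integrable_quadratic:
  fixes v :: "real \<Rightarrow> 'a::{real_inner, banach, second_countable_topology}"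
  assumes "bounded_linear T" and m: "set_borel_measurable lborel A v" and sq: "set_integrable lborel A (\<lambda>s. (norm (v s))\<^sup>2)"
  shows "set_integrable lborel A (\<lambda>s. inner (v s) (T (v s)))"
proof -
  interpret T: bounded_linear T by fact
  obtain C where C: "\<And>x. norm (T x) \<le> norm x * C" using T.bounded by blast
  have [measurable]: "(\<lambda>s. indicat_real A s *\<^sub>R v s) \<in> borel_measurable lborel"
    using m by (simp add: set_borel_measurable_def)
  have [measurable]: "T \<in> borel_measurable borel"
    by (intro borel_measurable_continuous_onI T.continuous_on continuous_on_id)
  have eq: "(\<lambda>s. indicat_real A s *\<^sub>R inner (v s) (T (v s))) = (\<lambda>s. inner (indicat_real A s *\<^sub>R v s) (T (indicat_real A s *\<^sub>R v s)))"
    by (auto simp: indicator_def)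
  show ?thesis
    unfolding set_integrable_def
  proof (rule Bochner_Integration.integrable_bound)
    show "integrable lborel (\<lambda>s. indicat_real A s *\<^sub>R (C * (norm (v s))\<^sup>2))"
      using set_integrable_mult_right[of C lborel A "\<lambda>s. (norm (v s))\<^sup>2"] sq by (simp add: set_integrable_def)
    show "(\<lambda>s. indicat_real A s *\<^sub>R inner (v s) (T (v s))) \<in> borel_measurable lborel"
      unfolding eq by measurable
    have "\<bar>inner x (T x)\<bar> \<le> \<bar>C * (norm x)\<^sup>2\<bar>" for x
    proof -
      have "\<bar>inner x (T x)\<bar> \<le> norm x * norm (T x)" by (rule Cauchy_Schwarz_ineq2)
      also have "\<dots> \<le> norm x * (norm x * C)" by (intro mult_left_mono C) simp
      also have "\<dots> = C * (norm x)\<^sup>2" by (simp add: power2_eq_square)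
      finally show ?thesis by simp
    qed
    then show "AE s in lborel. norm (indicat_real A s *\<^sub>R inner (v s) (T (v s))) \<le> norm (indicat_real A s *\<^sub>R (C * (norm (v s))\<^sup>2))"
      by (auto simp: indicator_def)
  qed
qed

text \<open>The projection commutes with the Bochner integral and fixes the integrand.\<close>

lemma set_integral_in_closed_subspace:
  fixes v :: "real \<Rightarrow> 'a::{real_inner, banach, second_countable_topology}"
  assumes proj: "bounded_linear I" "\<And>u. u \<in> H \<Longrightarrow> I u = u" "\<And>u. I u \<in> H"
    and v: "set_integrable lborel A v" "\<And>s. s \<in> A \<Longrightarrow> v s \<in> H"
  shows "(LBINT s:A. v s) \<in> H"
proof -
  interpret I: bounded_linear I by fact
  have eq: "(\<lambda>s. I (indicat_real A s *\<^sub>R v s)) = (\<lambda>s. indicat_real A s *\<^sub>R v s)"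
    using v(2) by (auto simp: indicator_def proj(2))
  have "I (LBINT s:A. v s) = (LBINT s. I (indicat_real A s *\<^sub>R v s))"
    using integral_bounded_linear[OF proj(1), of lborel "\<lambda>s. indicat_real A s *\<^sub>R v s"] v(1)
    by (simp add: set_lebesgue_integral_def set_integrable_def)
  also have "\<dots> = (LBINT s:A. v s)" unfolding eq set_lebesgue_integral_def ..
  finally show ?thesis using proj(3) by metis
qed

section \<open>The abstract Riccati system and the symmetry of its solution\<close>

text \<open>Operators act on the whole type, so \<open>I\<close>, the stand-in for the identity, is
  a projection onto \<open>H\<close>, and \<open>E\<close> inverts \<open>B\<close> on
  \<open>H\<close>. For \<open>R\<close> only the quadratic form is differentiated: the value
  contains nothing else of \<open>R\<close>, and no adjoint of \<open>Q\<close> has to be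
  mentioned.\<close>

locale riccati_system =
  fixes H :: "'a::{real_inner, banach, second_countable_topology} set"
    and I B E :: "'a \<Rightarrow>\<^sub>L 'a" and P Q :: "real \<Rightarrow> 'a \<Rightarrow>\<^sub>L 'a" and R :: "real \<Rightarrow> 'a \<Rightarrow> 'a"
    and \<kappa> m T :: real
  assumes subspace: "subspace H" and proj: "\<And>u. u \<in> H \<Longrightarrow> I u = u" "\<And>u. I u \<in> H"
    and B_in: "B u \<in> H" and B_sym: "inner (B u) v = inner u (B v)"
    and E_B: "u \<in> H \<Longrightarrow> E (B u) = u" and E_sym: "inner (E u) v = inner u (E v)"
    and E_nonneg: "0 \<le> inner u (E u)"
    and m: "0 < m"
    and P_in: "t \<in> {0..<T} \<Longrightarrow> u \<in> H \<Longrightarrow> P t u \<in> H" and Q_in: "t \<in> {0..<T} \<Longrightarrow> u \<in> H \<Longrightarrow> Q t u \<in> H"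
    and P_ode: "t \<in> {0..<T} \<Longrightarrow>
      (P has_vector_derivative \<kappa> *\<^sub>R I + (1 / m) *\<^sub>R (P t o\<^sub>L B o\<^sub>L P t)) (at t within {0..<T})"
    and Q_ode: "t \<in> {0..<T} \<Longrightarrow>
      (Q has_vector_derivative (1 / m) *\<^sub>R (P t o\<^sub>L B o\<^sub>L Q t)) (at t within {0..<T})"
    and R_ode: "t \<in> {0..<T} \<Longrightarrow> z \<in> H \<Longrightarrow>
      ((\<lambda>t. inner z (R t z)) has_real_derivative (1 / m) * inner (Q t z) (B (Q t z))) (at t within {0..<T})"
    and P_init_sym: "u \<in> H \<Longrightarrow> v \<in> H \<Longrightarrow> inner (P 0 u) v = inner u (P 0 v)"
begin

lemma continuous_on_PQ: "continuous_on {0..<T} P" "continuous_on {0..<T} Q"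
  by (intro continuous_on_vector_derivative[OF P_ode] continuous_on_vector_derivative[OF Q_ode]; assumption)+

text \<open>Gronwall's argument by iteration, carried out on pairs of vectors so that no adjoint
  operator enters. The derivative of the defect is a sum of two defects at other pairs. With the
  rate \<open>4 * C * norm B / m\<close>, twice what the estimate of the derivative yields, each
  integration gains a factor 1/2.\<close>

lemma P_sym_bound:
  assumes T: "0 \<le> s" "s \<le> t" "t < T" and C: "\<And>r. r \<in> {0..t} \<Longrightarrow> norm (P r) \<le> C"
  shows "u \<in> H \<Longrightarrow> v \<in> H \<Longrightarrow>
    \<bar>inner (P s u) v - inner u (P s v)\<bar> \<le> 2 * C * (1 / 2) ^ n * exp (4 * C * norm B / m * s) * norm u * norm v"
  using T(1,2)
proof (induction n arbitrary: s u v)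
  case 0
  have C0: "C \<ge> 0" by (rule order_trans[OF norm_ge_zero C[of s]]) (use 0 in auto)
  have PC: "norm (P s w) \<le> C * norm w" for w
    using norm_blinfun[of "P s" w] mult_right_mono[OF C[of s], of "norm w"] 0 by simp
  have "\<bar>inner (P s u) v - inner u (P s v)\<bar> \<le> \<bar>inner (P s u) v\<bar> + \<bar>inner u (P s v)\<bar>" by (rule abs_triangle_ineq4)
  also have "\<dots> \<le> norm (P s u) * norm v + norm u * norm (P s v)"
    by (intro add_mono Cauchy_Schwarz_ineq2)
  also have "\<dots> \<le> (C * norm u) * norm v + norm u * (C * norm v)"
    by (intro add_mono mult_right_mono mult_left_mono PC) auto
  also have "\<dots> = 2 * C * 1 * norm u * norm v" by simp
  also have "\<dots> \<le> 2 * C * exp (4 * C * norm B / m * s) * norm u * norm v"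
    using C0 0 m by (intro mult_right_mono mult_left_mono) auto
  finally show ?case by simp
next
  case (Suc n)
  define \<beta> where "\<beta> = 4 * C * norm B / m"
  define K where "K = 2 * C * (1 / 2) ^ n * norm u * norm v"
  have C0: "C \<ge> 0" by (rule order_trans[OF norm_ge_zero C[of s]]) (use Suc in auto)
  define d where "d r = inner (P r u) v - inner u (P r v)" for r
  \<comment> \<open>The cross terms \<open>inner (B (P r u)) (P r v)\<close> and
    \<open>inner (P r u) (B (P r v))\<close> cancel by symmetry of \<open>B\<close>. They are
    inserted so that each bracket is again a defect, with \<open>B (P r u)\<close> or
    \<open>B (P r v)\<close> as one of its vectors.\<close>
  define d' where "d' r = (1 / m) * ((inner (P r (B (P r u))) v - inner (B (P r u)) (P r v)) + (inner (P r u) (B (P r v)) - inner u (P r (B (P r v)))))" for r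
  have "norm (d s - d 0) \<le> K / 2 * exp (\<beta> * s) - K / 2 * exp (\<beta> * 0)"
  proof (cases "s = 0")
    case False
    show ?thesis
    proof (rule differentiable_bound_general[where f'=d' and \<phi>'="\<lambda>r. \<beta> * (K / 2 * exp (\<beta> * r))"])
      show "0 < s" using False Suc by simp
      have dd: "(d has_vector_derivative d' r) (at r within {0..<T})" if r: "r \<in> {0..<T}" for r
      proof -
        let ?P' = "\<kappa> *\<^sub>R I + (1 / m) *\<^sub>R (P r o\<^sub>L B o\<^sub>L P r)"
        have ap: "((\<lambda>r. P r w) has_vector_derivative ?P' w) (at r within {0..<T})" for w
          by (rule bounded_linear.has_vector_derivative[OF blinfun.bounded_linear_left P_ode[OF r]])
        have "(d has_vector_derivative inner (?P' u) v - inner u (?P' v)) (at r within {0..<T})"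
          unfolding d_def[abs_def]
          by (intro has_vector_derivative_diff bounded_linear.has_vector_derivative[OF bounded_linear_inner_left ap]
              bounded_linear.has_vector_derivative[OF bounded_linear_inner_right ap])
        also have "inner (?P' u) v - inner u (?P' v) = d' r"
          using Suc B_sym[of "P r u" "P r v"]
          by (simp add: d'_def blinfun.add_left blinfun.scaleR_left inner_add_left inner_add_right proj algebra_simps)
        finally show ?thesis .
      qed
      have "{0..s} \<subseteq> {0..<T}" using Suc T by auto
      then show "continuous_on {0..s} d"
        using continuous_on_vector_derivative[OF dd] continuous_on_subset by blast
      show "continuous_on {0..s} (\<lambda>r. K / 2 * exp (\<beta> * r))" by (intro continuous_intros)
      fix r assume r: "0 < r" "r < s"
      then have rT: "r \<in> {0..<T}" "r \<in> {0..t}" "at r within {0..<T} = at r"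
        using Suc T by (auto intro!: at_within_interior)
      show "(d has_vector_derivative d' r) (at r)" using dd[OF rT(1)] rT(3) by simp
      show "((\<lambda>r. K / 2 * exp (\<beta> * r)) has_vector_derivative \<beta> * (K / 2 * exp (\<beta> * r))) (at r)"
        unfolding has_real_derivative_iff_has_vector_derivative[symmetric] by (auto intro!: derivative_eq_intros)
      have BP: "norm (B (P r w)) \<le> norm B * C * norm w" for w
      proof -
        have "norm (B (P r w)) \<le> norm B * norm (P r w)" by (rule norm_blinfun)
        also have "\<dots> \<le> norm B * (C * norm w)"
          using norm_blinfun[of "P r" w] mult_right_mono[OF C[OF rT(2)], of "norm w"]
          by (intro mult_left_mono) auto
        finally show ?thesis by simp
      qed
      let ?k = "2 * C * (1 / 2) ^ n * exp (\<beta> * r)"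
      have k0: "?k \<ge> 0" using C0 by simp
      have "norm (d' r) \<le> (1 / m) * (\<bar>inner (P r (B (P r u))) v - inner (B (P r u)) (P r v)\<bar> + \<bar>inner (P r u) (B (P r v)) - inner u (P r (B (P r v)))\<bar>)"
        unfolding d'_def using m by (auto simp: abs_mult intro!: mult_left_mono divide_right_mono abs_triangle_ineq)
      also have "(1 / m) * (\<bar>inner (P r (B (P r u))) v - inner (B (P r u)) (P r v)\<bar> + \<bar>inner (P r u) (B (P r v)) - inner u (P r (B (P r v)))\<bar>)
         \<le> (1 / m) * (?k * norm (B (P r u)) * norm v + ?k * norm u * norm (B (P r v)))"
        using Suc.IH[of "B (P r u)" v r] Suc.IH[of u "B (P r v)" r] Suc.prems r m B_in
        by (intro mult_left_mono add_mono) (auto simp: \<beta>_def)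
      also have "\<dots> \<le> (1 / m) * (?k * (norm B * C * norm u) * norm v + ?k * norm u * (norm B * C * norm v))"
        using m C0 by (intro mult_left_mono add_mono mult_right_mono BP mult_nonneg_nonneg) auto
      also have "\<dots> = \<beta> * (K / 2 * exp (\<beta> * r))"
        using m by (simp add: \<beta>_def K_def field_simps)
      finally show "norm (d' r) \<le> \<beta> * (K / 2 * exp (\<beta> * r))" .
    qed
  qed simp
  moreover have "d 0 = 0" using P_init_sym Suc by (simp add: d_def)
  moreover have "K \<ge> 0" using C0 by (simp add: K_def)
  ultimately have "\<bar>d s\<bar> \<le> K / 2 * exp (\<beta> * s)" by simp
  then show ?case by (simp add: d_def K_def \<beta>_def mult.assoc mult.commute mult.left_commute)
qed

lemma bounded_on:
  assumes "t < T" and "continuous_on {0..<T} (f :: real \<Rightarrow> 'b::real_normed_vector)"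
  obtains C where "C > 0" "\<And>r. r \<in> {0..t} \<Longrightarrow> norm (f r) \<le> C"
proof -
  have "{0..t} \<subseteq> {0..<T}" using assms(1) by auto
  then have "bounded (f ` {0..t})"
    by (intro compact_imp_bounded compact_continuous_image continuous_on_subset[OF assms(2)]) auto
  then show ?thesis unfolding bounded_pos using that by (metis imageI)
qed

lemma P_sym:
  assumes t: "t \<in> {0..<T}" and uv: "u \<in> H" "v \<in> H"
  shows "inner (P t u) v = inner u (P t v)"
proof -
  obtain C where C: "C > 0" "\<And>r. r \<in> {0..t} \<Longrightarrow> norm (P r) \<le> C"
    using bounded_on[OF _ continuous_on_PQ(1), of t] t by auto
  let ?a = "exp (4 * C * norm B / m * t) * norm u * norm v"
  have "\<bar>inner (P t u) v - inner u (P t v)\<bar> \<le> 2 * C * ?a * (1 / 2) ^ n" for n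
    using P_sym_bound[OF _ _ _ C(2) uv, of t t n] t by (simp add: mult.commute mult.left_commute)
  moreover have "(\<lambda>n. 2 * C * ?a * (1 / 2) ^ n) \<longlonglongrightarrow> 2 * C * ?a * 0"
    by (intro tendsto_mult tendsto_const LIMSEQ_realpow_zero) auto
  ultimately have "\<bar>inner (P t u) v - inner u (P t v)\<bar> \<le> 2 * C * ?a * 0"
    by (intro LIMSEQ_le_const) auto
  then show ?thesis by simp
qed

section \<open>Completing the square along trajectories\<close>

definition traj :: "'a \<Rightarrow> (real \<Rightarrow> 'a) \<Rightarrow> real \<Rightarrow> 'a" where
  "traj x v s = x + (LBINT r:{0..s}. v r)"

text \<open>The pointwise maximiser of \<open>inner v p - m / 2 * inner v (E v)\<close> over
  \<open>H\<close>, where \<open>p = P y + Q z\<close> is the gradient of the candidate in the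
  state, at the remaining time.\<close>

definition feedback :: "real \<Rightarrow> 'a \<Rightarrow> (real \<Rightarrow> 'a) \<Rightarrow> real \<Rightarrow> 'a" where
  "feedback t z y s = (1 / m) *\<^sub>R B (P (t - s) (y s) + Q (t - s) z)"

definition W :: "real \<Rightarrow> 'a \<Rightarrow> 'a \<Rightarrow> real" where
  "W t x z = inner x (P t x) / 2 + inner x (Q t z) + inner z (R t z) / 2"

text \<open>With \<open>W 0\<close> as terminal payoff, \<open>c\<close> and \<open>K\<close> stay
  out of the argument; the initial conditions later identify it with the actual payoff.\<close>

definition reward :: "real \<Rightarrow> 'a \<Rightarrow> (real \<Rightarrow> 'a) \<Rightarrow> 'a \<Rightarrow> real" where
  "reward t x v z = (LBINT s:{0..t}. \<kappa> / 2 * (norm (traj x v s))\<^sup>2 - m / 2 * inner (v s) (E (v s)))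
     + W 0 (traj x v t) z"

lemma traj_in:
  assumes "x \<in> H" "set_integrable lborel {0..t} v" "\<And>s. s \<in> {0..t} \<Longrightarrow> v s \<in> H" "s \<in> {0..t}"
  shows "traj x v s \<in> H"
proof -
  have "(LBINT r:{0..s}. v r) \<in> H"
    using assms by (intro set_integral_in_closed_subspace[OF blinfun.bounded_linear_right proj] set_integrable_subset[OF assms(2)]) auto
  then show ?thesis unfolding traj_def by (intro subspace_add subspace assms)
qed

lemma ac_on_traj: "set_integrable lborel {0..t} v \<Longrightarrow> ac_on 0 t (traj x v)"
  unfolding traj_def[abs_def] by (intro ac_on_add ac_on_set_integral ac_on_lipschitz[of _ _ "\<lambda>_. x" 0]) simp_all

lemma continuous_on_feedback:
  assumes t: "t < T" and y: "continuous_on {0..t} y"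
  shows "continuous_on {0..t} (feedback t z y)"
proof -
  have sub: "(\<lambda>s. t - s) ` {0..t} \<subseteq> {0..<T}" using t by auto
  have "continuous_on {0..t} (\<lambda>s. P (t - s))" "continuous_on {0..t} (\<lambda>s. Q (t - s))"
    by (intro continuous_on_compose2[OF continuous_on_PQ(1) _ sub] continuous_on_compose2[OF continuous_on_PQ(2) _ sub] continuous_intros)+
  then show ?thesis unfolding feedback_def[abs_def] using y by (intro continuous_intros)
qed

lemma feedback_in: "feedback t z y s \<in> H"
  unfolding feedback_def by (intro subspace_scale subspace B_in)

text \<open>Completing the square: along any trajectory, the running reward plus the derivative of the
  candidate value is minus the \<open>E\<close>-square of the deviation from the feedback.\<close>

theorem reward_eq:
  assumes t: "t \<in> {0..<T}" and x: "x \<in> H" and z: "z \<in> H"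
    and vm: "set_borel_measurable lborel {0..t} v" and v2: "set_integrable lborel {0..t} (\<lambda>s. (norm (v s))\<^sup>2)"
    and vH: "\<And>s. s \<in> {0..t} \<Longrightarrow> v s \<in> H"
  defines "q \<equiv> (\<lambda>s. v s - feedback t z (traj x v) s)"
  shows "reward t x v z = W t x z - m / 2 * (LBINT s:{0..t}. inner (q s) (E (q s)))"
    and "set_integrable lborel {0..t} (\<lambda>s. inner (q s) (E (q s)))"
proof -
  define y where "y = traj x v"
  have vi: "set_integrable lborel {0..t} v" by (rule set_square_integrable_imp_integrable[OF vm v2])
  have yH: "y s \<in> H" if "s \<in> {0..t}" for s unfolding y_def by (rule traj_in[OF x vi vH that])
  have acy: "ac_on 0 t y" unfolding y_def by (rule ac_on_traj[OF vi])
  have yc: "continuous_on {0..t} y" by (rule ac_on_imp_continuous_on[OF acy])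
  have fc: "continuous_on {0..t} (\<lambda>s. - feedback t z y s)"
    using t by (intro continuous_on_minus continuous_on_feedback yc) auto
  have q2: "set_borel_measurable lborel {0..t} q" "set_integrable lborel {0..t} (\<lambda>s. (norm (q s))\<^sup>2)"
    using set_square_integrable_add[OF vm v2 set_square_integrable_continuous[OF fc]]
    by (simp_all add: q_def y_def)
  show qi: "set_integrable lborel {0..t} (\<lambda>s. inner (q s) (E (q s)))"
    by (rule set_integrable_quadratic[OF blinfun.bounded_linear_right q2])
  have vEi: "set_integrable lborel {0..t} (\<lambda>s. inner (v s) (E (v s)))"
    by (rule set_integrable_quadratic[OF blinfun.bounded_linear_right vm v2])
  define r where "r s = \<kappa> / 2 * (norm (y s))\<^sup>2 - m / 2 * inner (v s) (E (v s))" for s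
  have ri: "set_integrable lborel {0..t} r"
    unfolding r_def[abs_def]
    by (intro set_integral_diff(1) set_integrable_mult_right vEi borel_integrable_atLeastAtMost' continuous_intros yc)
  \<comment> \<open>The claimed derivative of the candidate value along the trajectory; integrating
    it yields the identity to be shown.\<close>
  define g where "g s = - r s - m / 2 * inner (q s) (E (q s))" for s
  have gi: "set_integrable lborel {0..t} g"
    unfolding g_def[abs_def]
    using set_integral_diff(1)[OF set_integrable_mult_right[of "-1" lborel "{0..t}" r] set_integrable_mult_right[of "m / 2" lborel "{0..t}" "\<lambda>s. inner (q s) (E (q s))"]] ri qi
    by simp
  define P' where "P' s = \<kappa> *\<^sub>R I + (1 / m) *\<^sub>R (P s o\<^sub>L B o\<^sub>L P s)" for s
  define Q' where "Q' s = (1 / m) *\<^sub>R (P s o\<^sub>L B o\<^sub>L Q s)" for s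
  define \<rho> where "\<rho> s = inner z (R s z)" for s
  define \<rho>' where "\<rho>' s = (1 / m) * inner (Q s z) (B (Q s z))" for s
  have sub: "{0..t} \<subseteq> {0..<T}" using t by auto
  note PQc = continuous_on_subset[OF continuous_on_PQ(1) sub] continuous_on_subset[OF continuous_on_PQ(2) sub]
  have dP: "(P has_vector_derivative P' s) (at s within {0..<T})"
    and dQ: "(Q has_vector_derivative Q' s) (at s within {0..<T})"
    and d\<rho>: "(\<rho> has_vector_derivative \<rho>' s) (at s within {0..<T})" if "s \<in> {0..t}" for s
    using P_ode[of s] Q_ode[of s] R_ode[OF _ z, of s] that sub
    by (auto simp: P'_def Q'_def \<rho>_def[abs_def] \<rho>'_def has_real_derivative_iff_has_vector_derivative)
  have cont: "continuous_on {0..t} P'" "continuous_on {0..t} Q'" "continuous_on {0..t} \<rho>'"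
    unfolding P'_def[abs_def] Q'_def[abs_def] \<rho>'_def[abs_def]
    by (intro continuous_intros bounded_bilinear.continuous_on[OF bounded_bilinear_blinfun_compose] PQc)+
  note acP = ac_on_reflect_C1[OF dP sub cont(1)] and acQ = ac_on_reflect_C1[OF dQ sub cont(2)]
    and ac\<rho> = ac_on_reflect_C1[OF d\<rho> sub cont(3)]
  \<comment> \<open>The candidate at remaining time \<open>t - s\<close> along the trajectory,
    starting from \<open>W t x z\<close> and ending at the terminal payoff.\<close>
  define \<Phi> where "\<Phi> s = (1 / 2) * inner (y s) (P (t - s) (y s)) + inner (y s) (Q (t - s) z) + (1 / 2) * \<rho> (t - s)" for s
  have ac\<Phi>: "ac_on 0 t \<Phi>"
    unfolding \<Phi>_def
    by (intro ac_on_add bounded_linear.ac_on[OF bounded_linear_mult_right]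
        bounded_bilinear.ac_on[OF bounded_bilinear_inner] acy ac\<rho>
        bounded_bilinear.ac_on[OF bounded_bilinear_blinfun_apply] acP acQ
        bounded_linear.ac_on[OF blinfun.bounded_linear_left])
  have "(LBINT s:{0..t}. g s) = \<Phi> t - \<Phi> 0"
  proof (rule ac_on_set_lebesgue_integral[OF _ ac\<Phi> gi])
    show "0 \<le> t" using t by simp
    show "AE s in lborel. s \<in> {0<..<t} \<longrightarrow> (\<Phi> has_real_derivative g s) (at s)"
      using Bochner_integral_has_derivative_AE[OF vi]
    proof eventually_elim
      case (elim s)
      show ?case
      proof
        assume s: "s \<in> {0<..<t}"
        then have st: "s \<in> {0..t}" "t - s \<in> {0..t}" "t - s \<in> {0..<T}" using t by auto
        have dy: "(y has_vector_derivative v s) (at s)"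
          unfolding y_def traj_def[abs_def] using has_vector_derivative_add[OF has_vector_derivative_const] elim s by fastforce
        have inner: "at (t - s) within {0..<T} = at (t - s)" using s t by (intro at_within_interior) auto
        have dt: "((\<lambda>s. t - s) has_vector_derivative - 1) (at s)"
          unfolding has_real_derivative_iff_has_vector_derivative[symmetric] by (auto intro!: derivative_eq_intros)
        note ch = vector_diff_chain_at[OF dt, unfolded o_def]
        have cP: "((\<lambda>s. P (t - s)) has_vector_derivative - P' (t - s)) (at s)"
          using ch[of P "P' (t - s)"] dP[OF st(2)] inner by simp
        have cQ: "((\<lambda>s. Q (t - s)) has_vector_derivative - Q' (t - s)) (at s)"
          using ch[of Q "Q' (t - s)"] dQ[OF st(2)] inner by simp
        have c\<rho>: "((\<lambda>s. \<rho> (t - s)) has_vector_derivative - \<rho>' (t - s)) (at s)"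
          using ch[of \<rho> "\<rho>' (t - s)"] d\<rho>[OF st(2)] inner by simp
        let ?P = "P (t - s)" and ?Q = "Q (t - s)"
        \<comment> \<open>The derivative in the raw form given by the product rules; the minus signs
          come from running time backwards.\<close>
        define D where "D = (1 / 2) * (inner (y s) (?P (v s) + (- P' (t - s)) (y s)) + inner (v s) (?P (y s)))
           + (inner (y s) ((- Q' (t - s)) z) + inner (v s) (?Q z)) + (1 / 2) * (- \<rho>' (t - s))"
        have d\<Phi>: "(\<Phi> has_vector_derivative D) (at s)"
          unfolding D_def \<Phi>_def[abs_def]
          by (intro has_vector_derivative_add has_vector_derivative_mult_right
              bounded_bilinear.has_vector_derivative[OF bounded_bilinear_inner] dy c\<rho>
              bounded_bilinear.has_vector_derivative[OF bounded_bilinear_blinfun_apply] cP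
              bounded_linear.has_vector_derivative[OF blinfun.bounded_linear_left cQ])
        have "D = g s"
        proof -
          let ?u = "?P (y s)" and ?w = "?Q z"
          let ?p = "?u + ?w"
          have yH': "y s \<in> H" and vH': "v s \<in> H" using yH[OF st(1)] vH[OF st(1)] by auto
          have uw: "?u \<in> H" "?w \<in> H" using P_in[OF st(3) yH'] Q_in[OF st(3) z] by auto
          then have pH: "?p \<in> H" by (intro subspace_add subspace)
          \<comment> \<open>Symmetry of \<open>P\<close> enters here: it merges the two terms linear
            in the control and, in the next two facts, moves the outer \<open>P\<close> of the
            differential equations onto the state.\<close>
          have 1: "inner (y s) (?P (v s)) = inner (v s) ?u"
            using P_sym[OF st(3) yH' vH'] by (simp add: inner_commute)
          have 2: "inner (y s) (P' (t - s) (y s)) = \<kappa> * (norm (y s))\<^sup>2 + (1 / m) * inner ?u (B ?u)"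
            using P_sym[OF st(3) yH' B_in, of ?u] yH'
            by (simp add: P'_def blinfun.add_left blinfun.scaleR_left inner_add_right proj power2_norm_eq_inner)
          have 3: "inner (y s) (Q' (t - s) z) = (1 / m) * inner ?u (B ?w)"
            using P_sym[OF st(3) yH' B_in, of ?w] by (simp add: Q'_def blinfun.scaleR_left)
          have 4: "inner ?p (B ?p) = inner ?u (B ?u) + 2 * inner ?u (B ?w) + inner ?w (B ?w)"
            using B_sym[of ?u ?w] by (simp add: blinfun.add_right inner_add_left inner_add_right inner_commute)
          have qs: "q s = v s - (1 / m) *\<^sub>R B ?p" by (simp add: q_def feedback_def y_def)
          \<comment> \<open>Since \<open>E (B p) = p\<close>, the mixed terms lose both operators
            and the last one keeps a single \<open>B\<close>. A generic \<open>p\<close> keeps the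
            sum \<open>?p\<close> from being expanded.\<close>
          have quad: "inner (q s) (E (q s)) = inner (v s) (E (v s)) - (2 / m) * inner (v s) p + (1 / m)\<^sup>2 * inner p (B p)"
            if "p \<in> H" "q s = v s - (1 / m) *\<^sub>R B p" for p
          proof -
            have a: "inner (B p) (E (v s)) = inner (v s) p"
              using E_sym[of "B p" "v s"] E_B[OF that(1)] by (simp add: inner_commute)
            have "E (q s) = E (v s) - (1 / m) *\<^sub>R p"
              using E_B[OF that(1)] by (simp add: that(2) blinfun.diff_right blinfun.scaleR_right)
            then have "inner (q s) (E (q s)) = inner (v s) (E (v s)) - (1 / m) * inner (v s) p
                - (1 / m) * (inner (B p) (E (v s)) - (1 / m) * inner (B p) p)"
              by (simp add: that(2) inner_diff_left inner_diff_right right_diff_distrib)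
            also have "inner (B p) p = inner p (B p)" by (rule B_sym)
            finally show ?thesis unfolding a by (simp add: power2_eq_square right_diff_distrib)
          qed
          note 5 = quad[OF pH qs]
          have "m / 2 * inner (q s) (E (q s)) = m / 2 * inner (v s) (E (v s)) - inner (v s) ?p + 1 / (2 * m) * inner ?p (B ?p)"
          proof -
            have "m / 2 * (a - (2 / m) * b + (1 / m)\<^sup>2 * c) = m / 2 * a - b + 1 / (2 * m) * c" for a b c
              using m by (simp add: field_simps power2_eq_square)
            then show ?thesis unfolding 5 .
          qed
          then have "g s = inner (v s) ?p - \<kappa> / 2 * (norm (y s))\<^sup>2 - 1 / (2 * m) * inner ?p (B ?p)"
            unfolding g_def r_def by (simp only: right_diff_distrib)
          then have g: "g s = inner (v s) ?u + inner (v s) ?w - \<kappa> / 2 * (norm (y s))\<^sup>2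
              - 1 / (2 * m) * (inner ?u (B ?u) + 2 * inner ?u (B ?w) + inner ?w (B ?w))"
            unfolding 4 by (simp only: inner_add_right)
          have "D = (1 / 2) * (inner (v s) ?u - (\<kappa> * (norm (y s))\<^sup>2 + (1 / m) * inner ?u (B ?u)) + inner (v s) ?u)
            + (- ((1 / m) * inner ?u (B ?w)) + inner (v s) ?w) + (1 / 2) * (- ((1 / m) * inner ?w (B ?w)))"
            unfolding D_def blinfun.minus_left inner_add_right inner_minus_right 1 2 3 \<rho>'_def by simp
          moreover have "(1 / 2) * (a - (\<kappa> * n + (1 / m) * e1) + a) + (- ((1 / m) * e2) + b) + (1 / 2) * (- ((1 / m) * e3))
            = a + b - \<kappa> / 2 * n - 1 / (2 * m) * (e1 + 2 * e2 + e3)" for a b n e1 e2 e3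
            using m by (simp add: field_simps)
          ultimately show ?thesis unfolding g by (simp only:)
        qed
        then show "(\<Phi> has_real_derivative g s) (at s)"
          using d\<Phi> by (simp add: has_real_derivative_iff_has_vector_derivative)
      qed
    qed
  qed
  moreover have "(LBINT s:{0..t}. g s) = - (LBINT s:{0..t}. r s) - m / 2 * (LBINT s:{0..t}. inner (q s) (E (q s)))"
  proof -
    have 1: "set_integrable lborel {0..t} (\<lambda>s. - 1 * r s)" by (intro set_integrable_mult_right ri)
    have 2: "set_integrable lborel {0..t} (\<lambda>s. m / 2 * inner (q s) (E (q s)))" by (intro set_integrable_mult_right qi)
    have "(LBINT s:{0..t}. g s) = (LBINT s:{0..t}. - 1 * r s - m / 2 * inner (q s) (E (q s)))" by (simp add: g_def)
    also have "\<dots> = (LBINT s:{0..t}. - 1 * r s) - (LBINT s:{0..t}. m / 2 * inner (q s) (E (q s)))"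
      by (rule set_integral_diff(2)[OF 1 2])
    also have "\<dots> = - 1 * (LBINT s:{0..t}. r s) - m / 2 * (LBINT s:{0..t}. inner (q s) (E (q s)))"
      by (simp only: set_integral_mult_right)
    finally show ?thesis by simp
  qed
  moreover have "y 0 = x"
  proof -
    have "(LBINT r:{0..0}. v r) = (LBINT r:{}. v r)"
      by (rule set_integral_discrete_difference[where X="{0}"]) auto
    then show ?thesis by (simp add: y_def traj_def set_lebesgue_integral_def)
  qed
  then have "\<Phi> 0 = W t x z" "\<Phi> t = W 0 (y t) z" by (simp_all add: \<Phi>_def W_def \<rho>_def)
  ultimately show "reward t x v z = W t x z - m / 2 * (LBINT s:{0..t}. inner (q s) (E (q s)))"
    unfolding reward_def y_def[symmetric] r_def[symmetric] by simp
qed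

corollary reward_le:
  assumes "t \<in> {0..<T}" "x \<in> H" "z \<in> H" "set_borel_measurable lborel {0..t} v"
    "set_integrable lborel {0..t} (\<lambda>s. (norm (v s))\<^sup>2)" "\<And>s. s \<in> {0..t} \<Longrightarrow> v s \<in> H"
  shows "reward t x v z \<le> W t x z"
proof -
  have "0 \<le> (LBINT s:{0..t}. inner (v s - feedback t z (traj x v) s) (E (v s - feedback t z (traj x v) s)))"
    unfolding set_lebesgue_integral_def by (intro Bochner_Integration.integral_nonneg) (simp add: E_nonneg)
  then show ?thesis using reward_eq(1)[OF assms] m by simp
qed

section \<open>Nearly optimal controls from Picard iteration\<close>

primrec picard :: "real \<Rightarrow> 'a \<Rightarrow> 'a \<Rightarrow> nat \<Rightarrow> real \<Rightarrow> 'a" where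
  "picard t x z 0 = (\<lambda>_. x)"
| "picard t x z (Suc n) = traj x (feedback t z (picard t x z n))"

lemma continuous_on_picard:
  assumes "t < T"
  shows "continuous_on {0..t} (picard t x z n)"
proof (induction n)
  case (Suc n)
  have "continuous_on {0..t} (feedback t z (picard t x z n))" by (rule continuous_on_feedback[OF assms Suc])
  then show ?case
    by (simp add: ac_on_imp_continuous_on[OF ac_on_traj] borel_integrable_atLeastAtMost')
qed simp

lemma feedback_picard_integrable:
  "t < T \<Longrightarrow> set_integrable lborel {0..t} (feedback t z (picard t x z n))"
  by (intro borel_integrable_atLeastAtMost' continuous_on_feedback continuous_on_picard)

lemma feedback_diff: "feedback t z y s - feedback t z y' s = (1 / m) *\<^sub>R B (P (t - s) (y s - y' s))"
  by (simp add: feedback_def scaleR_diff_right[symmetric] blinfun.diff_right[symmetric])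

text \<open>The feedback is Lipschitz in the state with constant \<open>M\<close>. Integrating
  \<open>M * exp (2 * M * r)\<close> gives at most half of \<open>exp (2 * M * s)\<close>, so this
  weight makes the iteration contract by 1/2 on the whole interval without subdividing it.\<close>

lemma picard_contraction:
  assumes t: "t \<in> {0..<T}"
  obtains M C where "M > 0" "C > 0"
    "\<And>s u. s \<in> {0..t} \<Longrightarrow> norm ((1 / m) *\<^sub>R B (P (t - s) u)) \<le> M * norm u"
    "\<And>n s. s \<in> {0..t} \<Longrightarrow> norm (picard t x z (Suc n) s - picard t x z n s) \<le> C * (1 / 2) ^ n * exp (2 * M * s)"
proof -
  have tT: "t < T" using t by simp
  obtain D where D: "D > 0" "\<And>r. r \<in> {0..t} \<Longrightarrow> norm (P r) \<le> D"
    using bounded_on[OF tT continuous_on_PQ(1)] by blast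
  \<comment> \<open>The summand 1 keeps the rate positive even if \<open>B\<close> is zero.\<close>
  define M where "M = norm B * D / m + 1"
  have M: "M > 0" using D m by (simp add: M_def add_nonneg_pos)
  have Mb: "norm ((1 / m) *\<^sub>R B (P (t - s) u)) \<le> M * norm u" if s: "s \<in> {0..t}" for s u
  proof -
    have "norm (B (P (t - s) u)) \<le> norm B * norm (P (t - s) u)" by (rule norm_blinfun)
    also have "\<dots> \<le> norm B * (D * norm u)"
      using norm_blinfun[of "P (t - s)" u] mult_right_mono[OF D(2)[of "t - s"], of "norm u"] s
      by (intro mult_left_mono) auto
    finally have "norm ((1 / m) *\<^sub>R B (P (t - s) u)) \<le> (1 / m) * (norm B * (D * norm u))"
      using m by (simp add: divide_right_mono)
    also have "\<dots> = norm B * D / m * norm u" by simp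
    also have "\<dots> \<le> M * norm u" unfolding M_def by (intro mult_right_mono) auto
    finally show ?thesis .
  qed
  have "ac_on 0 t (\<lambda>s. picard t x z 1 s - picard t x z 0 s)"
    using ac_on_traj[OF feedback_picard_integrable[OF tT, of z x 0]]
      ac_on_add[OF _ ac_on_lipschitz[of 0 t "\<lambda>_. - x" 0], of "traj x (feedback t z (picard t x z 0))"] by simp
  then obtain C where C: "C > 0" "\<And>s. s \<in> {0..t} \<Longrightarrow> norm (picard t x z 1 s - picard t x z 0 s) \<le> C"
    using ac_on_bounded by blast
  have "norm (picard t x z (Suc n) s - picard t x z n s) \<le> C * (1 / 2) ^ n * exp (2 * M * s)" if s: "s \<in> {0..t}" for n s
    using s
  proof (induction n arbitrary: s)
    case 0
    have "C * 1 \<le> C * exp (2 * M * s)" using C M 0 by (intro mult_left_mono) auto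
    then show ?case using C(2)[OF 0] by simp
  next
    case (Suc n)
    let ?f = "\<lambda>n. feedback t z (picard t x z n)"
    let ?k = "C * (1 / 2) ^ n"
    have fi: "set_integrable lborel {0..s} (?f n)" for n
      using Suc.prems by (intro set_integrable_subset[OF feedback_picard_integrable[OF tT]]) auto
    have "picard t x z (Suc (Suc n)) s - picard t x z (Suc n) s = (LBINT r:{0..s}. ?f (Suc n) r) - (LBINT r:{0..s}. ?f n r)"
      by (simp add: traj_def[of x _ s])
    also have "\<dots> = (LBINT r:{0..s}. ?f (Suc n) r - ?f n r)"
      by (rule set_integral_diff(2)[OF fi fi, symmetric])
    finally have eq: "picard t x z (Suc (Suc n)) s - picard t x z (Suc n) s = (LBINT r:{0..s}. ?f (Suc n) r - ?f n r)" .
    have "norm (picard t x z (Suc (Suc n)) s - picard t x z (Suc n) s) \<le> (LBINT r:{0..s}. norm (?f (Suc n) r - ?f n r))"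
      unfolding eq by (rule set_integral_norm_bound[OF set_integral_diff(1)[OF fi fi]])
    also have "\<dots> \<le> (LBINT r:{0..s}. M * (?k * exp (2 * M * r)))"
    proof (rule set_integral_mono)
      show "set_integrable lborel {0..s} (\<lambda>r. norm (?f (Suc n) r - ?f n r))"
        by (intro set_integrable_norm set_integral_diff(1) fi)
      show "set_integrable lborel {0..s} (\<lambda>r. M * (?k * exp (2 * M * r)))"
        by (intro borel_integrable_atLeastAtMost' continuous_intros)
      fix r assume "r \<in> {0..s}"
      then have r: "r \<in> {0..t}" using Suc.prems by auto
      have "norm (?f (Suc n) r - ?f n r) \<le> M * norm (picard t x z (Suc n) r - picard t x z n r)"
        unfolding feedback_diff by (rule Mb[OF r])
      also have "\<dots> \<le> M * (?k * exp (2 * M * r))" using M by (intro mult_left_mono Suc.IH[OF r]) auto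
      finally show "norm (?f (Suc n) r - ?f n r) \<le> M * (?k * exp (2 * M * r))" .
    qed
    also have "\<dots> = ?k / 2 * exp (2 * M * s) - ?k / 2 * exp (2 * M * 0)"
    proof -
      have "(LBINT r. M * (?k * exp (2 * M * r)) * indicator {0..s} r) = ?k / 2 * exp (2 * M * s) - ?k / 2 * exp (2 * M * 0)"
      proof (rule integral_FTC_Icc_real)
        show "((\<lambda>r. ?k / 2 * exp (2 * M * r)) has_real_derivative M * (?k * exp (2 * M * r))) (at r)" for r
          by (auto intro!: derivative_eq_intros)
      qed (use Suc.prems in \<open>auto intro!: continuous_intros\<close>)
      then show ?thesis
        unfolding set_lebesgue_integral_def real_scaleR_def
        by (simp only: mult.commute[of "indicat_real {0..s} r" for r])
    qed
    also have "\<dots> \<le> C * (1 / 2) ^ Suc n * exp (2 * M * s)" using C by simp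
    finally show ?case .
  qed
  then show ?thesis using that M C(1) Mb by blast
qed

text \<open>The control built from iterate \<open>n\<close> has iterate \<open>n + 1\<close> as its
  trajectory. Its deviation from the feedback is therefore \<open>B P / m\<close> applied to the
  difference of two consecutive iterates, and the loss, quadratic in it, decays like
  \<open>(1 / 4) ^ n\<close>. No limit of the iterates is taken.\<close>

theorem reward_picard:
  assumes t: "t \<in> {0..<T}" and x: "x \<in> H" and z: "z \<in> H"
  shows "(\<lambda>n. reward t x (feedback t z (picard t x z n)) z) \<longlonglongrightarrow> W t x z"
proof -
  have tT: "t < T" and t0: "0 \<le> t" using t by auto
  obtain M C where M: "M > 0" and C: "C > 0"
    and Mb: "\<And>s u. s \<in> {0..t} \<Longrightarrow> norm ((1 / m) *\<^sub>R B (P (t - s) u)) \<le> M * norm u"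
    and Cb: "\<And>n s. s \<in> {0..t} \<Longrightarrow> norm (picard t x z (Suc n) s - picard t x z n s) \<le> C * (1 / 2) ^ n * exp (2 * M * s)"
    using picard_contraction[OF t] by blast
  define v where "v n = feedback t z (picard t x z n)" for n
  define q where "q n s = v n s - feedback t z (traj x (v n)) s" for n s
  define K where "K = norm E * (M * (C * exp (2 * M * t)))\<^sup>2"
  have vc: "continuous_on {0..t} (v n)" for n unfolding v_def by (intro continuous_on_feedback continuous_on_picard tT)
  have vH: "v n s \<in> H" for n s unfolding v_def by (rule feedback_in)
  note eq = reward_eq[OF t x z set_square_integrable_continuous[OF vc] vH, folded q_def]
  have bound: "\<bar>LBINT s:{0..t}. inner (q n s) (E (q n s))\<bar> \<le> t * (K * (1 / 4) ^ n)" for n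
  proof -
    have nonneg: "0 \<le> (LBINT s:{0..t}. inner (q n s) (E (q n s)))"
      unfolding set_lebesgue_integral_def by (intro Bochner_Integration.integral_nonneg) (simp add: E_nonneg)
    have "(LBINT s:{0..t}. inner (q n s) (E (q n s))) \<le> (LBINT s:{0..t}. K * (1 / 4) ^ n)"
    proof (rule set_integral_mono[OF eq(2)])
      show "set_integrable lborel {0..t} (\<lambda>s. K * (1 / 4) ^ n)" by (intro borel_integrable_atLeastAtMost' continuous_intros)
      fix s assume s: "s \<in> {0..t}"
      have "q n s = (1 / m) *\<^sub>R B (P (t - s) (picard t x z n s - picard t x z (Suc n) s))"
        using feedback_diff[of t z "picard t x z n" s "picard t x z (Suc n)"] by (simp add: q_def v_def)
      then have "norm (q n s) \<le> M * norm (picard t x z (Suc n) s - picard t x z n s)"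
        using Mb[OF s, of "picard t x z n s - picard t x z (Suc n) s"] by (simp only: norm_minus_commute)
      also have "\<dots> \<le> M * (C * (1 / 2) ^ n * exp (2 * M * s))" using M by (intro mult_left_mono Cb s) simp
      also have "\<dots> \<le> M * (C * (1 / 2) ^ n * exp (2 * M * t))" using M C s by (intro mult_left_mono) auto
      finally have nq: "norm (q n s) \<le> M * (C * exp (2 * M * t)) * (1 / 2) ^ n" by (simp add: mult.commute mult.left_commute)
      have "inner (q n s) (E (q n s)) \<le> norm (q n s) * norm (E (q n s))" by (rule norm_cauchy_schwarz)
      also have "\<dots> \<le> norm (q n s) * (norm E * norm (q n s))" by (intro mult_left_mono norm_blinfun) simp
      also have "\<dots> = norm E * (norm (q n s))\<^sup>2" by (simp add: power2_eq_square)
      also have "\<dots> \<le> norm E * (M * (C * exp (2 * M * t)) * (1 / 2) ^ n)\<^sup>2"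
        using nq by (intro mult_left_mono power_mono) auto
      also have "\<dots> = K * ((1 / 2) ^ n)\<^sup>2" by (simp add: K_def power_mult_distrib)
      also have "((1 / 2 :: real) ^ n)\<^sup>2 = (1 / 4) ^ n" by (simp add: power_mult_distrib[symmetric] power2_eq_square)
      finally show "inner (q n s) (E (q n s)) \<le> K * (1 / 4) ^ n" .
    qed
    also have "\<dots> = t * (K * (1 / 4) ^ n)" using t0 by (simp add: set_lebesgue_integral_def)
    finally show ?thesis using nonneg by simp
  qed
  have "(\<lambda>n. (1 / 4) ^ n :: real) \<longlonglongrightarrow> 0" by (rule LIMSEQ_realpow_zero) auto
  then have null: "(\<lambda>n. t * (K * (1 / 4) ^ n)) \<longlonglongrightarrow> 0"
    by (intro tendsto_mult_right_zero)
  have "(\<lambda>n. LBINT s:{0..t}. inner (q n s) (E (q n s))) \<longlonglongrightarrow> 0"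
  proof (rule Lim_null_comparison[OF _ null])
    show "\<forall>\<^sub>F n in sequentially. norm (LBINT s:{0..t}. inner (q n s) (E (q n s))) \<le> t * (K * (1 / 4) ^ n)"
      using bound by simp
  qed
  then have "(\<lambda>n. W t x z - m / 2 * (LBINT s:{0..t}. inner (q n s) (E (q n s)))) \<longlonglongrightarrow> W t x z - m / 2 * 0"
    by (intro tendsto_intros)
  then show ?thesis using eq(1) by (simp add: v_def)
qed

end

subsection \<open>Reduction to bounded operators\<close>

lemma norm_half_eq: "norm_half L x = norm (A_half L x)"
  by (simp add: norm_half_def inner_half_def norm_eq_sqrt_inner)

context dirichlet_interval
begin

text \<open>The projection onto \<open>H\<close>, that is, the identity of the state space
  transported to all of \<open>l2\<close>.\<close>

definition I :: "l2 \<Rightarrow> l2" where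
  "I = diag (\<lambda>_. 1)"

lemma I_in: "I u \<in> H"
  unfolding I_def by (rule diag_in[where C=1]) simp

lemma inner_I_basis: "inner (I u) (sine L n) = inner u (sine L n)"
  unfolding I_def by (subst inner_diag_basis[where C=1]) auto

lemma I_on: "u \<in> H \<Longrightarrow> I u = u"
  by (intro coeff_eqI I_in) (simp_all add: inner_I_basis)

lemma bounded_linear_I: "bounded_linear I"
  unfolding I_def by (rule bounded_linear_diag[where C=1]) simp

lemma norm_I_le: "norm (I u) \<le> norm u"
  unfolding I_def using norm_diag_le[where C=1 and a="\<lambda>_. 1"] by simp

lemma J_I: "J (I u) = J u"
  by (intro coeff_eqI J_in) (simp add: inner_J_basis inner_I_basis)

lemma J_in_X_half': "J u \<in> X_half L"
  using J_in_X_half[OF I_in, of u] by (simp add: J_I)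

lemma A_half_J': "A_half L (J u) = I u"
  using A_half_J[OF I_in, of u] by (simp add: J_I)

interpretation J: bounded_linear J by (rule bounded_linear_J)
interpretation I: bounded_linear I by (rule bounded_linear_I)

text \<open>Conjugation by the coordinate map. \<open>J\<close> annihilates the orthogonal
  complement of \<open>H\<close>, so the result is defined on the whole type and vanishes on that
  complement.\<close>

definition lift_op :: "(l2 \<Rightarrow> l2) \<Rightarrow> l2 \<Rightarrow>\<^sub>L l2" where
  "lift_op T = Blinfun (\<lambda>u. A_half L (T (J u)))"

lemma A_half_add:
  assumes "x \<in> X_half L" "y \<in> X_half L"
  shows "x + y \<in> X_half L" "A_half L (x + y) = A_half L x + A_half L y"
proof -
  note x = X_half_cases[OF assms(1)] and y = X_half_cases[OF assms(2)]
  have H: "A_half L x + A_half L y \<in> H" using x(1) y(1) by (intro subspace_add subspace)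
  have eq: "J (A_half L x + A_half L y) = x + y" using x(2) y(2) by (simp add: J.add)
  show "x + y \<in> X_half L" using J_in_X_half[OF H] by (simp add: eq)
  show "A_half L (x + y) = A_half L x + A_half L y" using A_half_J[OF H] by (simp add: eq)
qed

lemma A_half_scale:
  assumes "x \<in> X_half L"
  shows "a *\<^sub>R x \<in> X_half L" "A_half L (a *\<^sub>R x) = a *\<^sub>R A_half L x"
proof -
  note x = X_half_cases[OF assms]
  have H: "a *\<^sub>R A_half L x \<in> H" using x(1) by (intro subspace_scale subspace)
  have eq: "J (a *\<^sub>R A_half L x) = a *\<^sub>R x" using x(2) by (simp add: J.scaleR)
  show "a *\<^sub>R x \<in> X_half L" using J_in_X_half[OF H] by (simp add: eq)
  show "A_half L (a *\<^sub>R x) = a *\<^sub>R A_half L x" using A_half_J[OF H] by (simp add: eq)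
qed

lemma bounded_opsD:
  assumes "T \<in> bounded_ops L"
  shows "\<And>x. x \<in> X_half L \<Longrightarrow> T x \<in> X_half L"
    "\<And>x y. x \<in> X_half L \<Longrightarrow> y \<in> X_half L \<Longrightarrow> T (x + y) = T x + T y"
    "\<And>a x. x \<in> X_half L \<Longrightarrow> T (a *\<^sub>R x) = a *\<^sub>R T x"
  using assms unfolding bounded_ops_def by auto

lemma lift_op_apply:
  assumes T: "T \<in> bounded_ops L"
  shows "lift_op T u = A_half L (T (J u))"
proof -
  note D = bounded_opsD[OF T]
  obtain C where C: "\<And>x. x \<in> X_half L \<Longrightarrow> norm_half L (T x) \<le> C * norm_half L x"
    using T unfolding bounded_ops_def by blast
  have "bounded_linear (\<lambda>u. A_half L (T (J u)))"
  proof (rule bounded_linear_intro[where K="\<bar>C\<bar>"])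
    show "A_half L (T (J (u + v))) = A_half L (T (J u)) + A_half L (T (J v))" for u v
      by (simp add: J.add D J_in_X_half' A_half_add)
    show "A_half L (T (J (a *\<^sub>R u))) = a *\<^sub>R A_half L (T (J u))" for a u
      by (simp add: J.scaleR D J_in_X_half' A_half_scale)
    show "norm (A_half L (T (J u))) \<le> norm u * \<bar>C\<bar>" for u
    proof -
      have "norm (A_half L (T (J u))) \<le> C * norm (I u)"
        using C[OF J_in_X_half', of u] by (simp add: norm_half_eq A_half_J')
      also have "\<dots> \<le> \<bar>C\<bar> * norm u" using norm_I_le[of u] by (intro mult_mono) auto
      finally show ?thesis by (simp add: mult.commute)
    qed
  qed
  then show ?thesis unfolding lift_op_def by (simp add: bounded_linear_Blinfun_apply)
qed

lemma lift_op_in: "T \<in> bounded_ops L \<Longrightarrow> lift_op T u \<in> H"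
  by (simp add: lift_op_apply X_half_cases bounded_opsD J_in_X_half')

lemma J_lift_op: "T \<in> bounded_ops L \<Longrightarrow> J (lift_op T u) = T (J u)"
  by (simp add: lift_op_apply X_half_cases bounded_opsD J_in_X_half')

lemma bounded_opsI:
  assumes "\<And>x. x \<in> X_half L \<Longrightarrow> T x = J (blinfun_apply b (A_half L x))"
  shows "T \<in> bounded_ops L"
  unfolding bounded_ops_def mem_Collect_eq
proof (intro conjI ballI allI exI)
  fix x assume x: "x \<in> X_half L"
  show "T x \<in> X_half L" by (simp add: assms x J_in_X_half')
  show "T (a *\<^sub>R x) = a *\<^sub>R T x" for a
    by (simp add: assms x A_half_scale blinfun.scaleR_right J.scaleR)
  show "T (x + y) = T x + T y" if "y \<in> X_half L" for y
    using that by (simp add: assms x A_half_add blinfun.add_right J.add)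
  have "norm_half L (T x) \<le> norm (b (A_half L x))"
    by (simp add: norm_half_eq assms x A_half_J' norm_I_le)
  also have "\<dots> \<le> norm b * norm (A_half L x)" by (rule norm_blinfun)
  finally show "norm_half L (T x) \<le> norm b * norm_half L x" by (simp add: norm_half_eq)
qed

text \<open>Agreement on the state space determines \<open>b\<close> only on \<open>H\<close> and up
  to projection of its values; the last two premises fix the rest.\<close>

lemma lift_op_eq:
  assumes "\<And>x. x \<in> X_half L \<Longrightarrow> T x = J (blinfun_apply b (A_half L x))"
    and "\<And>u. blinfun_apply b u \<in> H" "\<And>u. blinfun_apply b (I u) = blinfun_apply b u"
  shows "lift_op T = b"
proof (rule blinfun_eqI)
  have "T \<in> bounded_ops L" by (rule bounded_opsI[OF assms(1)])
  then show "lift_op T u = b u" for u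
    by (simp add: lift_op_apply assms J_in_X_half' A_half_J' I_on)
qed

lemma lift_op_I:
  assumes "T \<in> bounded_ops L"
  shows "lift_op T (I u) = lift_op T u"
  by (simp add: lift_op_apply[OF assms] J_I)

text \<open>\<open>op_norm\<close> is a supremum of reals, informative only once the set is known to
  be bounded above; the norm of the lifted operator supplies this bound. The inequality suffices to
  carry convergence to zero over to the lifted operators.\<close>

lemma norm_lift_op_le:
  assumes T: "T \<in> bounded_ops L"
  shows "norm (lift_op T) \<le> op_norm L T"
proof -
  let ?S = "{x \<in> X_half L. norm_half L x \<le> 1}"
  have bdd: "bdd_above ((\<lambda>x. norm_half L (T x)) ` ?S)"
  proof (rule bdd_aboveI2)
    fix x assume x: "x \<in> ?S"
    then have "norm_half L (T x) = norm (lift_op T (A_half L x))"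
      using X_half_cases[of x] by (simp add: lift_op_apply[OF T] norm_half_eq)
    also have "\<dots> \<le> norm (lift_op T) * norm (A_half L x)" by (rule norm_blinfun)
    also have "\<dots> \<le> norm (lift_op T) * 1" using x by (intro mult_left_mono) (auto simp: norm_half_eq)
    finally show "norm_half L (T x) \<le> norm (lift_op T)" by simp
  qed
  have unit: "norm (lift_op T u) \<le> op_norm L T" if "norm u \<le> 1" for u
  proof -
    have "J u \<in> ?S" using norm_I_le[of u] that by (simp add: J_in_X_half' norm_half_eq A_half_J')
    then have "norm_half L (T (J u)) \<le> op_norm L T"
      unfolding op_norm_def by (rule cSUP_upper[OF _ bdd])
    then show ?thesis by (simp add: lift_op_apply[OF T] norm_half_eq)
  qed
  show ?thesis
  proof (rule norm_blinfun_bound)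
    show "0 \<le> op_norm L T" using unit[of 0] by simp
    fix u :: l2
    show "norm (lift_op T u) \<le> op_norm L T * norm u"
    proof (cases "u = 0")
      case False
      have "norm (lift_op T (u /\<^sub>R norm u)) \<le> op_norm L T" using False by (intro unit) simp
      then have "norm (lift_op T u) / norm u \<le> op_norm L T" by (simp add: blinfun.scaleR_right divide_inverse_commute)
      then show ?thesis using False by (simp add: field_simps)
    qed simp
  qed
qed

text \<open>Lifting respects linear combinations, so the difference quotient minus its limit lifts
  to the corresponding expression, whose norm is at most the \<open>op_norm\<close> that tends to
  zero.\<close>

lemma has_op_derivative_lift:
  assumes deriv: "has_op_derivative L P D t S" and P: "\<And>s. s \<in> S \<Longrightarrow> P s \<in> bounded_ops L" and t: "t \<in> S"
  shows "((\<lambda>s. lift_op (P s)) has_vector_derivative lift_op D) (at t within S)"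
proof -
  have D: "D \<in> bounded_ops L"
    and lim: "((\<lambda>s. op_norm L (\<lambda>x. (P s x - P t x) /\<^sub>R (s - t) - D x)) \<longlongrightarrow> 0) (at t within S)"
    using deriv by (auto simp: has_op_derivative_def)
  let ?q = "\<lambda>s. (1 / (s - t)) *\<^sub>R (lift_op (P s) - lift_op (P t)) - lift_op D"
  have bound: "norm (?q s) \<le> op_norm L (\<lambda>x. (P s x - P t x) /\<^sub>R (s - t) - D x)" if s: "s \<in> S" for s
  proof -
    let ?T = "\<lambda>x. (P s x - P t x) /\<^sub>R (s - t) - D x"
    have T: "?T x = J (blinfun_apply (?q s) (A_half L x))" if x: "x \<in> X_half L" for x
      using J_lift_op[OF P[OF s], of "A_half L x"] J_lift_op[OF P[OF t], of "A_half L x"]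
        J_lift_op[OF D, of "A_half L x"] X_half_cases(2)[OF x]
      by (simp add: blinfun.diff_left blinfun.scaleR_left J.diff J.scaleR divide_inverse)
    have "lift_op ?T = ?q s"
    proof (rule lift_op_eq[OF T])
      show "?q s u \<in> H" for u
        unfolding blinfun.diff_left blinfun.scaleR_left
        by (intro subspace_diff subspace_scale subspace lift_op_in P D s t)
      show "?q s (I u) = ?q s u" for u
        by (simp add: blinfun.diff_left blinfun.scaleR_left lift_op_I P D s t)
    qed
    then show ?thesis using norm_lift_op_le[OF bounded_opsI[OF T]] by metis
  qed
  have "(?q \<longlongrightarrow> 0) (at t within S)"
  proof (rule Lim_null_comparison[OF _ lim])
    show "\<forall>\<^sub>F s in at t within S. norm (?q s) \<le> op_norm L (\<lambda>x. (P s x - P t x) /\<^sub>R (s - t) - D x)"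
      using bound by (auto simp: eventually_at_topological)
  qed
  then have q0: "((\<lambda>s. norm (?q s)) \<longlongrightarrow> 0) (at t within S)" by (rule tendsto_norm_zero)
  show ?thesis
    unfolding has_vector_derivative_def has_derivative_within
  proof
    show "((\<lambda>s. (1 / norm (s - t)) *\<^sub>R (lift_op (P s) - (lift_op (P t) + (s - t) *\<^sub>R lift_op D))) \<longlongrightarrow> 0) (at t within S)"
    proof (rule Lim_null_comparison[OF _ q0])
      have "norm ((1 / norm (s - t)) *\<^sub>R (lift_op (P s) - (lift_op (P t) + (s - t) *\<^sub>R lift_op D))) \<le> norm (?q s)"
        if "s \<noteq> t" for s
      proof -
        have "lift_op (P s) - (lift_op (P t) + (s - t) *\<^sub>R lift_op D) = (s - t) *\<^sub>R ?q s"
          using that by (simp add: scaleR_diff_right)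
        then show ?thesis using that by simp
      qed
      then show "\<forall>\<^sub>F s in at t within S. norm ((1 / norm (s - t)) *\<^sub>R (lift_op (P s) - (lift_op (P t) + (s - t) *\<^sub>R lift_op D))) \<le> norm (?q s)"
        by (auto simp: eventually_at_topological)
    qed
  qed (rule bounded_linear_scaleR_left)
qed

text \<open>The definite description is justified by representing the lifted functional as a vector
  \<open>v\<close>; testing on the states \<open>J (sine L n)\<close> shows that \<open>J v\<close>
  is the only possible value.\<close>

lemma adj_property:
  assumes T: "T \<in> bounded_ops L" and y: "y \<in> X_half L"
  shows "adj L T y \<in> X_half L" "\<And>x. x \<in> X_half L \<Longrightarrow> inner_half L (T x) y = inner_half L x (adj L T y)"
proof -
  have "bounded_linear (\<lambda>u. inner (lift_op T u) (A_half L y))"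
    by (intro bounded_linear_compose[OF bounded_linear_inner_left blinfun.bounded_linear_right])
  then obtain v where v: "v \<in> H" "\<And>u. u \<in> H \<Longrightarrow> inner (lift_op T u) (A_half L y) = inner u v"
    using riesz_representation by blast
  have ex: "J v \<in> X_half L \<and> (\<forall>x\<in>X_half L. inner_half L (T x) y = inner_half L x (J v))"
  proof (intro conjI ballI)
    fix x assume x: "x \<in> X_half L"
    show "inner_half L (T x) y = inner_half L x (J v)"
      using v(2)[OF X_half_cases(1)[OF x]] v(1)
      by (simp add: inner_half_def lift_op_apply[OF T] X_half_cases(2)[OF x] A_half_J)
  qed (rule J_in_X_half')
  have uniq: "w = J v" if w: "w \<in> X_half L \<and> (\<forall>x\<in>X_half L. inner_half L (T x) y = inner_half L x w)" for w
  proof -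
    have "A_half L w = v"
    proof (rule coeff_eqI)
      show "inner (A_half L w) (sine L n) = inner v (sine L n)" for n
      proof -
        have "inner_half L (J (sine L n)) w = inner_half L (J (sine L n)) (J v)"
          using w ex J_in_X_half'[of "sine L n"] by metis
        then show ?thesis
          using v(1) by (simp add: inner_half_def A_half_J basis_in inner_commute)
      qed
    qed (use w v X_half_cases in auto)
    then show ?thesis using X_half_cases(2)[of w] w by auto
  qed
  have "adj L T y = J v" unfolding adj_def using ex uniq by (rule the_equality)
  then show "adj L T y \<in> X_half L" "\<And>x. x \<in> X_half L \<Longrightarrow> inner_half L (T x) y = inner_half L x (adj L T y)"
    using ex by auto
qed

lemma inner_half_J: "u \<in> H \<Longrightarrow> inner_half L (J u) x = inner u (A_half L x)"
  by (simp add: inner_half_def A_half_J)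

end

section \<open>Transfer of the verification to the state space\<close>

theorem theorem3p8:
  fixes L \<kappa> m m_low \<mu> c :: real
    and K :: "l2 \<Rightarrow> l2"
    and P Q R :: "real \<Rightarrow> l2 \<Rightarrow> l2"
  assumes "0 < L" and "0 < \<kappa>" and "0 < m"
    and "0 < m_low" and "m_low < m"
    and standing: "\<forall>\<nu>\<in>{0<..1}. \<forall>t\<in>{0<..<t_bar \<kappa> m \<nu>}. \<forall>x\<in>X_half L.
                     value_fn L \<kappa> m_low (\<lambda>_. 0) \<nu> t x < \<infinity>"
    and "\<mu> \<in> {0<..1}" and "0 \<le> c"
    and K: "K \<in> bounded_ops L" "boundedly_invertible L K"
    and PQR: "\<forall>t\<in>{0..<t_bar \<kappa> m \<mu>}. P t \<in> bounded_ops L \<and> Q t \<in> bounded_ops L \<and> R t \<in> bounded_ops L"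
    and P_ode: "\<forall>t\<in>{0..<t_bar \<kappa> m \<mu>}. has_op_derivative L P
                  (\<lambda>x. \<kappa> *\<^sub>R x + (1 / m) *\<^sub>R P t (AIA L \<mu> (P t x))) t {0..<t_bar \<kappa> m \<mu>}"
    and P_init: "\<forall>x\<in>X_half L. P 0 x = - c *\<^sub>R M_op L K x"
    and Q_ode: "\<forall>t\<in>{0..<t_bar \<kappa> m \<mu>}. has_op_derivative L Q
                  (\<lambda>x. (1 / m) *\<^sub>R P t (AIA L \<mu> (Q t x))) t {0..<t_bar \<kappa> m \<mu>}"
    and Q_init: "\<forall>x\<in>X_half L. Q 0 x = c *\<^sub>R M_op L K x"
    and R_ode: "\<forall>t\<in>{0..<t_bar \<kappa> m \<mu>}. has_op_derivative L R
                  (\<lambda>x. (1 / m) *\<^sub>R adj L (Q t) (AIA L \<mu> (Q t x))) t {0..<t_bar \<kappa> m \<mu>}"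
    and R_init: "\<forall>x\<in>X_half L. R 0 x = - c *\<^sub>R M_op L K x"
  shows "\<forall>t\<in>{0..<t_bar \<kappa> m \<mu>}. \<forall>x\<in>X_half L. \<forall>z\<in>X_half L.
           value_fn L \<kappa> m (\<lambda>y. psi_c L K c y z) \<mu> t x = ereal (W_breve L P Q R t x z)"
proof -
  interpret dirichlet_interval L by unfold_locales fact
  interpret J: bounded_linear J by (rule bounded_linear_J)
  have \<mu>0: "\<mu> \<noteq> 0" using \<open>\<mu> \<in> {0<..1}\<close> by auto
  define T where "T = t_bar \<kappa> m \<mu>"
  let ?I = "Blinfun I" and ?B = "Blinfun (B \<mu>)"
  let ?E = "Blinfun (\<lambda>u. J (J u) + \<mu>\<^sup>2 *\<^sub>R u)"
  let ?P = "\<lambda>t. lift_op (P t)" and ?Q = "\<lambda>t. lift_op (Q t)" and ?R = "\<lambda>t. blinfun_apply (lift_op (R t))"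
  have [simp]: "blinfun_apply ?I = I" by (rule bounded_linear_Blinfun_apply[OF bounded_linear_I])
  have [simp]: "blinfun_apply ?B = B \<mu>" by (rule bounded_linear_Blinfun_apply[OF bounded_linear_B[OF \<mu>0]])
  have [simp]: "blinfun_apply ?E = (\<lambda>u. J (J u) + \<mu>\<^sup>2 *\<^sub>R u)"
    by (intro bounded_linear_Blinfun_apply bounded_linear_add bounded_linear_compose[OF bounded_linear_J bounded_linear_J]
        bounded_linear_scaleR_right)
  have ops: "P t \<in> bounded_ops L" "Q t \<in> bounded_ops L" "R t \<in> bounded_ops L" if "t \<in> {0..<T}" for t
    using PQR that by (auto simp: T_def)
  have K_init: "inner u (A_half L (M_op L K (J v))) = inner (lift_op K u) (lift_op K v)" if "u \<in> H" for u v
  proof -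
    have Kv: "K (J v) \<in> X_half L" by (intro bounded_opsD(1)[OF K(1)] J_in_X_half')
    have "inner u (A_half L (M_op L K (J v))) = inner_half L (J u) (adj L K (K (J v)))"
      using that by (simp add: M_op_def inner_half_J)
    also have "\<dots> = inner_half L (K (J u)) (K (J v))"
      by (rule adj_property(2)[OF K(1) Kv J_in_X_half', symmetric])
    finally show ?thesis by (simp add: inner_half_def lift_op_apply[OF K(1)])
  qed
  have M_in: "M_op L K (J v) \<in> X_half L" for v
    unfolding M_op_def by (intro adj_property(1)[OF K(1)] bounded_opsD(1)[OF K(1)] J_in_X_half')
  have t_bar_pos: "0 < T"
    using \<open>0 < \<kappa>\<close> \<open>0 < m\<close> \<open>\<mu> \<in> {0<..1}\<close> by (simp add: T_def t_bar_def)
  then have zero: "0 \<in> {0..<T}" by simp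
  \<comment> \<open>In coordinates the form of \<open>K' K\<close> is the inner product of the
    lifted images under \<open>K\<close>: this gives the symmetry of \<open>P 0\<close> at once, and
    the terminal payoff later.\<close>
  have init: "inner u (?P 0 v) = - c * inner (lift_op K u) (lift_op K v)"
    "inner u (?Q 0 v) = c * inner (lift_op K u) (lift_op K v)"
    "inner u (?R 0 v) = - c * inner (lift_op K u) (lift_op K v)" if "u \<in> H" for u v
    using K_init[OF that, of v] ops[OF zero] P_init Q_init R_init
    by (simp_all add: lift_op_apply J_in_X_half' A_half_scale[OF M_in] del: scaleR_minus_left)
  interpret S: riccati_system H ?I ?B ?E ?P ?Q ?R \<kappa> m T
  proof
    show "subspace H" by (rule subspace)
    show "?I u = u" if "u \<in> H" for u using that by (simp add: I_on)
    show "?I u \<in> H" for u by (simp add: I_in)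
    show "?B u \<in> H" for u by (simp add: B_in[OF \<mu>0])
    show "inner (?B u) v = inner u (?B v)" for u v by (simp add: B_selfadjoint[OF \<mu>0])
    show "?E (?B u) = u" if "u \<in> H" for u using J_square_B[OF \<mu>0 that] by simp
    show "inner (?E u) v = inner u (?E v)" for u v
      by (simp add: inner_add_left inner_add_right J_selfadjoint)
    show "0 \<le> inner u (?E u)" for u
    proof -
      have "inner u (?E u) = inner (J u) (J u) + \<mu>\<^sup>2 * inner u u"
        using J_selfadjoint[of u "J u"] by (simp add: inner_add_right)
      then show ?thesis by simp
    qed
    show "0 < m" by fact
    fix t assume t: "t \<in> {0..<T}"
    note PQRt = ops[OF t]
    show "?P t u \<in> H" "?Q t u \<in> H" for u by (simp_all add: lift_op_in PQRt)
    have J_BP: "AIA L \<mu> (T' (J u)) = J (B \<mu> (lift_op T' u))" if "T' \<in> bounded_ops L" for T' u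
      using AIA_J[OF \<mu>0 lift_op_in[OF that, of u]] by (simp add: J_lift_op that)
    let ?P' = "\<kappa> *\<^sub>R ?I + (1 / m) *\<^sub>R (?P t o\<^sub>L ?B o\<^sub>L ?P t)" and ?Q' = "(1 / m) *\<^sub>R (?P t o\<^sub>L ?B o\<^sub>L ?Q t)"
    have "lift_op (\<lambda>x. \<kappa> *\<^sub>R x + (1 / m) *\<^sub>R P t (AIA L \<mu> (P t x))) = ?P'"
    proof (rule lift_op_eq)
      fix x assume x: "x \<in> X_half L"
      note X = X_half_cases[OF x]
      show "\<kappa> *\<^sub>R x + (1 / m) *\<^sub>R P t (AIA L \<mu> (P t x)) = J (?P' (A_half L x))"
        using J_BP[OF PQRt(1), of "A_half L x"] X
        by (simp add: blinfun.add_left blinfun.scaleR_left J.add J.scaleR J_I J_lift_op[OF PQRt(1)])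
    next
      show "?P' u \<in> H" for u
        by (simp add: blinfun.add_left blinfun.scaleR_left subspace_add subspace_scale subspace I_in lift_op_in PQRt)
      show "?P' (I u) = ?P' u" for u
        by (simp add: blinfun.add_left blinfun.scaleR_left I_on I_in lift_op_I PQRt)
    qed
    then show "(?P has_vector_derivative ?P') (at t within {0..<T})"
      using has_op_derivative_lift[OF P_ode[folded T_def, rule_format, OF t] ops(1) t] by simp
    have "lift_op (\<lambda>x. (1 / m) *\<^sub>R P t (AIA L \<mu> (Q t x))) = ?Q'"
    proof (rule lift_op_eq)
      fix x assume x: "x \<in> X_half L"
      note X = X_half_cases[OF x]
      show "(1 / m) *\<^sub>R P t (AIA L \<mu> (Q t x)) = J (?Q' (A_half L x))"
        using J_BP[OF PQRt(2), of "A_half L x"] X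
        by (simp add: blinfun.scaleR_left J.scaleR J_lift_op[OF PQRt(1)])
    next
      show "?Q' u \<in> H" for u
        by (simp add: blinfun.scaleR_left subspace_scale subspace lift_op_in PQRt)
      show "?Q' (I u) = ?Q' u" for u
        by (simp add: blinfun.scaleR_left lift_op_I PQRt)
    qed
    then show "(?Q has_vector_derivative ?Q') (at t within {0..<T})"
      using has_op_derivative_lift[OF Q_ode[folded T_def, rule_format, OF t] ops(2) t] by simp
    let ?D = "\<lambda>x. (1 / m) *\<^sub>R adj L (Q t) (AIA L \<mu> (Q t x))"
    \<comment> \<open>Boundedness of the right-hand side is part of
      \<open>has_op_derivative\<close>, so the adjoint need not be shown bounded separately.\<close>
    have D: "?D \<in> bounded_ops L"
      using R_ode[folded T_def, rule_format, OF t] by (simp add: has_op_derivative_def)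
    have dR: "((\<lambda>s. lift_op (R s)) has_vector_derivative lift_op ?D) (at t within {0..<T})"
      using has_op_derivative_lift[OF R_ode[folded T_def, rule_format, OF t] ops(3) t] by simp
    fix z assume z: "z \<in> H"
    have adj: "adj L (Q t) (J u) \<in> X_half L" for u by (rule adj_property(1)[OF PQRt(2) J_in_X_half'])
    have "inner z (lift_op ?D z) = (1 / m) * inner z (A_half L (adj L (Q t) (J (B \<mu> (?Q t z)))))"
      by (simp add: lift_op_apply[OF D] J_BP[OF PQRt(2)] A_half_scale[OF adj])
    also have "inner z (A_half L (adj L (Q t) (J (B \<mu> (?Q t z))))) = inner_half L (J z) (adj L (Q t) (J (B \<mu> (?Q t z))))"
      using z by (simp add: inner_half_J)
    also have "\<dots> = inner_half L (Q t (J z)) (J (B \<mu> (?Q t z)))"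
      by (rule adj_property(2)[OF PQRt(2) J_in_X_half' J_in_X_half', symmetric])
    also have "\<dots> = inner (?Q t z) (?B (?Q t z))"
      by (simp add: inner_half_def lift_op_apply[OF PQRt(2)] A_half_J' I_on B_in[OF \<mu>0])
    finally have zD: "inner z (lift_op ?D z) = (1 / m) * inner (?Q t z) (?B (?Q t z))" .
    have "((\<lambda>s. inner z (lift_op (R s) z)) has_vector_derivative inner z (lift_op ?D z)) (at t within {0..<T})"
      by (rule bounded_linear.has_vector_derivative[OF bounded_linear_inner_right
          bounded_linear.has_vector_derivative[OF blinfun.bounded_linear_left dR]])
    then show "((\<lambda>t. inner z (?R t z)) has_real_derivative (1 / m) * inner (?Q t z) (?B (?Q t z))) (at t within {0..<T})"
      by (simp only: has_real_derivative_iff_has_vector_derivative zD)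
  next
    show "inner (?P 0 u) v = inner u (?P 0 v)" if "u \<in> H" "v \<in> H" for u v
      using init(1)[OF that(1), of v] init(1)[OF that(2), of u] by (simp add: inner_commute)
  qed
  show ?thesis
  proof (intro ballI)
    fix t x z assume "t \<in> {0..<t_bar \<kappa> m \<mu>}" and x: "x \<in> X_half L" and z: "z \<in> X_half L"
    then have t: "t \<in> {0..<T}" by (simp add: T_def)
    define u where "u = A_half L x"
    define \<zeta> where "\<zeta> = A_half L z"
    have u: "u \<in> H" "J u = x" and \<zeta>: "\<zeta> \<in> H" "J \<zeta> = z"
      using X_half_cases[OF x] X_half_cases[OF z] by (auto simp: u_def \<zeta>_def)
    let ?pay = "payoff L \<kappa> m (\<lambda>y. psi_c L K c y z) \<mu> t x"
    have W: "W_breve L P Q R t x z = S.W t u \<zeta>"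
      using ops[OF t] by (simp add: W_breve_def S.W_def inner_half_def lift_op_apply u \<zeta> flip: u_def \<zeta>_def)
    \<comment> \<open>Expanding the square: the signs \<open>-c\<close>, \<open>+c\<close>,
      \<open>-c\<close> of the three initial values are those of its two squares and its mixed
      term.\<close>
    have terminal: "psi_c L K c (J y) z = S.W 0 y \<zeta>" if y: "y \<in> H" for y
    proof -
      have "A_half L (K (J y - z)) = lift_op K y - lift_op K \<zeta>"
        by (simp add: \<zeta>(2)[symmetric] J.diff[symmetric] lift_op_apply[OF K(1), symmetric] blinfun.diff_right)
      then have "psi_c L K c (J y) z = - (c / 2) * (norm (lift_op K y - lift_op K \<zeta>))\<^sup>2"
        by (simp add: psi_c_def norm_half_eq)
      also have "\<dots> = S.W 0 y \<zeta>"
        unfolding S.W_def init[OF y] init[OF \<zeta>(1)] power2_norm_eq_inner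
        by (simp add: inner_diff_left inner_diff_right inner_commute[of "lift_op K \<zeta>" "lift_op K y"] algebra_simps)
      finally show ?thesis .
    qed
    have control: "set_borel_measurable lborel {0..t} (\<lambda>s. A_half L (w s))"
      "set_integrable lborel {0..t} (\<lambda>s. (norm (A_half L (w s)))\<^sup>2)"
      "\<And>s. s \<in> {0..t} \<Longrightarrow> w s \<in> X_half L"
      if "w \<in> controls L t" for w
      using that by (auto simp: controls_def norm_half_eq)
    have pay: "?pay w = S.reward t u (\<lambda>s. A_half L (w s)) \<zeta>" if w: "w \<in> controls L t" for w
    proof -
      define v where "v s = A_half L (w s)" for s
      note c = control[OF w, folded v_def]
      have vH: "v s \<in> H" "J (v s) = w s" if "s \<in> {0..t}" for s
        using X_half_cases[OF c(3)[OF that]] by (simp_all add: v_def)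
      have vi: "set_integrable lborel {0..t} v" by (rule set_square_integrable_imp_integrable[OF c(1,2)])
      \<comment> \<open>The trajectory is an integral in \<open>l2\<close>; as a bounded operator,
        \<open>J\<close> commutes with it, so the coordinate of the trajectory is the trajectory of
        the coordinate.\<close>
      have traj: "trajectory x w s = J (S.traj u v s)" and trajH: "S.traj u v s \<in> H" if s: "s \<in> {0..t}" for s
      proof -
        have "set_integrable lborel {0..s} v" using s by (intro set_integrable_subset[OF vi]) auto
        then have "J (LBINT r:{0..s}. v r) = (LBINT r. J (indicat_real {0..s} r *\<^sub>R v r))"
          unfolding set_lebesgue_integral_def set_integrable_def
          by (rule integral_bounded_linear[OF bounded_linear_J, symmetric])
        also have "\<dots> = (LBINT r:{0..s}. w r)"
          unfolding set_lebesgue_integral_def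
          by (rule Bochner_Integration.integral_cong) (use s vH in \<open>auto simp: indicator_def J.scaleR\<close>)
        finally show "trajectory x w s = J (S.traj u v s)"
          by (simp add: trajectory_def S.traj_def J.add u)
        show "S.traj u v s \<in> H" by (rule S.traj_in[OF u(1) vi vH(1) s])
      qed
      \<comment> \<open>\<open>A^(1/2)\<close> undoes \<open>J\<close> in the first component,
        leaving \<open>w = J v\<close>; the second contributes \<open>\<mu> v\<close>.
        Self-adjointness of \<open>J\<close> collects both into \<open>E\<close>.\<close>
      have cost: "(norm_half_pair L (J_mu L \<mu> (w s)))\<^sup>2 = inner (v s) (?E (v s))" if s: "s \<in> {0..t}" for s
      proof -
        have wH: "w s \<in> H" using vH(2)[OF s] J_in by metis
        have "(norm_half_pair L (J_mu L \<mu> (w s)))\<^sup>2 = (norm (w s))\<^sup>2 + (\<mu> * norm (v s))\<^sup>2"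
          by (simp add: norm_half_pair_def J_mu_def J_op_eq[OF wH] norm_half_eq A_half_J wH A_half_scale[OF c(3)[OF s]] v_def power_mult_distrib)
        also have "\<dots> = inner (J (v s)) (J (v s)) + \<mu>\<^sup>2 * inner (v s) (v s)"
          using vH(2)[OF s] by (simp add: power2_norm_eq_inner power_mult_distrib)
        finally show ?thesis by (simp add: J_selfadjoint inner_add_right)
      qed
      have "(LBINT s:{0..t}. \<kappa> / 2 * (norm_half L (trajectory x w s))\<^sup>2 - m / 2 * (norm_half_pair L (J_mu L \<mu> (w s)))\<^sup>2)
          = (LBINT s:{0..t}. \<kappa> / 2 * (norm (S.traj u v s))\<^sup>2 - m / 2 * inner (v s) (?E (v s)))"
      proof (rule set_lebesgue_integral_cong)
        show "\<forall>s. s \<in> {0..t} \<longrightarrow> \<kappa> / 2 * (norm_half L (trajectory x w s))\<^sup>2 - m / 2 * (norm_half_pair L (J_mu L \<mu> (w s)))\<^sup>2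
            = \<kappa> / 2 * (norm (S.traj u v s))\<^sup>2 - m / 2 * inner (v s) (?E (v s))"
        proof (intro allI impI)
          fix s assume s: "s \<in> {0..t}"
          show "\<kappa> / 2 * (norm_half L (trajectory x w s))\<^sup>2 - m / 2 * (norm_half_pair L (J_mu L \<mu> (w s)))\<^sup>2
            = \<kappa> / 2 * (norm (S.traj u v s))\<^sup>2 - m / 2 * inner (v s) (?E (v s))"
            by (simp only: norm_half_eq traj[OF s] cost[OF s] A_half_J[OF trajH[OF s]])
        qed
      qed simp
      moreover have "psi_c L K c (trajectory x w t) z = S.W 0 (S.traj u v t) \<zeta>"
        using traj[of t] trajH[of t] terminal t by simp
      ultimately show ?thesis unfolding payoff_def S.reward_def v_def by simp
    qed
    have le: "?pay w \<le> S.W t u \<zeta>" if w: "w \<in> controls L t" for w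
      unfolding pay[OF w] using control[OF w] X_half_cases by (intro S.reward_le t u \<zeta>) auto
    \<comment> \<open>The Picard feedbacks, mapped back to the state space; by continuity their
      coordinates are square integrable.\<close>
    define w where "w n s = J (S.feedback t \<zeta> (S.picard t u \<zeta> n) s)" for n s
    have Aw: "A_half L (w n s) = S.feedback t \<zeta> (S.picard t u \<zeta> n) s" for n s
      unfolding w_def by (rule A_half_J[OF S.feedback_in])
    have fc: "continuous_on {0..t} (S.feedback t \<zeta> (S.picard t u \<zeta> n))" for n
      using t by (intro S.continuous_on_feedback S.continuous_on_picard) auto
    have wc: "w n \<in> controls L t" for n
      using set_square_integrable_continuous[OF fc]
      by (auto simp: controls_def norm_half_eq Aw) (simp add: w_def J_in_X_half')
    have lim: "(\<lambda>n. ?pay (w n)) \<longlonglongrightarrow> S.W t u \<zeta>"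
      using S.reward_picard[OF t u(1) \<zeta>(1)] by (simp add: pay[OF wc] Aw)
    show "value_fn L \<kappa> m (\<lambda>y. psi_c L K c y z) \<mu> t x = ereal (W_breve L P Q R t x z)"
      unfolding value_fn_def W
    proof (rule antisym)
      show "(SUP w\<in>controls L t. ereal (?pay w)) \<le> ereal (S.W t u \<zeta>)"
        by (intro SUP_least) (simp add: le)
      \<comment> \<open>The candidate is a limit of payoffs of admissible controls, and each of
        these is below the supremum.\<close>
      show "ereal (S.W t u \<zeta>) \<le> (SUP w\<in>controls L t. ereal (?pay w))"
      proof (rule LIMSEQ_le_const2)
        show "(\<lambda>n. ereal (?pay (w n))) \<longlonglongrightarrow> ereal (S.W t u \<zeta>)" using lim by simp
        show "\<exists>N. \<forall>n\<ge>N. ereal (?pay (w n)) \<le> (SUP w\<in>controls L t. ereal (?pay w))"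
          by (intro exI allI impI SUP_upper wc)
      qed
    qed
  qed
qed

end
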